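(* Let $(\Sigma_M,\sigma)$ be a transitive countable-state Markov shift with all column sums $c_j=\sum_i m_{ij}$ finite, and let $Q=(q_{ji})$ be the stochastic matrix $q_{ji}=m_{ij}/c_j$. Given any point $y_0\in\Sigma_M$, for a random choice $(y_n)_{n\ge 0}$ of the backward trajectory of $y_0$ the following holds. (a) If $Q$ is positive recurrent, then $(y_n)$ equidistributes for the fair measure $\mu=\mathrm{Markov}(\pi,P)$. (b) If $Q$ is null recurrent, then $(y_n)$ is dense in $\Sigma_M$, but visits each cylinder set $[i]$, $i\in\mathcal I$, with limiting frequency zero, i.e. $\frac1N\#\{0\le n<N : y_n\in[i]\}\to 0$ as $N\to\infty$. (c) If $Q$ is transient, then $(y_n)$ visits each cylinder set $[i]$, $i\in\mathcal I$, only finitely often.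
   Context: Markov shift: $\mathcal I$ is a countable set of states, $M=(m_{ij})_{i,j\in\mathcal I}$ is a $0$-$1$ matrix, $\Sigma_M=\{\omega_0\omega_1\omega_2\cdots\in\mathcal I^{\mathbb N_0}: m_{\omega_n\omega_{n+1}}=1 \text{ for all } n\}$ is the one-sided Markov shift with the topology having the cylinder sets $[i_0\cdots i_n]=\{\omega\in\Sigma_M:\omega_0=i_0,\dots,\omega_n=i_n\}$ as a basis, and $\sigma$ is the left shift. Transitivity of $\sigma$ means the same as irreducibility of $M$. If $x\in[j]$ then $c(x):=\#\sigma^{-1}(x)=c_j=\sum_i m_{ij}$. The matrix $Q$ with $q_{ji}=m_{ij}/c_j$ (row index $j$, column index $i$) is an irreducible stochastic matrix; it is positive recurrent, null recurrent or transient in the usual sense of Markov chains. $Q$ is positive recurrent if and only if there is a vector $\pi$ with $\pi Q=\pi$, $\pi_i\ge0$, $\sum_i\pi_i=1$; then $\pi$ is unique with strictly positive entries. In that case $P=(p_{ij})$ is the stochastic matrix defined by $\pi_ip_{ij}=\pi_jq_{ji}$, and $\mathrm{Markov}(\pi,P)$ is the shift-invariant Borel probability measure $\mu$ on $\Sigma_M$ with $\mu([i_0\cdots i_n])=\pi_{i_0}p_{i_0i_1}\cdots p_{i_{n-1}i_n}$. Fair measure: for a state $j$ let $p(j)=\{i\in\mathcal I: m_{ij}=1\}$, so $c_j=\#p(j)$. A $\sigma$-invariant Borel probability measure $\mu$ on $\Sigma_M$ is fair if for every $j$, every Borel set $B\subset[j]$ and every $i\in p(j)$ we have $\mu([i]\cap\sigma^{-1}(B))=\mu(B)/c_j$.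 Random backward trajectory: for $y_0$ with $\#\sigma^{-n}(y_0)<\infty$ for all $n\ge0$, consider the Markov sequence of random variables $Y_0,Y_1,\dots$ with $P[Y_0=y_0]=1$ and $P[Y_{n+1}=y_{n+1}\mid Y_n=y_n]=1/c(y_n)$ for each $y_{n+1}\in\sigma^{-1}(y_n)$. A property holds for a random choice of the backward trajectory of $y_0$ if it holds for almost every outcome $(y_n)_{n\ge0}$ of this process. A sequence $(y_n)$ equidistributes for a Borel probability measure $\mu$ if $\frac1N\sum_{n=0}^{N-1}\phi(y_n)\to\int\phi\,d\mu$ for every bounded continuous function $\phi:\Sigma_M\to\mathbb R$. *)

theory Defs
  imports "HOL-Probability.Probability"
begin

section \<open>Countable-state Markov shifts\<close>

text \<open>The countable set of states is the type \<open>'i::countable\<close> (finite or countably infinite); a matrix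
  indexed by states is a function \<open>'i \<Rightarrow> 'i \<Rightarrow> real\<close>, and a point of the shift is a
  sequence \<open>nat \<Rightarrow> 'i\<close>.\<close>

definition zero_one_matrix :: "('i \<Rightarrow> 'i \<Rightarrow> real) \<Rightarrow> bool" where
  "zero_one_matrix m \<longleftrightarrow> (\<forall>i j. m i j \<in> {0, 1})"

definition shift_space :: "('i \<Rightarrow> 'i \<Rightarrow> real) \<Rightarrow> (nat \<Rightarrow> 'i) set" where
  "shift_space m = {\<omega>. \<forall>n. m (\<omega> n) (\<omega> (Suc n)) = 1}"

definition left_shift :: "(nat \<Rightarrow> 'i) \<Rightarrow> (nat \<Rightarrow> 'i)" where
  "left_shift \<omega> = (\<lambda>n. \<omega> (Suc n))"

definition cylinder :: "('i \<Rightarrow> 'i \<Rightarrow> real) \<Rightarrow> 'i list \<Rightarrow> (nat \<Rightarrow> 'i) set" where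
  "cylinder m w = {\<omega> \<in> shift_space m. \<forall>k<length w. \<omega> k = w ! k}"

definition shift_topology :: "('i \<Rightarrow> 'i \<Rightarrow> real) \<Rightarrow> (nat \<Rightarrow> 'i) topology" where
  "shift_topology m = topology_generated_by {cylinder m w | w. w \<noteq> []}"

definition shift_borel :: "('i \<Rightarrow> 'i \<Rightarrow> real) \<Rightarrow> (nat \<Rightarrow> 'i) measure" where
  "shift_borel m = sigma (shift_space m) {U. openin (shift_topology m) U}"

text \<open>Transitivity of the shift is understood as irreducibility of the matrix: any state leads to any
  state in at least one step, i.e. some power \<open>m ^ n\<close> with \<open>n \<ge> 1\<close> has positive \<open>(i, j)\<close> entry.\<close>

definition transitive_shift :: "('i \<Rightarrow> 'i \<Rightarrow> real) \<Rightarrow> bool" where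
  "transitive_shift m \<longleftrightarrow> (\<forall>i j. (i, j) \<in> {(a, b). m a b > 0}\<^sup>+)"

definition finite_column_sums :: "('i \<Rightarrow> 'i \<Rightarrow> real) \<Rightarrow> bool" where
  "finite_column_sums m \<longleftrightarrow> (\<forall>j. (\<lambda>i. m i j) summable_on UNIV)"

definition column_sum :: "('i \<Rightarrow> 'i \<Rightarrow> real) \<Rightarrow> 'i \<Rightarrow> real" where
  "column_sum m j = (\<Sum>\<^sub>\<infinity>i. m i j)"

definition backward_matrix :: "('i \<Rightarrow> 'i \<Rightarrow> real) \<Rightarrow> 'i \<Rightarrow> 'i \<Rightarrow> real" where
  "backward_matrix m j i = m i j / column_sum m j"


section \<open>Recurrence of stochastic matrices\<close>

text \<open>\<open>first_passage Q n i j\<close> is the probability that the chain with transition matrix \<open>Q\<close> started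
  at \<open>i\<close> hits \<open>j\<close> at time \<open>n\<close> for the first time among the times \<open>\<ge> 1\<close>.\<close>

fun first_passage :: "('i \<Rightarrow> 'i \<Rightarrow> real) \<Rightarrow> nat \<Rightarrow> 'i \<Rightarrow> 'i \<Rightarrow> real" where
  "first_passage Q 0 i j = 0"
| "first_passage Q (Suc 0) i j = Q i j"
| "first_passage Q (Suc (Suc n)) i j = (\<Sum>\<^sub>\<infinity>k\<in>- {j}. Q i k * first_passage Q (Suc n) k j)"

definition recurrent_state :: "('i \<Rightarrow> 'i \<Rightarrow> real) \<Rightarrow> 'i \<Rightarrow> bool" where
  "recurrent_state Q i \<longleftrightarrow> (\<lambda>n. first_passage Q n i i) sums 1"

definition finite_mean_return_time :: "('i \<Rightarrow> 'i \<Rightarrow> real) \<Rightarrow> 'i \<Rightarrow> bool" where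
  "finite_mean_return_time Q i \<longleftrightarrow> summable (\<lambda>n. real n * first_passage Q n i i)"

definition positive_recurrent :: "('i \<Rightarrow> 'i \<Rightarrow> real) \<Rightarrow> bool" where
  "positive_recurrent Q \<longleftrightarrow> (\<forall>i. recurrent_state Q i \<and> finite_mean_return_time Q i)"

definition null_recurrent :: "('i \<Rightarrow> 'i \<Rightarrow> real) \<Rightarrow> bool" where
  "null_recurrent Q \<longleftrightarrow> (\<forall>i. recurrent_state Q i \<and> \<not> finite_mean_return_time Q i)"

definition transient :: "('i \<Rightarrow> 'i \<Rightarrow> real) \<Rightarrow> bool" where
  "transient Q \<longleftrightarrow> (\<forall>i. \<not> recurrent_state Q i)"

definition is_stationary :: "('i \<Rightarrow> 'i \<Rightarrow> real) \<Rightarrow> ('i \<Rightarrow> real) \<Rightarrow> bool" where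
  "is_stationary Q \<pi> \<longleftrightarrow>
     (\<forall>i. \<pi> i \<ge> 0) \<and> (\<pi> has_sum 1) UNIV \<and> (\<forall>i. ((\<lambda>j. \<pi> j * Q j i) has_sum \<pi> i) UNIV)"

definition stationary_vector :: "('i \<Rightarrow> 'i \<Rightarrow> real) \<Rightarrow> 'i \<Rightarrow> real" where
  "stationary_vector Q = (THE \<pi>. is_stationary Q \<pi>)"

text \<open>The time reversal \<open>P\<close> of \<open>Q\<close>, determined by \<open>\<pi> i * P i j = \<pi> j * Q j i\<close>.\<close>

definition reversed_matrix :: "('i \<Rightarrow> 'i \<Rightarrow> real) \<Rightarrow> ('i \<Rightarrow> real) \<Rightarrow> 'i \<Rightarrow> 'i \<Rightarrow> real" where
  "reversed_matrix Q \<pi> i j = \<pi> j * Q j i / \<pi> i"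


section \<open>Invariant, Markov and fair measures\<close>

definition invariant_borel_prob :: "('i \<Rightarrow> 'i \<Rightarrow> real) \<Rightarrow> (nat \<Rightarrow> 'i) measure \<Rightarrow> bool" where
  "invariant_borel_prob m \<mu> \<longleftrightarrow>
     sets \<mu> = sets (shift_borel m) \<and> prob_space \<mu> \<and>
     (\<forall>B\<in>sets \<mu>. measure \<mu> (left_shift -` B \<inter> shift_space m) = measure \<mu> B)"

definition is_markov_measure ::
    "('i \<Rightarrow> 'i \<Rightarrow> real) \<Rightarrow> ('i \<Rightarrow> real) \<Rightarrow> ('i \<Rightarrow> 'i \<Rightarrow> real) \<Rightarrow> (nat \<Rightarrow> 'i) measure \<Rightarrow> bool" where
  "is_markov_measure m \<pi> P \<mu> \<longleftrightarrow>
     invariant_borel_prob m \<mu> \<and>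
     (\<forall>w. w \<noteq> [] \<longrightarrow>
        measure \<mu> (cylinder m w) = \<pi> (w ! 0) * (\<Prod>k<length w - 1. P (w ! k) (w ! Suc k)))"

definition markov_measure ::
    "('i \<Rightarrow> 'i \<Rightarrow> real) \<Rightarrow> ('i \<Rightarrow> real) \<Rightarrow> ('i \<Rightarrow> 'i \<Rightarrow> real) \<Rightarrow> (nat \<Rightarrow> 'i) measure" where
  "markov_measure m \<pi> P = (THE \<mu>. is_markov_measure m \<pi> P \<mu>)"

definition fair_measure :: "('i \<Rightarrow> 'i \<Rightarrow> real) \<Rightarrow> (nat \<Rightarrow> 'i) measure \<Rightarrow> bool" where
  "fair_measure m \<mu> \<longleftrightarrow>
     invariant_borel_prob m \<mu> \<and>
     (\<forall>j. \<forall>B\<in>sets \<mu>. B \<subseteq> cylinder m [j] \<longrightarrow>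
        (\<forall>i. m i j = 1 \<longrightarrow>
           measure \<mu> (cylinder m [i] \<inter> left_shift -` B) = measure \<mu> B / column_sum m j))"


section \<open>Random backward trajectories and equidistribution\<close>

definition preimages :: "('i \<Rightarrow> 'i \<Rightarrow> real) \<Rightarrow> (nat \<Rightarrow> 'i) \<Rightarrow> (nat \<Rightarrow> 'i) set" where
  "preimages m x = {z \<in> shift_space m. left_shift z = x}"

text \<open>The random variables \<open>Y n\<close> live on an arbitrary probability space \<open>\<Omega>\<close>. The third clause is the
  Markov property and the fourth gives the transition probabilities. Every \<open>Y n\<close> takes only countably
  many values almost surely, so elementary conditional probabilities, restricted to conditioning
  events of positive probability, suffice.\<close>

definition random_backward_trajectory ::
    "('i \<Rightarrow> 'i \<Rightarrow> real) \<Rightarrow> (nat \<Rightarrow> 'i) \<Rightarrow> 'w measure \<Rightarrow> (nat \<Rightarrow> 'w \<Rightarrow> (nat \<Rightarrow> 'i)) \<Rightarrow> bool" where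
  "random_backward_trajectory m y0 \<Omega> Y \<longleftrightarrow>
     prob_space \<Omega> \<and>
     (\<forall>n. Y n \<in> measurable \<Omega> (shift_borel m)) \<and>
     \<P>(\<omega> in \<Omega>. Y 0 \<omega> = y0) = 1 \<and>
     (\<forall>n y z. \<P>(\<omega> in \<Omega>. \<forall>k\<le>n. Y k \<omega> = y k) > 0 \<longrightarrow>
        \<P>(\<omega> in \<Omega>. Y (Suc n) \<omega> = z \<bar> \<forall>k\<le>n. Y k \<omega> = y k)
          = \<P>(\<omega> in \<Omega>. Y (Suc n) \<omega> = z \<bar> Y n \<omega> = y n)) \<and>
     (\<forall>n x. \<P>(\<omega> in \<Omega>. Y n \<omega> = x) > 0 \<longrightarrow>
        (\<forall>z\<in>preimages m x.
           \<P>(\<omega> in \<Omega>. Y (Suc n) \<omega> = z \<bar> Y n \<omega> = x) = 1 / real (card (preimages m x))))"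

definition equidistributes ::
    "('i \<Rightarrow> 'i \<Rightarrow> real) \<Rightarrow> (nat \<Rightarrow> 'i) measure \<Rightarrow> (nat \<Rightarrow> (nat \<Rightarrow> 'i)) \<Rightarrow> bool" where
  "equidistributes m \<mu> y \<longleftrightarrow>
     (\<forall>\<phi> :: (nat \<Rightarrow> 'i) \<Rightarrow> real.
        continuous_map (shift_topology m) euclideanreal \<phi> \<and> bounded (\<phi> ` shift_space m) \<longrightarrow>
        (\<lambda>N. (\<Sum>n<N. \<phi> (y n)) / real N) \<longlonglongrightarrow> (\<integral>x. \<phi> x \<partial>\<mu>))"

definition dense_in_shift :: "('i \<Rightarrow> 'i \<Rightarrow> real) \<Rightarrow> (nat \<Rightarrow> (nat \<Rightarrow> 'i)) \<Rightarrow> bool" where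
  "dense_in_shift m y \<longleftrightarrow> shift_topology m closure_of (range y) = shift_space m"

end

theory Submission
  imports Defs
begin

text \<open>
  Let \<open>X\<^sub>n\<close> be the first letter of the \<open>n\<close>-th point \<open>y\<^sub>n\<close> of a backward trajectory. A step backwards prepends a
  letter chosen uniformly among the predecessors of the current first letter, so \<open>X\<close> is a Markov chain with
  transition matrix \<open>Q\<close>, and \<open>y\<^sub>n\<close> is the word \<open>X\<^sub>n \<dots> X\<^sub>1\<close> followed by \<open>y\<^sub>0\<close> (\<open>AE_Y_eq_glue\<close>, \<open>law_of_states\<close>). Once
  \<open>n \<ge> k\<close>, the point \<open>y\<^sub>n\<close> lies in the cylinder of \<open>i\<^sub>0 \<dots> i\<^sub>k\<close> iff the chain spells the reversed word
  \<open>i\<^sub>k \<dots> i\<^sub>0\<close> at the times \<open>n - k, \<dots>, n\<close>. Hence each claim is a statement about the visits of an irreducible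
  countable chain to states or words, and it is proved for the law \<open>chain K x\<close> of such a chain on path space.

  Recurrence is measured by the probability \<open>S\<^sub>n(x)\<close> of not visiting a state \<open>a\<close> at the times \<open>1, \<dots>, n\<close>: return is
  certain iff \<open>S\<^sub>n(a) \<longlonglongrightarrow> 0\<close>, and the mean return time is \<open>\<Sum>\<^sub>n S\<^sub>n(a)\<close>. If return is certain, subharmonic
  functions \<open>u\<close> with values in the unit interval are constant (\<open>bounded_subharmonic_constant\<close>), since they satisfy \<open>u(x) \<le> u(a) + S\<^sub>n(x) (1 - u(a))\<close>. Therefore shift
  invariant events have probability zero or one (\<open>shift_invariant_zero_one\<close>), and every possible word is visited
  (\<open>word_visited\<close>), which is density.

  In the transient case the expected number of visits to a state is finite (\<open>expected_visits_le\<close>), and the Borel-Cantelli lemma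
  applies. In the null recurrent case the mean hitting time of \<open>a\<close>, truncated at \<open>k\<close>, is a bounded function that falls
  by at most one per step on average, but rises by \<open>S\<^sub>1(a) + \<dots> + S\<^sub>k(a)\<close> on average after each visit to \<open>a\<close>. As this sum is
  unbounded in \<open>k\<close>, visits have frequency zero (\<open>visit_frequency_zero\<close>). In the positive recurrent case the expected numbers
  of visits during an excursion from \<open>a\<close> give a stationary vector \<open>\<pi>\<close>, which is unique by Kac's formula
  \<open>\<pi>(a) \<Sum>\<^sub>n S\<^sub>n(a) = 1\<close>. The ergodic theorem (\<open>ergodic_averages\<close>) combines the covering argument of Katznelson and Weiss for the
  stationary chain with the zero-one law, which also carries the result over to an arbitrary starting state.

  The Markov measure is the law of the stationary chain run in reversed time. The identity \<open>\<pi>\<^sub>i p\<^sub>i\<^sub>j = \<pi>\<^sub>j q\<^sub>j\<^sub>i\<close> shows both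
  that it is fair and that the measure of a cylinder is the probability that the stationary chain \<open>Q\<close> spells the
  reversed word. So the frequency with which \<open>y\<^sub>n\<close> visits a cylinder tends to its measure, and bounded continuous
  functions are reached by approximation on finitely many cylinders (\<open>equidistributes_if_word_frequencies\<close>).
\<close>

section \<open>Path measures of countable Markov chains\<close>

abbreviation path_space :: "(nat \<Rightarrow> 'i) measure" where
  "path_space \<equiv> PiM UNIV (\<lambda>_. count_space UNIV)"

text \<open>Unlike \<^const>\<open>cylinder\<close>, these sets do not depend on a matrix: the law of a chain lives on all sequences, and only
  almost every path is admissible.\<close>

definition path_cyl :: "'i list \<Rightarrow> (nat \<Rightarrow> 'i) set" where
  "path_cyl w = {s. \<forall>k<length w. s k = w ! k}"

lemma space_path_space [simp]: "space path_space = UNIV"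
  by (auto simp: space_PiM)

lemma path_cyl_Nil [simp]: "path_cyl [] = UNIV"
  by (simp add: path_cyl_def)

lemma path_cyl_Cons: "path_cyl (x # w) = {s. s 0 = x \<and> left_shift s \<in> path_cyl w}"
  by (auto simp: path_cyl_def left_shift_def All_less_Suc2)

lemma measurable_coordinate [measurable]: "(\<lambda>s. s n) \<in> measurable path_space (count_space UNIV)"
  by (rule measurable_component_singleton) auto

lemma measurable_left_shift [measurable]: "left_shift \<in> measurable path_space path_space"
  unfolding left_shift_def by (rule measurable_PiM_single') (auto simp: space_PiM)

lemma measurable_left_shift_funpow [measurable]:
  "(left_shift ^^ n) \<in> measurable path_space path_space"
  by (induction n) (auto intro: measurable_comp[OF _ measurable_left_shift])

lemma left_shift_funpow: "(left_shift ^^ n) s = (\<lambda>k. s (n + k))"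
  by (induction n arbitrary: s) (auto simp: left_shift_def funpow_Suc_right simp del: funpow.simps)

lemma measurable_case_nat_path [measurable]: "case_nat x \<in> measurable path_space path_space"
  by (rule measurable_PiM_single') (auto simp: space_PiM split: nat.split)

lemma left_shift_case_nat [simp]: "left_shift (case_nat x s) = s"
  by (simp add: left_shift_def)

lemma sets_path_cyl [measurable, simp]: "path_cyl w \<in> sets path_space"
proof -
  have "{s \<in> space path_space. \<forall>k<length w. s k = w ! k} \<in> sets path_space"
    by measurable
  then show ?thesis by (simp add: path_cyl_def)
qed

lemma path_cyl_Int:
  assumes "length v \<le> length w"
  shows "path_cyl v \<inter> path_cyl w = {} \<or> path_cyl v \<inter> path_cyl w = path_cyl w"
proof (cases "\<forall>k<length v. v ! k = w ! k")
  case True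
  then have "path_cyl w \<subseteq> path_cyl v" using assms by (auto simp: path_cyl_def)
  then show ?thesis by blast
next
  case False
  then show ?thesis using assms by (auto simp: path_cyl_def)
qed

text \<open>There are countably many words, so an event that depends on finitely many coordinates is a countable
  union of word events. This is how word events generate the product sigma-algebra.\<close>

lemma path_event_eq_UN_path_cyl:
  "{s. P (map s [0..<n])} = (\<Union>w\<in>{w. length w = n \<and> P w}. path_cyl w)"
proof (intro equalityI subsetI)
  fix s assume "s \<in> {s. P (map s [0..<n])}"
  then have "map s [0..<n] \<in> {w. length w = n \<and> P w}" "s \<in> path_cyl (map s [0..<n])"
    by (auto simp: path_cyl_def)
  then show "s \<in> (\<Union>w\<in>{w. length w = n \<and> P w}. path_cyl w)" by blast
next
  fix s assume "s \<in> (\<Union>w\<in>{w. length w = n \<and> P w}. path_cyl w)"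
  then obtain w where w: "length w = n" "P w" "s \<in> path_cyl w" by blast
  then have "map s [0..<n] = w" by (auto simp: path_cyl_def list_eq_iff_nth_eq)
  with w show "s \<in> {s. P (map s [0..<n])}" by simp
qed

lemma sets_path_space_eq:
  "sets (path_space :: (nat \<Rightarrow> 'i::countable) measure) = sigma_sets UNIV (insert {} (range path_cyl))"
proof
  have "insert {} (range path_cyl) \<subseteq> sets (path_space :: (nat \<Rightarrow> 'i) measure)" by auto
  from sets.sigma_sets_subset[OF this]
  show "sigma_sets UNIV (insert {} (range path_cyl)) \<subseteq> sets (path_space :: (nat \<Rightarrow> 'i) measure)"
    by simp
  have "{f. f i \<in> A} \<in> sigma_sets UNIV (insert {} (range path_cyl))" for i and A :: "'i set"
  proof -
    have "{f. f i \<in> A} = {f. map f [0..<Suc i] ! i \<in> A}" by (simp add: nth_append del: upt_Suc)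
    also have "\<dots> = (\<Union>w\<in>{w. length w = Suc i \<and> w ! i \<in> A}. path_cyl w)"
      by (rule path_event_eq_UN_path_cyl)
    also have "\<dots> \<in> sigma_sets UNIV (insert {} (range path_cyl))"
      by (rule sigma_sets_UNION) auto
    finally show ?thesis .
  qed
  then have "{{f \<in> UNIV. f i \<in> A} |i A. True} \<subseteq> sigma_sets UNIV (insert {} (range (path_cyl :: 'i list \<Rightarrow> _)))"
    by auto
  then show "sets (path_space :: (nat \<Rightarrow> 'i) measure) \<subseteq> sigma_sets UNIV (insert {} (range path_cyl))"
    unfolding sets_PiM_single by (simp add: sigma_sets_mono)
qed

text \<open>The events of nonempty words are closed under intersection up to the empty set, and the one-letter words cover the space.\<close>

lemma path_measure_eqI:
  fixes \<mu> \<nu> :: "(nat \<Rightarrow> 'i::countable) measure"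
  assumes "finite_measure \<mu>" "finite_measure \<nu>"
    and s\<mu>: "sets \<mu> = sets path_space" and s\<nu>: "sets \<nu> = sets path_space"
    and eq: "\<And>x w. measure \<mu> (path_cyl (x # w)) = measure \<nu> (path_cyl (x # w))"
  shows "\<mu> = \<nu>"
proof -
  interpret \<mu>: finite_measure \<mu> by fact
  interpret \<nu>: finite_measure \<nu> by fact
  let ?E = "insert {} (range (\<lambda>(x, w). path_cyl (x # w)) :: (nat \<Rightarrow> 'i) set set)"
  have un: "(\<Union>x. path_cyl [x]) = (UNIV :: (nat \<Rightarrow> 'i) set)"
    by (auto simp: path_cyl_def)
  have E: "Int_stable ?E"
  proof (rule Int_stableI)
    fix A B assume A: "A \<in> ?E" and B: "B \<in> ?E"
    have "A \<inter> B = {} \<or> A \<inter> B = A \<or> A \<inter> B = B"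
      using A B
    proof (elim insertE rangeE)
      fix p q assume "A = (case p of (x, w) \<Rightarrow> path_cyl (x # w))" "B = (case q of (x, w) \<Rightarrow> path_cyl (x # w))"
      then obtain v w where *: "A = path_cyl v" "B = path_cyl w" by (auto split: prod.splits)
      show ?thesis
        using path_cyl_Int[of v w] path_cyl_Int[of w v] unfolding * by (cases "length v \<le> length w") auto
    qed auto
    then show "A \<inter> B \<in> ?E" using A B by auto
  qed
  have gen: "sigma_sets UNIV (insert {} (range path_cyl)) = sigma_sets UNIV ?E"
  proof (rule antisym; rule sigma_sets_mono)
    show "insert {} (range path_cyl) \<subseteq> sigma_sets UNIV ?E"
    proof
      fix A :: "(nat \<Rightarrow> 'i) set" assume "A \<in> insert {} (range path_cyl)"
      then consider "A = {}" | "A = UNIV" | x w where "A = path_cyl (x # w)"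
        by (metis imageE insertE neq_Nil_conv path_cyl_Nil)
      then show "A \<in> sigma_sets UNIV ?E"
      proof cases
        case 3
        then have "A \<in> ?E" by auto
        then show ?thesis by (rule sigma_sets.Basic)
      qed (auto intro: sigma_sets.Empty sigma_sets_top)
    qed
  qed (auto intro: sigma_sets.Empty)
  show ?thesis
  proof (rule measure_eqI_generator_eq_countable[where A="range (\<lambda>x. path_cyl [x])", OF E])
    show "emeasure \<mu> X = emeasure \<nu> X" if "X \<in> ?E" for X
      using that eq by (auto simp: \<mu>.emeasure_eq_measure \<nu>.emeasure_eq_measure)
  qed (use un s\<mu> s\<nu> in \<open>auto simp: sets_path_space_eq gen\<close>)
qed

text \<open>The chain is driven by stacks of independent instructions: the entry at \<open>(n, y)\<close> is the next state if the
  chain is in \<open>y\<close> at time \<open>n\<close>. A given word reads pairwise different entries, so its probability is a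
  product by the definition of the product measure, and no extension theorem beyond infinite products enters.\<close>

primrec stack_walk :: "'i \<Rightarrow> (nat \<times> 'i \<Rightarrow> 'i) \<Rightarrow> nat \<Rightarrow> 'i" where
  "stack_walk x U 0 = x"
| "stack_walk x U (Suc n) = U (n, stack_walk x U n)"

definition chain :: "('i::countable \<Rightarrow> 'i pmf) \<Rightarrow> 'i \<Rightarrow> (nat \<Rightarrow> 'i) measure" where
  "chain K x = distr (PiM UNIV (\<lambda>(n, y). measure_pmf (K y))) path_space (stack_walk x)"

definition word_prob :: "('i \<Rightarrow> 'i pmf) \<Rightarrow> 'i list \<Rightarrow> real" where
  "word_prob K w = (\<Prod>k<length w - 1. pmf (K (w ! k)) (w ! Suc k))"

lemma word_prob_singleton [simp]: "word_prob K [x] = 1"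
  by (simp add: word_prob_def)

lemma word_prob_Cons_Cons [simp]: "word_prob K (x # y # w) = pmf (K x) y * word_prob K (y # w)"
  by (simp add: word_prob_def prod.lessThan_Suc_shift del: prod.lessThan_Suc)

lemma word_prob_nonneg: "0 \<le> word_prob K w"
  by (auto simp: word_prob_def intro: prod_nonneg)

lemma sets_stack_space: "sets (PiM UNIV (\<lambda>(n::nat, y). measure_pmf (K y))) = sets (PiM UNIV (\<lambda>_. count_space UNIV))"
  by (rule sets_PiM_cong) auto

lemma measurable_stack_walk [measurable]:
  "stack_walk (x :: 'i :: countable) \<in> measurable (PiM UNIV (\<lambda>(n, y). measure_pmf (K y))) path_space"
proof -
  have "(\<lambda>U. stack_walk x U n) \<in> measurable (PiM UNIV (\<lambda>_. count_space UNIV)) (count_space UNIV)" for n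
  proof (induction n)
    case (Suc n)
    have "(\<lambda>U. (\<lambda>y U. U (n, y)) (stack_walk x U n) U) \<in> measurable (PiM UNIV (\<lambda>_. count_space UNIV)) (count_space UNIV)"
      by (rule measurable_compose_countable[OF _ Suc]) simp
    then show ?case by simp
  qed simp
  then show ?thesis
    unfolding measurable_cong_sets[OF sets_stack_space refl]
    by (intro measurable_PiM_single') (auto simp: space_PiM)
qed

lemma prob_space_stack: "prob_space (PiM UNIV (\<lambda>(n::nat, y). measure_pmf (K y)))"
  by (rule prob_space_PiM) (auto intro: prob_space_measure_pmf)

lemma prob_space_chain: "prob_space (chain K x)"
  unfolding chain_def by (rule prob_space.prob_space_distr[OF prob_space_stack]) simp

lemma sets_chain [simp, measurable_cong]: "sets (chain K x) = sets path_space"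
  by (simp add: chain_def)

lemma space_chain [simp]: "space (chain K x) = UNIV"
  by (simp add: chain_def)

text \<open>The walk follows \<open>x # w\<close> iff the instruction at \<open>(k, (x # w) ! k)\<close> is \<open>w ! k\<close> for each \<open>k\<close>. These
  instructions are independent since their time indices differ.\<close>

lemma measure_chain_path_cyl:
  "measure (chain K x) (path_cyl (y # w)) = (if y = x then word_prob K (y # w) else 0)"
proof -
  let ?M = "\<lambda>(n::nat, y). measure_pmf (K y)"
  let ?S = "PiM UNIV ?M"
  interpret product_prob_space ?M UNIV
    by (rule product_prob_spaceI) (auto intro: prob_space_measure_pmf)
  have sp: "space ?S = UNIV" by (auto simp: space_PiM)
  have m: "measure (chain K x) (path_cyl (y # w)) = measure ?S {U. stack_walk x U \<in> path_cyl (y # w)}"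
    unfolding chain_def by (subst measure_distr) (auto simp: sp vimage_def)
  show ?thesis
  proof (cases "y = x")
    case False
    then have "{U. stack_walk x U \<in> path_cyl (y # w)} = {}"
      by (auto simp: path_cyl_def)
    then show ?thesis using m False by simp
  next
    case True
    let ?v = "x # w"
    let ?J = "(\<lambda>k. (k, ?v ! k)) ` {..<length w}"
    have "stack_walk x U \<in> path_cyl ?v \<longleftrightarrow> (\<forall>k<length w. U (k, ?v ! k) = w ! k)" for U
    proof
      assume *: "stack_walk x U \<in> path_cyl ?v"
      show "\<forall>k<length w. U (k, ?v ! k) = w ! k"
      proof (intro allI impI)
        fix k assume "k < length w"
        have *: "stack_walk x U j = ?v ! j" if "j < Suc (length w)" for j
          using * that by (simp add: path_cyl_def)
        have "stack_walk x U k = ?v ! k" "stack_walk x U (Suc k) = ?v ! Suc k"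
          using *[of k] *[of "Suc k"] \<open>k < length w\<close> by auto
        then show "U (k, ?v ! k) = w ! k" by simp
      qed
    next
      assume *: "\<forall>k<length w. U (k, ?v ! k) = w ! k"
      have "k \<le> length w \<Longrightarrow> stack_walk x U k = ?v ! k" for k
        by (induction k) (use * in auto)
      then show "stack_walk x U \<in> path_cyl ?v" by (auto simp: path_cyl_def less_Suc_eq_le)
    qed
    then have eq: "{U. stack_walk x U \<in> path_cyl ?v} = {U\<in>space ?S. \<forall>i\<in>?J. U i \<in> {w ! fst i}}"
      by (auto simp: sp)
    have "emeasure ?S {U. stack_walk x U \<in> path_cyl ?v} = (\<Prod>i\<in>?J. emeasure (?M i) {w ! fst i})"
      unfolding eq by (rule emeasure_PiM_Collect) (auto split: prod.splits)
    also have "\<dots> = (\<Prod>k<length w. ennreal (pmf (K (?v ! k)) (w ! k)))"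
      by (subst prod.reindex) (auto simp: inj_on_def emeasure_pmf_single)
    also have "\<dots> = ennreal (word_prob K ?v)"
      by (subst prod_ennreal) (auto simp: word_prob_def)
    finally show ?thesis using m True by (simp add: measure_def word_prob_nonneg)
  qed
qed

lemma chain_start: "AE s in chain K x. s 0 = x"
proof -
  interpret prob_space "chain K x" by (rule prob_space_chain)
  have "prob (path_cyl [x]) = 1" by (simp add: measure_chain_path_cyl)
  then have "AE s in chain K x. s \<in> path_cyl [x]" by (subst prob_eq_1[symmetric]) auto
  then show ?thesis by (simp add: path_cyl_def)
qed

lemma pmf_bind_kernel_measurable:
  fixes \<kappa> :: "'i \<Rightarrow> 'a measure"
  assumes "\<And>y. prob_space (\<kappa> y)" "\<And>y. sets (\<kappa> y) = sets N"
  shows "\<kappa> \<in> measurable (measure_pmf p) (subprob_algebra N)"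
  using assms by (auto simp: space_subprob_algebra intro: prob_space_imp_subprob_space)

lemma chain_measurable [measurable]: "chain K \<in> measurable (measure_pmf p) (subprob_algebra path_space)"
  by (rule pmf_bind_kernel_measurable) (auto intro: prob_space_chain)

lemma measure_pmf_bind_kernel:
  fixes \<kappa> :: "'i \<Rightarrow> 'a measure"
  assumes "\<And>y. prob_space (\<kappa> y)" "\<And>y. sets (\<kappa> y) = sets N" "A \<in> sets N"
  shows "measure (measure_pmf p \<bind> \<kappa>) A = (\<integral>y. measure (\<kappa> y) A \<partial>measure_pmf p)"
proof -
  have "emeasure (measure_pmf p \<bind> \<kappa>) A = (\<integral>\<^sup>+y. emeasure (\<kappa> y) A \<partial>measure_pmf p)"
    by (rule emeasure_bind[OF _ pmf_bind_kernel_measurable]) (use assms in auto)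
  also have "\<dots> = (\<integral>\<^sup>+y. ennreal (measure (\<kappa> y) A) \<partial>measure_pmf p)"
    using assms(1) by (intro nn_integral_cong) (simp add: finite_measure.emeasure_eq_measure prob_space_def)
  also have "\<dots> = ennreal (\<integral>y. measure (\<kappa> y) A \<partial>measure_pmf p)"
    by (rule nn_integral_eq_integral)
       (auto intro!: measure_pmf.integrable_const_bound[where B=1] simp: assms prob_space.prob_le_1)
  finally show ?thesis by (simp add: measure_def)
qed

lemma integral_pmf_delta: "(\<integral>y. (if y = z then c else 0) \<partial>measure_pmf p) = pmf p z * (c::real)"
  by (subst integral_measure_pmf[of "{z}"]) (auto split: if_splits)

lemma integral_pmf_delta': "(\<integral>y. (if z = y then c else 0) \<partial>measure_pmf p) = pmf p z * (c::real)"
  by (subst integral_measure_pmf[of "{z}"]) (auto split: if_splits)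

lemma prob_space_chain_case_nat: "prob_space (distr (chain K y) path_space (case_nat x))"
  by (rule prob_space.prob_space_distr[OF prob_space_chain]) simp

lemma chain_case_nat_measurable [measurable]:
  "(\<lambda>y. distr (chain K y) path_space (case_nat x)) \<in> measurable (measure_pmf p) (subprob_algebra path_space)"
  by (rule pmf_bind_kernel_measurable[OF prob_space_chain_case_nat]) simp

text \<open>After one step the chain starts afresh. Most later statements about paths are derived from this identity by
  induction on the length of a word or on a number of steps, which replaces filtrations and stopping times.\<close>

theorem chain_first_step:
  "chain K x = measure_pmf (K x) \<bind> (\<lambda>y. distr (chain K y) path_space (case_nat x))"
proof (rule path_measure_eqI)
  let ?\<kappa> = "\<lambda>y. distr (chain K y) path_space (case_nat x)"
  note p = prob_space_chain_case_nat
  show "finite_measure (chain K x)" using prob_space_chain by (rule prob_space.finite_measure)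
  show "finite_measure (measure_pmf (K x) \<bind> ?\<kappa>)"
    by (intro prob_space.finite_measure prob_space.prob_space_bind[where S=path_space]
        prob_space_measure_pmf chain_case_nat_measurable AE_I2 p)
  show "sets (measure_pmf (K x) \<bind> ?\<kappa>) = sets path_space"
    by (rule sets_bind) auto
  fix z w
  have *: "measure (?\<kappa> y) (path_cyl (z # w)) = (if z = x then measure (chain K y) (path_cyl w) else 0)" for y
  proof -
    have "case_nat x -` path_cyl (z # w) = (if z = x then path_cyl w else {})"
      by (auto simp: path_cyl_Cons)
    then show ?thesis by (simp add: measure_distr)
  qed
  have "measure (measure_pmf (K x) \<bind> ?\<kappa>) (path_cyl (z # w)) = (\<integral>y. measure (?\<kappa> y) (path_cyl (z # w)) \<partial>measure_pmf (K x))"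
    by (rule measure_pmf_bind_kernel[OF p]) auto
  also have "\<dots> = (\<integral>y. (if z = x then measure (chain K y) (path_cyl w) else 0) \<partial>measure_pmf (K x))"
    by (simp add: *)
  also have "\<dots> = measure (chain K x) (path_cyl (z # w))"
  proof (cases w)
    case Nil
    have "measure (chain K y) UNIV = 1" for y
      using prob_space.prob_space[OF prob_space_chain, of K y] by simp
    then show ?thesis by (simp add: Nil measure_chain_path_cyl)
  next
    case (Cons y' w')
    have "(\<integral>y. (if y' = y then word_prob K (y' # w') else 0) \<partial>measure_pmf (K x)) = pmf (K x) y' * word_prob K (y' # w')"
      by (rule integral_pmf_delta')
    then show ?thesis
      by (simp add: Cons measure_chain_path_cyl)
  qed
  finally show "measure (chain K x) (path_cyl (z # w)) = measure (measure_pmf (K x) \<bind> ?\<kappa>) (path_cyl (z # w))" by (rule sym)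
qed (rule sets_chain)

lemma measure_chain_first_step:
  assumes "A \<in> sets path_space"
  shows "measure (chain K x) A = (\<integral>y. measure (chain K y) {s. case_nat x s \<in> A} \<partial>measure_pmf (K x))"
proof -
  have "measure (chain K x) A = (\<integral>y. measure (distr (chain K y) path_space (case_nat x)) A \<partial>measure_pmf (K x))"
    by (subst chain_first_step, rule measure_pmf_bind_kernel)
       (auto intro!: prob_space.prob_space_distr[OF prob_space_chain] assms)
  then show ?thesis using assms by (simp add: measure_distr vimage_def)
qed

lemma integral_chain_first_step:
  fixes f :: "(nat \<Rightarrow> 'i::countable) \<Rightarrow> real"
  assumes [measurable]: "f \<in> borel_measurable path_space" and b: "\<And>s. \<bar>f s\<bar> \<le> B"
  shows "(\<integral>s. f s \<partial>chain K x) = (\<integral>y. (\<integral>s. f (case_nat x s) \<partial>chain K y) \<partial>measure_pmf (K x))"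
proof -
  have "(\<integral>s. f s \<partial>chain K x) = (\<integral>y. (\<integral>s. f s \<partial>distr (chain K y) path_space (case_nat x)) \<partial>measure_pmf (K x))"
    by (subst chain_first_step, rule integral_bind[OF _ _ chain_case_nat_measurable, where B=B and B'=1])
       (auto intro!: prob_space.emeasure_le_1[OF prob_space_chain_case_nat] simp: b prob_space.emeasure_space_1[OF prob_space_chain_case_nat])
  also have "\<dots> = (\<integral>y. (\<integral>s. f (case_nat x s) \<partial>chain K y) \<partial>measure_pmf (K x))"
    by (simp add: integral_distr)
  finally show ?thesis .
qed

text \<open>The Markov property at the end of a word; it is only ever needed for conditioning on a word.\<close>

lemma measure_chain_markov:
  fixes K :: "'i::countable \<Rightarrow> 'i pmf" and A :: "(nat \<Rightarrow> 'i) set"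
  assumes [measurable]: "A \<in> sets path_space"
  shows "measure (chain K x) (path_cyl (y # w) \<inter> {s. (left_shift ^^ length w) s \<in> A})
     = measure (chain K x) (path_cyl (y # w)) * measure (chain K (last (y # w))) A"
proof (induction w arbitrary: x y)
  case Nil
  show ?case
  proof (cases "y = x")
    case True
    interpret prob_space "chain K x" by (rule prob_space_chain)
    have "AE s in chain K x. s 0 = x" by (rule chain_start)
    then have "prob (path_cyl [x] \<inter> A) = prob A"
      by (intro finite_measure_eq_AE) (auto simp: path_cyl_def elim: eventually_mono)
    then show ?thesis using True by (simp add: measure_chain_path_cyl)
  next
    case False
    then have "measure (chain K x) (path_cyl [y]) = 0" by (simp add: measure_chain_path_cyl)
    moreover have "measure (chain K x) (path_cyl [y] \<inter> A) \<le> measure (chain K x) (path_cyl [y])"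
      by (intro finite_measure.finite_measure_mono prob_space.finite_measure prob_space_chain) auto
    ultimately show ?thesis by (simp add: measure_le_0_iff)
  qed
next
  case (Cons z w)
  have m: "{s. (left_shift ^^ n) s \<in> A} \<in> sets path_space" for n
  proof -
    have "(left_shift ^^ n) -` A \<inter> space path_space \<in> sets path_space" by measurable
    then show ?thesis by (simp add: vimage_def)
  qed
  have step: "measure (chain K x) (path_cyl (y # z # w) \<inter> {s. (left_shift ^^ Suc (length w)) s \<in> A})
    = (\<integral>u. (if y = x then measure (chain K u) (path_cyl (z # w) \<inter> {s. (left_shift ^^ length w) s \<in> A}) else 0) \<partial>measure_pmf (K x))"
  proof (subst measure_chain_first_step)
    show "path_cyl (y # z # w) \<inter> {s. (left_shift ^^ Suc (length w)) s \<in> A} \<in> sets path_space"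
      by (intro sets.Int sets_path_cyl m)
  qed (auto simp: path_cyl_Cons[of y] funpow_Suc_right Int_def simp del: funpow.simps
         intro!: Bochner_Integration.integral_cong)
  have step': "measure (chain K x) (path_cyl (y # z # w))
    = (\<integral>u. (if y = x then measure (chain K u) (path_cyl (z # w)) else 0) \<partial>measure_pmf (K x))"
    by (subst measure_chain_first_step, rule sets_path_cyl)
       (auto simp: path_cyl_Cons[of y] intro!: Bochner_Integration.integral_cong)
  have l: "last (y # z # w) = last (z # w)" by simp
  show ?case
    unfolding length_Cons step step' l by (cases "y = x") (simp_all add: Cons.IH del: last.simps)
qed

lemma left_shift_chain: "distr (chain K x) path_space left_shift = measure_pmf (K x) \<bind> chain K"
proof -
  have "distr (chain K x) path_space left_shift
     = distr (measure_pmf (K x) \<bind> (\<lambda>y. distr (chain K y) path_space (case_nat x))) path_space left_shift"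
    by (simp only: chain_first_step[symmetric])
  also have "\<dots> = measure_pmf (K x) \<bind> (\<lambda>y. distr (distr (chain K y) path_space (case_nat x)) path_space left_shift)"
    by (rule distr_bind[OF chain_case_nat_measurable]) auto
  also have "(\<lambda>y. distr (distr (chain K y) path_space (case_nat x)) path_space left_shift) = chain K"
    by (auto simp: distr_distr comp_def intro!: distr_id2)
  finally show ?thesis .
qed

section \<open>Recurrence through survival probabilities\<close>

lemma integrable_pmf_bounded:
  "(\<And>y. \<bar>f y\<bar> \<le> (B::real)) \<Longrightarrow> integrable (measure_pmf p) f"
  by (rule measure_pmf.integrable_const_bound[where B=B]) auto

lemma integral_pmf_mono:
  fixes f g :: "'i \<Rightarrow> real"
  assumes "\<And>y. \<bar>f y\<bar> \<le> B" "\<And>y. \<bar>g y\<bar> \<le> C" "\<And>y. f y \<le> g y"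
  shows "(\<integral>y. f y \<partial>measure_pmf p) \<le> (\<integral>y. g y \<partial>measure_pmf p)"
  using assms by (intro integral_mono integrable_pmf_bounded[where B=B] integrable_pmf_bounded[where B=C]) auto

lemma integral_pmf_in_01:
  fixes f :: "'i \<Rightarrow> real"
  assumes "\<And>y. 0 \<le> f y" "\<And>y. f y \<le> 1"
  shows "0 \<le> (\<integral>y. f y \<partial>measure_pmf p)" "(\<integral>y. f y \<partial>measure_pmf p) \<le> 1"
proof -
  show "0 \<le> (\<integral>y. f y \<partial>measure_pmf p)" using assms by simp
  have "(\<integral>y. f y \<partial>measure_pmf p) \<le> (\<integral>y. 1 \<partial>measure_pmf p)"
    using assms by (intro integral_pmf_mono[where B=1 and C=1]) auto
  then show "(\<integral>y. f y \<partial>measure_pmf p) \<le> 1" by simp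
qed

lemma pmf_times_le_integral:
  fixes f :: "'i \<Rightarrow> real"
  assumes "\<And>y. 0 \<le> f y" "\<And>y. f y \<le> B"
  shows "pmf p z * f z \<le> (\<integral>y. f y \<partial>measure_pmf p)"
proof -
  have "pmf p z * f z = (\<integral>y. (if y = z then f z else 0) \<partial>measure_pmf p)"
    by (simp add: integral_pmf_delta)
  also have "\<dots> \<le> (\<integral>y. f y \<partial>measure_pmf p)"
    using assms by (intro integral_pmf_mono[where B=B and C=B]) (auto simp: order_trans[OF assms(1) assms(2)])
  finally show ?thesis .
qed

lemma integral_bind_pmf_bounded:
  fixes f :: "'b \<Rightarrow> real"
  assumes "\<And>y. \<bar>f y\<bar> \<le> B"
  shows "(\<integral>y. f y \<partial>measure_pmf (bind_pmf p K)) = (\<integral>x. (\<integral>y. f y \<partial>measure_pmf (K x)) \<partial>measure_pmf p)"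
  unfolding measure_pmf_bind
  by (rule integral_bind[where K="count_space UNIV" and B=B and B'=1])
     (use assms in \<open>auto simp: measure_pmf.emeasure_space_1 space_subprob_algebra intro: measure_pmf.subprob_space_axioms\<close>)

text \<open>\<open>survival K a n x\<close> is the probability that the chain started at \<open>x\<close> does not visit \<open>a\<close> at the times
  \<open>1, \<dots>, n\<close>. Its values at \<open>x = a\<close> are the tails of the return time, so that they tend to \<open>0\<close> iff return is
  certain, and they are summable iff moreover the mean return time is finite.\<close>

primrec survival :: "('i \<Rightarrow> 'i pmf) \<Rightarrow> 'i \<Rightarrow> nat \<Rightarrow> 'i \<Rightarrow> real" where
  "survival K a 0 = (\<lambda>x. 1)"
| "survival K a (Suc n) = (\<lambda>x. \<integral>y. (if y = a then 0 else survival K a n y) \<partial>measure_pmf (K x))"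

lemma survival_nonneg: "0 \<le> survival K a n x" and survival_le_1: "survival K a n x \<le> 1"
proof (induction n arbitrary: x)
  case (Suc n)
  { case 1 show ?case using Suc by (auto intro!: integral_pmf_in_01) }
  { case 2 show ?case using Suc by (auto intro!: integral_pmf_in_01) }
qed auto

lemma abs_survival_le_1: "\<bar>survival K a n x\<bar> \<le> 1"
  using survival_nonneg[of K a n x] survival_le_1[of K a n x] by simp

lemma survival_Suc_le: "survival K a (Suc n) x \<le> survival K a n x"
proof (induction n arbitrary: x)
  case 0 show ?case using survival_le_1[of K a "Suc 0" x] by simp
next
  case (Suc n)
  have "(\<integral>y. (if y = a then 0 else survival K a (Suc n) y) \<partial>measure_pmf (K x))
      \<le> (\<integral>y. (if y = a then 0 else survival K a n y) \<partial>measure_pmf (K x))"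
    using abs_survival_le_1 Suc by (intro integral_pmf_mono[where B=1 and C=1]) (auto simp del: survival.simps)
  then show ?case by simp
qed

text \<open>Paths of length zero are allowed here: only the passage between different states matters below.\<close>

definition irreducible_kernel :: "('i \<Rightarrow> 'i pmf) \<Rightarrow> bool" where
  "irreducible_kernel K \<longleftrightarrow> (\<forall>x y. (x, y) \<in> {(u, v). v \<in> set_pmf (K u)}\<^sup>*)"

definition certain_return :: "('i \<Rightarrow> 'i pmf) \<Rightarrow> 'i \<Rightarrow> bool" where
  "certain_return K a \<longleftrightarrow> (\<lambda>n. survival K a n a) \<longlonglongrightarrow> 0"

text \<open>If the chain could avoid \<open>a\<close> forever from some state, then it could also do so from each predecessor of that state,
  and going back along a path from \<open>a\<close> it could do so from \<open>a\<close> itself.\<close>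

lemma survival_tendsto_0:
  assumes "irreducible_kernel K" "certain_return K a"
  shows "(\<lambda>n. survival K a n x) \<longlonglongrightarrow> 0"
proof -
  have "(a, x) \<in> {(u, v). v \<in> set_pmf (K u)}\<^sup>*"
    using assms(1) by (simp add: irreducible_kernel_def)
  then show ?thesis
  proof (induction rule: rtrancl_induct)
    case base then show ?case using assms(2) by (simp add: certain_return_def)
  next
    case (step x y)
    then have pos: "pmf (K x) y > 0" by (simp add: pmf_positive)
    show ?case
    proof (cases "y = a")
      case True then show ?thesis using assms(2) by (simp add: certain_return_def)
    next
      case False
      have le: "survival K a n y \<le> survival K a (Suc n) x / pmf (K x) y" for n
        using pmf_times_le_integral[of "\<lambda>y. if y = a then 0 else survival K a n y" 1 "K x" y] pos False
        by (simp add: survival_nonneg survival_le_1 field_simps)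
      have lim: "(\<lambda>n. survival K a (Suc n) x / pmf (K x) y) \<longlonglongrightarrow> 0"
        using tendsto_divide[OF LIMSEQ_Suc[OF step.IH] tendsto_const, of "pmf (K x) y"] pos by simp
      show ?thesis
        by (rule tendsto_sandwich[OF _ _ tendsto_const lim])
           (use survival_nonneg le in \<open>auto intro!: always_eventually simp del: survival.simps\<close>)
    qed
  qed
qed

text \<open>Run the chain until it hits \<open>a\<close> or \<open>n\<close> steps have passed. On average \<open>u\<close> does not decrease, and its final value
  is \<open>u a\<close> in the first case and at most \<open>1\<close> in the second.\<close>

lemma subharmonic_le_survival:
  fixes u :: "'i \<Rightarrow> real"
  assumes u: "\<And>x. 0 \<le> u x" "\<And>x. u x \<le> 1"
    and sub: "\<And>x. u x \<le> (\<integral>y. u y \<partial>measure_pmf (K x))"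
  shows "u x \<le> u a + survival K a n x * (1 - u a)"
proof (induction n arbitrary: x)
  case 0 show ?case using u by simp
next
  case (Suc n)
  have ua: "\<bar>u a\<bar> \<le> 1" using u[of a] by simp
  have "u x \<le> (\<integral>y. u y \<partial>measure_pmf (K x))" by (rule sub)
  also have "\<dots> \<le> (\<integral>y. u a + (if y = a then 0 else survival K a n y) * (1 - u a) \<partial>measure_pmf (K x))"
  proof (rule integral_mono)
    show "integrable (measure_pmf (K x)) u"
      using u by (intro integrable_pmf_bounded[where B=1]) simp
    show "integrable (measure_pmf (K x)) (\<lambda>y. u a + (if y = a then 0 else survival K a n y) * (1 - u a))"
      using abs_survival_le_1 ua
      by (intro Bochner_Integration.integrable_add Bochner_Integration.integrable_mult_left
            integrable_pmf_bounded[where B=1]) auto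
  qed (use Suc in auto)
  also have "\<dots> = u a + survival K a (Suc n) x * (1 - u a)"
    using abs_survival_le_1
    by (subst Bochner_Integration.integral_add)
       (auto intro!: integrable_pmf_bounded[where B=1] Bochner_Integration.integrable_mult_left)
  finally show ?case .
qed

text \<open>This Liouville property is where recurrence enters both the zero-one law and the density of trajectories.\<close>

lemma bounded_subharmonic_constant:
  fixes u :: "'i \<Rightarrow> real"
  assumes K: "irreducible_kernel K" "\<And>a. certain_return K a"
    and u: "\<And>x. 0 \<le> u x" "\<And>x. u x \<le> 1"
    and sub: "\<And>x. u x \<le> (\<integral>y. u y \<partial>measure_pmf (K x))"
  shows "u x = u y"
proof -
  have "u x \<le> u a" for x a
  proof (rule LIMSEQ_le_const)
    show "(\<lambda>n. u a + survival K a n x * (1 - u a)) \<longlonglongrightarrow> u a"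
      using tendsto_add[OF tendsto_const[of "u a"]
        tendsto_mult_left_zero[OF survival_tendsto_0[OF K, of a x], of "1 - u a"]] by simp
  qed (use subharmonic_le_survival[of u K, OF u sub] in auto)
  then show ?thesis by (simp add: order_antisym)
qed

subsection \<open>Stationary vectors\<close>

text \<open>Kac's formula before passing to the limit. Integrating the recursion of \<^const>\<open>survival\<close> against a stationary
  vector gives \<open>E S\<^sub>n\<^sub>+\<^sub>1 = E S\<^sub>n - p(a) S\<^sub>n(a)\<close>, and the sum telescopes. It yields uniqueness and strict
  positivity of the stationary vector at once.\<close>

lemma stationary_sum_survival:
  assumes st: "bind_pmf p K = p"
  shows "pmf p a * (\<Sum>n<N. survival K a n a) = 1 - (\<integral>x. survival K a N x \<partial>measure_pmf p)"
proof (induction N)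
  case (Suc N)
  let ?g = "\<lambda>y. if y = a then 0 else survival K a N y"
  have "(\<integral>x. survival K a (Suc N) x \<partial>measure_pmf p) = (\<integral>y. ?g y \<partial>measure_pmf (bind_pmf p K))"
    using abs_survival_le_1 by (subst integral_bind_pmf_bounded[where B=1]) auto
  also have "\<dots> = (\<integral>y. survival K a N y - (if y = a then survival K a N a else 0) \<partial>measure_pmf p)"
    unfolding st by (intro Bochner_Integration.integral_cong) auto
  also have "\<dots> = (\<integral>y. survival K a N y \<partial>measure_pmf p) - pmf p a * survival K a N a"
    using abs_survival_le_1
    by (subst Bochner_Integration.integral_diff) (auto intro!: integrable_pmf_bounded[where B=1] simp: integral_pmf_delta)
  finally show ?case using Suc by (simp add: algebra_simps del: survival.simps)
qed simp

lemma stationary_times_mean_return: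
  assumes "irreducible_kernel K" "certain_return K a" and st: "bind_pmf p K = p"
  shows "(\<lambda>N. pmf p a * (\<Sum>n<N. survival K a n a)) \<longlonglongrightarrow> 1"
proof -
  have "(\<lambda>N. \<integral>x. survival K a N x \<partial>measure_pmf p) \<longlonglongrightarrow> (\<integral>x. 0 \<partial>measure_pmf p)"
    by (rule integral_dominated_convergence[where w="\<lambda>_. 1"])
       (use survival_tendsto_0[OF assms(1,2)] abs_survival_le_1 in \<open>auto intro!: AE_I2\<close>)
  then have "(\<lambda>N. 1 - (\<integral>x. survival K a N x \<partial>measure_pmf p)) \<longlonglongrightarrow> 1 - 0"
    by (intro tendsto_diff tendsto_const) simp
  then show ?thesis by (simp add: stationary_sum_survival[OF st])
qed

lemma stationary_positive:
  assumes "irreducible_kernel K" "certain_return K a" "bind_pmf p K = p"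
  shows "0 < pmf p a"
proof (rule ccontr)
  assume "\<not> 0 < pmf p a"
  then have "pmf p a = 0" using pmf_nonneg[of p a] by linarith
  with stationary_times_mean_return[OF assms] have "(\<lambda>N::nat. 0::real) \<longlonglongrightarrow> 1" by simp
  then show False using LIMSEQ_unique[OF tendsto_const[of "0::real"]] by fastforce
qed

lemma stationary_unique:
  assumes K: "irreducible_kernel K" "\<And>a. certain_return K a"
    and p: "bind_pmf p K = p" and q: "bind_pmf q K = q"
  shows "p = q"
proof (rule pmf_eqI)
  fix a
  let ?T = "\<lambda>N. \<Sum>n<N. survival K a n a"
  have "(\<lambda>N. pmf q a * (pmf p a * ?T N)) \<longlonglongrightarrow> pmf q a * 1"
    by (intro tendsto_mult tendsto_const stationary_times_mean_return K p)
  moreover have "(\<lambda>N. pmf p a * (pmf q a * ?T N)) \<longlonglongrightarrow> pmf p a * 1"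
    by (intro tendsto_mult tendsto_const stationary_times_mean_return K q)
  ultimately show "pmf p a = pmf q a"
    using LIMSEQ_unique by (force simp: mult.left_commute)
qed

text \<open>\<open>taboo K a n i\<close> is the probability that the chain started at \<open>a\<close> is in \<open>i\<close> at time \<open>n\<close> and has not returned to
  \<open>a\<close> by then. Summing over \<open>n\<close> gives the expected number of visits to \<open>i\<close> during one excursion from \<open>a\<close>, the
  classical stationary measure.\<close>

primrec taboo :: "('i \<Rightarrow> 'i pmf) \<Rightarrow> 'i \<Rightarrow> nat \<Rightarrow> 'i \<Rightarrow> ennreal" where
  "taboo K a 0 = (\<lambda>i. indicator {a} i)"
| "taboo K a (Suc n) = (\<lambda>i. indicator (- {a}) i * (\<integral>\<^sup>+ j. taboo K a n j * ennreal (pmf (K j) i) \<partial>count_space UNIV))"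

text \<open>Splitting a path that avoids \<open>a\<close> at time \<open>n\<close>: the row vectors \<^const>\<open>taboo\<close> and the column vectors
  \<^const>\<open>survival\<close> are iterates of the same matrix with the column of \<open>a\<close> deleted. The case \<open>k = 0\<close> gives the
  total mass of \<^const>\<open>taboo\<close>.\<close>

lemma taboo_survival:
  fixes K :: "'i::countable \<Rightarrow> 'i pmf"
  shows "(\<integral>\<^sup>+ i. taboo K a n i * ennreal (survival K a k i) \<partial>count_space UNIV) = ennreal (survival K a (n + k) a)"
proof (induction n arbitrary: k)
  case 0
  have "(\<integral>\<^sup>+ i. indicator {a} i * ennreal (survival K a k i) \<partial>count_space UNIV)
     = (\<integral>\<^sup>+ i. ennreal (survival K a k a) * indicator {a} i \<partial>count_space UNIV)"
    by (intro nn_integral_cong) (auto split: split_indicator)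
  then show ?case by simp
next
  case (Suc n)
  have 1: "(\<integral>\<^sup>+ i. indicator (- {a}) i * ennreal (pmf (K j) i) * ennreal (survival K a k i) \<partial>count_space UNIV)
      = ennreal (survival K a (Suc k) j)" for j
  proof -
    have "(\<integral>\<^sup>+ i. indicator (- {a}) i * ennreal (pmf (K j) i) * ennreal (survival K a k i) \<partial>count_space UNIV)
      = (\<integral>\<^sup>+ i. ennreal (if i = a then 0 else survival K a k i) \<partial>measure_pmf (K j))"
      unfolding nn_integral_measure_pmf by (intro nn_integral_cong) (auto split: split_indicator)
    also have "\<dots> = ennreal (survival K a (Suc k) j)"
      using abs_survival_le_1 survival_nonneg
      by (subst nn_integral_eq_integral) (auto intro!: integrable_pmf_bounded[where B=1] AE_I2)
    finally show ?thesis .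
  qed
  have "(\<integral>\<^sup>+ i. taboo K a (Suc n) i * ennreal (survival K a k i) \<partial>count_space UNIV)
     = (\<integral>\<^sup>+ i. (\<integral>\<^sup>+ j. taboo K a n j * (indicator (- {a}) i * ennreal (pmf (K j) i) * ennreal (survival K a k i)) \<partial>count_space UNIV) \<partial>count_space UNIV)"
    by (intro nn_integral_cong) (simp add: nn_integral_cmult[symmetric] nn_integral_multc[symmetric] mult_ac)
  also have "\<dots> = (\<integral>\<^sup>+ j. (\<integral>\<^sup>+ i. taboo K a n j * (indicator (- {a}) i * ennreal (pmf (K j) i) * ennreal (survival K a k i)) \<partial>count_space UNIV) \<partial>count_space UNIV)"
    using nn_integral_snd_count_space[of "\<lambda>(j, i). taboo K a n j * (indicator (- {a}) i * ennreal (pmf (K j) i) * ennreal (survival K a k i))"]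
      nn_integral_fst_count_space[of "\<lambda>(j, i). taboo K a n j * (indicator (- {a}) i * ennreal (pmf (K j) i) * ennreal (survival K a k i))"]
    by simp
  also have "\<dots> = (\<integral>\<^sup>+ j. taboo K a n j * ennreal (survival K a (Suc k) j) \<partial>count_space UNIV)"
    by (simp only: nn_integral_cmult borel_measurable_count_space 1)
  also have "\<dots> = ennreal (survival K a (Suc n + k) a)" using Suc[of "Suc k"] by simp
  finally show ?case .
qed

text \<open>The remaining value is determined by the total mass. In the construction of a stationary vector this
  saves the computation at the base point \<open>a\<close>.\<close>

lemma pmf_eqI_off_point:
  assumes "\<And>i. i \<noteq> a \<Longrightarrow> pmf p i = pmf q i"
  shows "p = q"
proof (rule pmf_eqI)
  fix i
  have "emeasure (measure_pmf p) (- {a}) = emeasure (measure_pmf q) (- {a})"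
    unfolding measure_pmf_eq_density
    by (auto simp: emeasure_density assms intro!: nn_integral_cong split: split_indicator)
  then have "measure (measure_pmf p) (- {a}) = measure (measure_pmf q) (- {a})"
    by (simp add: measure_def)
  then have "pmf p a = pmf q a"
    using measure_pmf.prob_compl[of "{a}" p] measure_pmf.prob_compl[of "{a}" q]
    by (simp add: measure_pmf_single Compl_eq_Diff_UNIV)
  with assms show "pmf p i = pmf q i" by (cases "i = a") auto
qed

lemma stationary_exists:
  fixes K :: "'i::countable \<Rightarrow> 'i pmf"
  assumes "summable (\<lambda>n. survival K a n a)"
  obtains p where "bind_pmf p K = p"
proof -
  let ?C = "count_space (UNIV :: 'i set)"
  define G where "G i = (\<Sum>n. taboo K a n i)" for i
  define c where "c = (\<Sum>n. survival K a n a)"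
  have "(\<Sum>n<1. survival K a n a) \<le> c"
    unfolding c_def by (rule sum_le_suminf[OF assms]) (auto intro: survival_nonneg)
  then have c: "1 \<le> c" by simp
  have G: "(\<integral>\<^sup>+ i. G i \<partial>?C) = ennreal c"
  proof -
    have "(\<integral>\<^sup>+ i. G i \<partial>?C) = (\<Sum>n. \<integral>\<^sup>+ i. taboo K a n i \<partial>?C)"
      unfolding G_def by (rule nn_integral_suminf) simp
    also have "\<dots> = (\<Sum>n. ennreal (survival K a n a))"
      using taboo_survival[of K a _ 0] by simp
    also have "\<dots> = ennreal c"
      unfolding c_def by (rule suminf_ennreal2[OF survival_nonneg assms])
    finally show ?thesis .
  qed
  have Gfin: "G i \<noteq> \<infinity>" for i
  proof -
    have "G i \<le> (\<integral>\<^sup>+ i. G i \<partial>?C)" by (rule nn_integral_ge_point) simp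
    then show ?thesis using G by (auto simp: top_unique)
  qed
  define f where "f i = enn2real (G i) / c" for i
  have f: "ennreal (f i) = G i / ennreal c" for i
    using Gfin[of i] c by (simp add: f_def divide_ennreal[symmetric] top.not_eq_extremum)
  have f0: "0 \<le> f i" for i using c by (simp add: f_def)
  have "(\<integral>\<^sup>+ i. ennreal (f i) \<partial>?C) = 1"
    unfolding f using c by (simp add: nn_integral_divide G divide_ennreal)
  note pmf_p = pmf_embed_pmf[OF f0 this]
  let ?p = "embed_pmf f"
  have "bind_pmf ?p K = ?p"
  proof (rule pmf_eqI_off_point)
    fix i assume i: "i \<noteq> a"
    have "ennreal (pmf (bind_pmf ?p K) i) = (\<integral>\<^sup>+ j. ennreal (f j) * ennreal (pmf (K j) i) \<partial>?C)"
      by (simp add: ennreal_pmf_bind nn_integral_measure_pmf pmf_p)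
    also have "\<dots> = (\<integral>\<^sup>+ j. (G j * ennreal (pmf (K j) i)) / ennreal c \<partial>?C)"
      by (simp add: f ennreal_times_divide mult.commute)
    also have "\<dots> = (\<integral>\<^sup>+ j. G j * ennreal (pmf (K j) i) \<partial>?C) / ennreal c"
      by (rule nn_integral_divide) simp
    also have "(\<integral>\<^sup>+ j. G j * ennreal (pmf (K j) i) \<partial>?C) = (\<Sum>n. \<integral>\<^sup>+ j. taboo K a n j * ennreal (pmf (K j) i) \<partial>?C)"
      unfolding G_def by (simp add: nn_integral_suminf[symmetric])
    also have "\<dots> = (\<Sum>n. taboo K a (Suc n) i)" using i by simp
    also have "\<dots> = G i"
      unfolding G_def using i suminf_offset[of "\<lambda>n. taboo K a n i" 1] by simp
    also have "G i / ennreal c = ennreal (pmf ?p i)" by (simp add: f pmf_p)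
    finally show "pmf (bind_pmf ?p K) i = pmf ?p i" by (simp add: pmf_nonneg)
  qed
  then show thesis by (rule that)
qed

section \<open>Transient chains\<close>

lemma sets_visit [simp]: "{s. s n \<in> B} \<in> sets path_space"
proof -
  have "(\<lambda>s. s n) -` B \<inter> space path_space \<in> sets path_space"
    by (rule measurable_sets[OF measurable_coordinate]) simp
  then show ?thesis by (simp add: vimage_def)
qed

lemma measure_chain_visit_Suc:
  "measure (chain K x) {s. s (Suc n) \<in> B} = (\<integral>y. measure (chain K y) {s. s n \<in> B} \<partial>measure_pmf (K x))"
  by (subst measure_chain_first_step[OF sets_visit]) simp

lemma measure_chain_visit_0: "measure (chain K x) {s. s 0 = a} = (if x = a then 1 else 0)"
proof -
  have "{s. s 0 = a} = path_cyl [a]" by (auto simp: path_cyl_def)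
  then show ?thesis by (simp add: measure_chain_path_cyl)
qed

lemma prob_chain_le_1: "measure (chain K x) A \<le> 1"
  by (rule prob_space.prob_le_1[OF prob_space_chain])

lemma abs_prob_chain_le_1: "\<bar>measure (chain K x) A\<bar> \<le> 1"
  using prob_chain_le_1[of K x A] by simp

text \<open>The chain visits \<open>a\<close> before time \<open>N\<close> with probability \<open>1 - S\<^sub>N(x)\<close>, and after the first visit the expected number
  of further visits is at most the one from \<open>a\<close>. For \<open>x = a\<close> this bounds the expected number of visits by
  \<open>1 / l\<close>, where \<open>l > 0\<close> is the probability of never returning.\<close>

lemma expected_visits_le:
  "(\<Sum>n<N. measure (chain K x) {s. s (Suc n) = a})
     \<le> (1 - survival K a N x) * (1 + (\<Sum>n<N. measure (chain K a) {s. s (Suc n) = a}))"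
proof (induction N arbitrary: x)
  case (Suc N)
  let ?V = "\<lambda>N x. \<Sum>n<N. measure (chain K x) {s. s (Suc n) = a}"
  have Vle: "\<bar>?V N y\<bar> \<le> real N" for y
    using sum_bounded_above[of "{..<N}" "\<lambda>n. measure (chain K y) {s. s (Suc n) = a}" 1, OF prob_chain_le_1]
    by (simp add: sum_nonneg)
  have mono: "?V N a \<le> ?V (Suc N) a" by simp
  have split: "?V (Suc N) x = (\<integral>y. (if y = a then 1 else 0) + ?V N y \<partial>measure_pmf (K x))"
  proof -
    have "?V (Suc N) x = (\<Sum>n<Suc N. (\<integral>y. measure (chain K y) {s. s n = a} \<partial>measure_pmf (K x)))"
      using measure_chain_visit_Suc[of K x _ "{a}"] by simp
    also have "\<dots> = (\<integral>y. (\<Sum>n<Suc N. measure (chain K y) {s. s n = a}) \<partial>measure_pmf (K x))"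
      by (rule Bochner_Integration.integral_sum[symmetric])
         (auto intro!: integrable_pmf_bounded[where B=1] abs_prob_chain_le_1)
    also have "\<dots> = (\<integral>y. (if y = a then 1 else 0) + ?V N y \<partial>measure_pmf (K x))"
      by (simp add: sum.lessThan_Suc_shift measure_chain_visit_0 del: sum.lessThan_Suc)
    finally show ?thesis .
  qed
  also have "\<dots> \<le> (\<integral>y. (1 - (if y = a then 0 else survival K a N y)) * (1 + ?V N a) \<partial>measure_pmf (K x))"
  proof (rule integral_mono)
    show "integrable (measure_pmf (K x)) (\<lambda>y. (if y = a then 1 else 0) + ?V N y)"
      using Vle by (intro Bochner_Integration.integrable_add integrable_pmf_bounded[where B="real N"]
          integrable_pmf_bounded[where B=1 and f="\<lambda>y. if y = a then 1 else 0"]) auto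
    show "integrable (measure_pmf (K x)) (\<lambda>y. (1 - (if y = a then 0 else survival K a N y)) * (1 + ?V N a))"
    proof (intro Bochner_Integration.integrable_mult_left integrable_pmf_bounded[where B=1])
      fix y show "\<bar>1 - (if y = a then 0 else survival K a N y)\<bar> \<le> 1"
        using survival_nonneg[of K a N y] survival_le_1[of K a N y] by auto
    qed
    fix y
    show "(if y = a then 1 else 0) + ?V N y \<le> (1 - (if y = a then 0 else survival K a N y)) * (1 + ?V N a)"
      using Suc[of y] by auto
  qed
  also have "\<dots> = (1 - survival K a (Suc N) x) * (1 + ?V N a)"
    using abs_survival_le_1
    by (simp, subst Bochner_Integration.integral_diff) (auto intro!: integrable_pmf_bounded[where B=1])
  also have "\<dots> \<le> (1 - survival K a (Suc N) x) * (1 + ?V (Suc N) a)"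
    by (intro mult_left_mono) (use mono survival_le_1[of K a "Suc N" x] in auto)
  finally show ?case .
qed simp

lemma survival_convergent: "convergent (\<lambda>n. survival K a n x)"
  by (rule Bseq_monoseq_convergent)
     (auto intro!: BseqI'[where K=1] decseq_imp_monoseq decseq_SucI survival_Suc_le abs_survival_le_1 simp del: survival.simps)

lemma transient_finite_visits:
  assumes "\<not> certain_return K a"
  shows "AE s in chain K x. finite {n. s n = a}"
proof -
  interpret prob_space "chain K x" by (rule prob_space_chain)
  obtain l where l: "(\<lambda>n. survival K a n a) \<longlonglongrightarrow> l"
    using survival_convergent[of K a a] unfolding convergent_def by blast
  have "decseq (\<lambda>n. survival K a n a)" by (intro decseq_SucI survival_Suc_le)
  then have ge: "l \<le> survival K a N a" for N by (rule decseq_ge[OF _ l])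
  have "0 \<le> l" by (rule LIMSEQ_le_const[OF l]) (auto simp: survival_nonneg)
  with assms l have lpos: "0 < l" by (auto simp: certain_return_def le_less)
  let ?V = "\<lambda>N x. \<Sum>n<N. measure (chain K x) {s. s (Suc n) = a}"
  have "?V N a \<le> 1 / l" for N
  proof -
    have "0 \<le> ?V N a" by (simp add: sum_nonneg)
    have "?V N a \<le> (1 - survival K a N a) * (1 + ?V N a)" by (rule expected_visits_le)
    also have "\<dots> \<le> (1 - l) * (1 + ?V N a)"
      by (intro mult_right_mono) (use ge[of N] \<open>0 \<le> ?V N a\<close> in auto)
    finally have "l * ?V N a \<le> 1" using lpos by (simp add: algebra_simps)
    then show ?thesis using lpos by (simp add: field_simps)
  qed
  then have V: "?V N x \<le> 1 + 1 / l" for N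
  proof -
    have V0: "0 \<le> ?V N a" by (simp add: sum_nonneg)
    have "?V N x \<le> (1 - survival K a N x) * (1 + ?V N a)" by (rule expected_visits_le)
    also have "\<dots> \<le> 1 * (1 + ?V N a)"
      by (intro mult_right_mono) (use survival_nonneg[of K a N x] V0 in auto)
    finally show ?thesis using \<open>?V N a \<le> 1 / l\<close> by simp
  qed
  have "summable (\<lambda>n. measure (chain K x) {s. s (Suc n) = a})"
    by (rule bounded_imp_summable[where B="1 + 1 / l"])
       (use V in \<open>auto simp: lessThan_Suc_atMost[symmetric] simp del: sum.lessThan_Suc\<close>)
  then have "AE s in chain K x. eventually (\<lambda>n. s \<in> space (chain K x) - {s. s (Suc n) = a}) sequentially"
    by (intro borel_cantelli_AE1) (use sets_visit[of _ "{a}"] in \<open>auto simp: emeasure_eq_measure\<close>)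
  then show ?thesis
  proof eventually_elim
    case (elim s)
    then obtain n0 where "\<And>n. n \<ge> n0 \<Longrightarrow> s (Suc n) \<noteq> a"
      by (auto simp: eventually_sequentially)
    then have "{n. s n = a} \<subseteq> {..n0}"
      by (metis (mono_tags, lifting) Suc_le_D atMost_iff mem_Collect_eq not_less_eq_eq subsetI)
    then show ?case by (rule finite_subset) simp
  qed
qed

section \<open>A zero-one law\<close>

lemma started_chain:
  fixes K :: "'i::countable \<Rightarrow> 'i pmf"
  shows "prob_space (measure_pmf p \<bind> chain K)" "sets (measure_pmf p \<bind> chain K) = sets path_space"
proof -
  show "prob_space (measure_pmf p \<bind> chain K)"
    by (intro prob_space.prob_space_bind[where S=path_space] prob_space_measure_pmf chain_measurable
        AE_I2 prob_space_chain)
  show "sets (measure_pmf p \<bind> chain K) = sets path_space"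
    by (rule sets_bind) auto
qed

text \<open>For such an event \<open>x \<mapsto> P\<^sub>x(A)\<close> is subharmonic: after the first step the path still lies in \<open>A\<close>.\<close>

lemma shift_invariant_constant:
  fixes K :: "'i::countable \<Rightarrow> 'i pmf"
  assumes K: "irreducible_kernel K" "\<And>a. certain_return K a"
    and A: "A \<in> sets path_space" and sub: "\<And>s. s \<in> A \<Longrightarrow> left_shift s \<in> A"
  shows "measure (chain K x) A = measure (chain K y) A"
proof (rule bounded_subharmonic_constant[OF K, where u="\<lambda>x. measure (chain K x) A"])
  fix x
  have m: "{s. case_nat x s \<in> A} \<in> sets path_space"
    using measurable_sets[OF measurable_case_nat_path A, of x] by (simp add: vimage_def)
  have "measure (chain K x) A = (\<integral>y. measure (chain K y) {s. case_nat x s \<in> A} \<partial>measure_pmf (K x))"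
    by (rule measure_chain_first_step[OF A])
  also have "\<dots> \<le> (\<integral>y. measure (chain K y) A \<partial>measure_pmf (K x))"
  proof (rule integral_pmf_mono[where B=1 and C=1])
    fix y
    interpret prob_space "chain K y" by (rule prob_space_chain)
    have "{s. case_nat x s \<in> A} \<subseteq> A" using sub[of "case_nat x s" for s] by auto
    then show "measure (chain K y) {s. case_nat x s \<in> A} \<le> measure (chain K y) A"
      using A by (intro finite_measure_mono) auto
  qed (rule abs_prob_chain_le_1)+
  finally show "measure (chain K x) A \<le> (\<integral>y. measure (chain K y) A \<partial>measure_pmf (K x))" .
qed (auto simp: prob_chain_le_1)

text \<open>By the Markov property an invariant event \<open>A\<close> of constant probability \<open>c\<close> is independent of each word, hence of every
  event, hence of itself, so \<open>c = c\<^sup>2\<close>.\<close>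

theorem shift_invariant_zero_one:
  fixes K :: "'i::countable \<Rightarrow> 'i pmf"
  assumes K: "irreducible_kernel K" "\<And>a. certain_return K a"
    and A: "A \<in> sets path_space" and inv: "\<And>s. left_shift s \<in> A \<longleftrightarrow> s \<in> A"
  shows "(\<forall>x. measure (chain K x) A = 0) \<or> (\<forall>x. measure (chain K x) A = 1)"
proof -
  define c where "c = measure (chain K undefined) A"
  have c: "measure (chain K x) A = c" for x
    unfolding c_def by (rule shift_invariant_constant[OF K A]) (simp add: inv)
  have invn: "(left_shift ^^ n) s \<in> A \<longleftrightarrow> s \<in> A" for n s
    by (induction n) (auto simp: inv)
  fix x :: 'i
  interpret prob_space "chain K x" by (rule prob_space_chain)
  \<comment> \<open>Both measures agree on words by the Markov property, hence on \<open>A\<close> itself.\<close>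
  let ?\<mu> = "density (chain K x) (indicator A)"
  let ?\<nu> = "scale_measure (ennreal c) (chain K x)"
  have em1: "emeasure ?\<mu> B = emeasure (chain K x) (B \<inter> A)" if "B \<in> sets path_space" for B
  proof -
    have "emeasure ?\<mu> B = (\<integral>\<^sup>+s. indicator A s * indicator B s \<partial>chain K x)"
      using A that by (intro emeasure_density) auto
    also have "\<dots> = (\<integral>\<^sup>+s. indicator (B \<inter> A) s \<partial>chain K x)"
      by (intro nn_integral_cong) (auto split: split_indicator)
    also have "\<dots> = emeasure (chain K x) (B \<inter> A)"
      using A that by (intro nn_integral_indicator) auto
    finally show ?thesis .
  qed
  have c0: "0 \<le> c" by (simp add: c_def)
  have m1: "measure ?\<mu> B = prob (B \<inter> A)" if "B \<in> sets path_space" for B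
    using em1[OF that] by (simp add: measure_def)
  have m2: "measure ?\<nu> B = c * prob B" for B
    using c0 by (simp add: measure_def enn2real_mult)
  have "?\<mu> = ?\<nu>"
  proof (rule path_measure_eqI)
    show "finite_measure ?\<mu>" "finite_measure ?\<nu>"
      using em1[of UNIV] sets.top[of "path_space :: (nat \<Rightarrow> 'i) measure"]
      by (auto intro!: finite_measureI simp: emeasure_eq_measure ennreal_mult_eq_top_iff)
    fix y w
    have "prob (path_cyl (y # w) \<inter> A) = prob (path_cyl (y # w) \<inter> {s. (left_shift ^^ length w) s \<in> A})"
      by (simp add: invn)
    also have "\<dots> = c * prob (path_cyl (y # w))"
      by (simp add: measure_chain_markov[OF A] c)
    finally show "measure ?\<mu> (path_cyl (y # w)) = measure ?\<nu> (path_cyl (y # w))"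
      by (simp add: m1 m2)
  qed auto
  then have "measure ?\<mu> A = measure ?\<nu> A" by simp
  then have "c = c * c" using m1[OF A] m2[of A] c[of x] by simp
  then have "c = 0 \<or> c = 1" by simp
  with c show ?thesis by auto
qed

section \<open>Frequencies\<close>

subsection \<open>Law of large numbers for martingale increments of a chain\<close>

definition kernel_op :: "('i \<Rightarrow> 'i pmf) \<Rightarrow> ('i \<Rightarrow> real) \<Rightarrow> 'i \<Rightarrow> real" where
  "kernel_op K u x = (\<integral>y. u y \<partial>measure_pmf (K x))"

text \<open>The martingale part of \<open>u\<close> along the path: each increment has conditional mean zero given the past.\<close>

definition compensated_sum :: "('i \<Rightarrow> 'i pmf) \<Rightarrow> ('i \<Rightarrow> real) \<Rightarrow> nat \<Rightarrow> (nat \<Rightarrow> 'i) \<Rightarrow> real" where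
  "compensated_sum K u N s = (\<Sum>n<N. u (s (Suc n)) - kernel_op K u (s n))"

lemma abs_kernel_op_le:
  assumes "\<And>y. \<bar>u y\<bar> \<le> B"
  shows "\<bar>kernel_op K u x\<bar> \<le> B"
proof -
  have u: "- B \<le> u y" "u y \<le> B" for y using assms[of y] by auto
  have "(\<integral>y. u y \<partial>measure_pmf (K x)) \<le> (\<integral>y. B \<partial>measure_pmf (K x))"
    by (rule integral_pmf_mono[where B=B and C="\<bar>B\<bar>"]) (use assms u in auto)
  moreover have "(\<integral>y. - B \<partial>measure_pmf (K x)) \<le> (\<integral>y. u y \<partial>measure_pmf (K x))"
    by (rule integral_pmf_mono[where B="\<bar>B\<bar>" and C=B]) (use assms u in auto)
  ultimately show ?thesis by (simp add: kernel_op_def abs_le_iff)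
qed

lemma compensated_sum_measurable [measurable]:
  "compensated_sum K u N \<in> borel_measurable (path_space :: (nat \<Rightarrow> 'i::countable) measure)"
  unfolding compensated_sum_def by measurable

lemma compensated_sum_Suc_case_nat:
  "compensated_sum K u (Suc N) (case_nat x s) = (u (s 0) - kernel_op K u x) + compensated_sum K u N s"
  by (simp add: compensated_sum_def sum.lessThan_Suc_shift del: sum.lessThan_Suc)

lemma abs_compensated_increment_le:
  assumes "\<And>y. \<bar>u y\<bar> \<le> B"
  shows "\<bar>u y - kernel_op K u x\<bar> \<le> 2 * B"
  using assms[of y] abs_kernel_op_le[of u B K x, OF assms] by linarith

lemma abs_compensated_sum_le:
  assumes "\<And>y. \<bar>u y\<bar> \<le> B"
  shows "\<bar>compensated_sum K u N s\<bar> \<le> real N * (2 * B)"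
proof -
  have "\<bar>compensated_sum K u N s\<bar> \<le> (\<Sum>n<N. \<bar>u (s (Suc n)) - kernel_op K u (s n)\<bar>)"
    unfolding compensated_sum_def by (rule sum_abs)
  also have "\<dots> \<le> (\<Sum>n<N. 2 * B)"
    by (intro sum_mono abs_compensated_increment_le assms)
  finally show ?thesis by simp
qed

lemma integrable_chain_bounded:
  fixes f :: "(nat \<Rightarrow> 'i::countable) \<Rightarrow> real"
  assumes "f \<in> borel_measurable path_space" "\<And>s. \<bar>f s\<bar> \<le> B"
  shows "integrable (chain K x) f"
  using assms
  by (intro finite_measure.integrable_const_bound[where B=B] prob_space.finite_measure prob_space_chain) auto

text \<open>Conditioning on the first step makes the increment a constant and leaves a compensated sum of the remaining path, whose mean
  is zero; so the cross term vanishes and the second moments add up.\<close>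

lemma compensated_sum_moments:
  fixes K :: "'i::countable \<Rightarrow> 'i pmf"
  assumes u: "\<And>y. \<bar>u y\<bar> \<le> B"
  shows compensated_sum_mean: "(\<integral>s. compensated_sum K u N s \<partial>chain K x) = 0"
    and compensated_sum_second_moment: "(\<integral>s. (compensated_sum K u N s)\<^sup>2 \<partial>chain K x) \<le> real N * (2 * B)\<^sup>2"
proof (induction N arbitrary: x)
  case 0
  { case 1 show ?case by (simp add: compensated_sum_def) }
  { case 2 show ?case by (simp add: compensated_sum_def) }
next
  case (Suc N)
  let ?S = "compensated_sum K u"
  have B0: "0 \<le> B" using u[of undefined] by simp
  have int: "integrable (chain K y) (?S N)" for y
    by (rule integrable_chain_bounded[OF _ abs_compensated_sum_le[OF u]]) simp
  have sq: "(?S N s)\<^sup>2 \<le> (real N * (2 * B))\<^sup>2" for N s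
    using power_mono[OF abs_compensated_sum_le[of u B K N s, OF u], of 2] by simp
  have int2: "integrable (chain K y) (\<lambda>s. (?S N s)\<^sup>2)" for y
    by (rule integrable_chain_bounded[where B="(real N * (2 * B))\<^sup>2"]) (auto simp: sq)
  { case 1
    have "(\<integral>s. ?S (Suc N) s \<partial>chain K x)
        = (\<integral>y. (\<integral>s. (u (s 0) - kernel_op K u x) + ?S N s \<partial>chain K y) \<partial>measure_pmf (K x))"
      by (subst integral_chain_first_step[OF _ abs_compensated_sum_le[OF u]])
         (auto simp: compensated_sum_Suc_case_nat)
    also have "\<dots> = (\<integral>y. u y - kernel_op K u x \<partial>measure_pmf (K x))"
    proof (intro Bochner_Integration.integral_cong refl)
      fix y
      interpret Y: prob_space "chain K y" by (rule prob_space_chain)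
      have "(\<integral>s. (u (s 0) - kernel_op K u x) + ?S N s \<partial>chain K y) = (\<integral>s. (u y - kernel_op K u x) + ?S N s \<partial>chain K y)"
      proof (rule integral_cong_AE)
        show "AE s in chain K y. (u (s 0) - kernel_op K u x) + ?S N s = (u y - kernel_op K u x) + ?S N s"
          using chain_start[where K=K and x=y] by eventually_elim simp
      qed measurable
      also have "\<dots> = u y - kernel_op K u x"
        using int[of y] Suc(1)[of y] Y.prob_space by simp
      finally show "(\<integral>s. (u (s 0) - kernel_op K u x) + ?S N s \<partial>chain K y) = u y - kernel_op K u x" .
    qed
    also have "\<dots> = 0"
      using u by (simp add: integrable_pmf_bounded[where B=B] kernel_op_def)
    finally show ?case . }
  { case 2
    have "(\<integral>s. (?S (Suc N) s)\<^sup>2 \<partial>chain K x)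
        = (\<integral>y. (\<integral>s. ((u (s 0) - kernel_op K u x) + ?S N s)\<^sup>2 \<partial>chain K y) \<partial>measure_pmf (K x))"
      by (subst integral_chain_first_step[where B="(real (Suc N) * (2 * B))\<^sup>2"])
         (auto simp: compensated_sum_Suc_case_nat sq simp del: of_nat_Suc)
    also have "\<dots> \<le> (\<integral>y. real (Suc N) * (2 * B)\<^sup>2 \<partial>measure_pmf (K x))"
    proof (intro integral_mono)
      have eq: "(\<integral>s. ((u (s 0) - kernel_op K u x) + ?S N s)\<^sup>2 \<partial>chain K y)
          = (u y - kernel_op K u x)\<^sup>2 + (\<integral>s. (?S N s)\<^sup>2 \<partial>chain K y)" for y
      proof -
        let ?d = "u y - kernel_op K u x"
        interpret Y: prob_space "chain K y" by (rule prob_space_chain)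
        have "(\<integral>s. ((u (s 0) - kernel_op K u x) + ?S N s)\<^sup>2 \<partial>chain K y) = (\<integral>s. (?d + ?S N s)\<^sup>2 \<partial>chain K y)"
        proof (rule integral_cong_AE)
          show "AE s in chain K y. ((u (s 0) - kernel_op K u x) + ?S N s)\<^sup>2 = (?d + ?S N s)\<^sup>2"
            using chain_start[where K=K and x=y] by eventually_elim simp
        qed measurable
        also have "\<dots> = (\<integral>s. ?d\<^sup>2 + (2 * ?d * ?S N s + (?S N s)\<^sup>2) \<partial>chain K y)"
          by (intro Bochner_Integration.integral_cong) (auto simp: power2_sum)
        also have "\<dots> = ?d\<^sup>2 + (\<integral>s. (?S N s)\<^sup>2 \<partial>chain K y)"
          using int[of y] int2[of y] Suc(1)[of y] Y.prob_space by simp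
        finally show ?thesis .
      qed
      have d2: "(u y - kernel_op K u x)\<^sup>2 \<le> (2 * B)\<^sup>2" for y
        using power_mono[OF abs_compensated_increment_le[of u B y K x, OF u], of 2] by simp
      show le: "(\<integral>s. ((u (s 0) - kernel_op K u x) + ?S N s)\<^sup>2 \<partial>chain K y) \<le> real (Suc N) * (2 * B)\<^sup>2" for y
        unfolding eq using d2[of y] Suc(2)[of y] by (simp add: distrib_right)
      show "integrable (measure_pmf (K x)) (\<lambda>y. \<integral>s. ((u (s 0) - kernel_op K u x) + ?S N s)\<^sup>2 \<partial>chain K y)"
        using le by (intro integrable_pmf_bounded[where B="real (Suc N) * (2 * B)\<^sup>2"]) (simp del: of_nat_Suc)
    qed simp
    also have "\<dots> = real (Suc N) * (2 * B)\<^sup>2" by simp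
    finally show ?case . }
qed

text \<open>Between consecutive squares \<open>k\<^sup>2\<close> and \<open>(k + 1)\<^sup>2\<close> the sums change by \<open>O(k)\<close>, which is small compared with \<open>k\<^sup>2\<close>.\<close>

lemma tendsto_average_of_squares:
  fixes S :: "nat \<Rightarrow> real"
  assumes incr: "\<And>n. \<bar>S (Suc n) - S n\<bar> \<le> C"
    and lim: "(\<lambda>k. S (k\<^sup>2) / real (k\<^sup>2)) \<longlonglongrightarrow> 0"
  shows "(\<lambda>n. S n / real n) \<longlonglongrightarrow> 0"
proof -
  \<comment> \<open>The largest square below \<open>n\<close> is \<open>(r n)\<^sup>2\<close>.\<close>
  define r where "r n = nat \<lfloor>sqrt (real n)\<rfloor>" for n :: nat
  have r1: "(r n)\<^sup>2 \<le> n" for n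
  proof -
    have "real (r n) \<le> sqrt (real n)" by (simp add: r_def)
    then have "(real (r n))\<^sup>2 \<le> real n"
      using power_mono[of "real (r n)" "sqrt (real n)" 2] by simp
    then show ?thesis by (metis of_nat_le_iff of_nat_power)
  qed
  have r2: "n \<le> (r n)\<^sup>2 + 2 * r n" for n
  proof -
    have "sqrt (real n) < real (r n) + 1" by (simp add: r_def)
    then have "real n < (real (r n) + 1)\<^sup>2"
      using power_strict_mono[of "sqrt (real n)" "real (r n) + 1" 2] by simp
    then have "real n < real ((r n + 1)\<^sup>2)" by (simp add: add.commute)
    then have "n < (r n + 1)\<^sup>2" by (simp only: of_nat_less_iff)
    then show ?thesis by (simp add: power2_eq_square)
  qed
  have C: "0 \<le> C" using incr[of 0] by simp
  have S: "\<bar>S (n + d) - S n\<bar> \<le> real d * C" for n d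
  proof (induction d)
    case (Suc d)
    have "\<bar>S (n + Suc d) - S n\<bar> \<le> \<bar>S (Suc (n + d)) - S (n + d)\<bar> + \<bar>S (n + d) - S n\<bar>" by simp
    also have "\<dots> \<le> C + real d * C" using incr Suc by (rule add_mono)
    finally show ?case by (simp add: distrib_right)
  qed simp
  have bound: "norm (S n / real n) \<le> \<bar>S ((r n)\<^sup>2) / real ((r n)\<^sup>2)\<bar> + 2 * C / real (r n)" if "r n \<ge> 1" for n
  proof -
    have rn: "0 < real ((r n)\<^sup>2)" using that by simp
    have "\<bar>S n\<bar> \<le> \<bar>S ((r n)\<^sup>2)\<bar> + real (n - (r n)\<^sup>2) * C"
      using S[of "(r n)\<^sup>2" "n - (r n)\<^sup>2"] r1[of n] by simp
    also have "\<dots> \<le> \<bar>S ((r n)\<^sup>2)\<bar> + real (2 * r n) * C"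
      using r2[of n] C by (intro add_left_mono mult_right_mono) (auto simp del: of_nat_mult)
    finally have 1: "\<bar>S n\<bar> \<le> \<bar>S ((r n)\<^sup>2)\<bar> + real (2 * r n) * C" .
    have "norm (S n / real n) = \<bar>S n\<bar> / real n" by simp
    also have "\<dots> \<le> \<bar>S n\<bar> / real ((r n)\<^sup>2)"
      using r1[of n] rn by (intro divide_left_mono) (auto simp only: of_nat_le_iff abs_ge_zero intro!: mult_pos_pos)
    also have "\<dots> \<le> (\<bar>S ((r n)\<^sup>2)\<bar> + real (2 * r n) * C) / real ((r n)\<^sup>2)"
      using 1 rn by (intro divide_right_mono) auto
    also have "\<dots> = \<bar>S ((r n)\<^sup>2) / real ((r n)\<^sup>2)\<bar> + 2 * C / real (r n)"
      using that by (simp add: add_divide_distrib power2_eq_square)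
    finally show ?thesis .
  qed
  have rtop: "filterlim r at_top sequentially"
    unfolding r_def
    by (intro filterlim_compose[OF filterlim_nat_sequentially] filterlim_compose[OF filterlim_floor_sequentially]
          filterlim_compose[OF sqrt_at_top] filterlim_real_sequentially)
  have "(\<lambda>n. \<bar>S ((r n)\<^sup>2) / real ((r n)\<^sup>2)\<bar> + 2 * C / real (r n)) \<longlonglongrightarrow> \<bar>0\<bar> + 0"
  proof (intro tendsto_add tendsto_rabs)
    show "(\<lambda>n. S ((r n)\<^sup>2) / real ((r n)\<^sup>2)) \<longlonglongrightarrow> 0"
      using filterlim_compose[OF lim rtop] by simp
    show "(\<lambda>n. 2 * C / real (r n)) \<longlonglongrightarrow> 0"
      by (rule tendsto_divide_0[OF tendsto_const])
         (rule filterlim_at_top_imp_at_infinity, rule filterlim_compose[OF filterlim_real_sequentially rtop])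
  qed
  then have lim0: "(\<lambda>n. \<bar>S ((r n)\<^sup>2) / real ((r n)\<^sup>2)\<bar> + 2 * C / real (r n)) \<longlonglongrightarrow> 0" by simp
  have "eventually (\<lambda>n. r n \<ge> 1) sequentially"
    using rtop unfolding filterlim_at_top by blast
  then have "eventually (\<lambda>n. norm (S n / real n)
      \<le> \<bar>S ((r n)\<^sup>2) / real ((r n)\<^sup>2)\<bar> + 2 * C / real (r n)) sequentially"
    by (rule eventually_mono) (rule bound)
  then show ?thesis by (rule Lim_null_comparison[OF _ lim0])
qed

text \<open>The variance of the average over \<open>n\<close> steps is \<open>O(1 / n)\<close>, which is summable along the squares.\<close>

lemma compensated_sum_average:
  fixes K :: "'i::countable \<Rightarrow> 'i pmf"
  assumes u: "\<And>y. \<bar>u y\<bar> \<le> B"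
  shows "AE s in chain K x. (\<lambda>N. compensated_sum K u N s / real N) \<longlonglongrightarrow> 0"
proof -
  let ?S = "compensated_sum K u"
  let ?q = "\<lambda>k s. (?S ((Suc k)\<^sup>2) s / real ((Suc k)\<^sup>2))\<^sup>2"
  have q: "(\<integral>\<^sup>+s. ennreal (?q k s) \<partial>chain K x) \<le> ennreal ((2 * B)\<^sup>2 * (1 / (real (Suc k))\<^sup>2))" for k
  proof -
    let ?n = "(Suc k)\<^sup>2"
    have n: "0 < real ?n" by simp
    have sq: "(?S ?n s)\<^sup>2 \<le> (real ?n * (2 * B))\<^sup>2" for s
      using power_mono[OF abs_compensated_sum_le[of u B K ?n s, OF u], of 2] by simp
    have int: "integrable (chain K x) (\<lambda>s. (?S ?n s)\<^sup>2)"
      by (rule integrable_chain_bounded[where B="(real ?n * (2 * B))\<^sup>2"]) (auto simp: sq simp del: of_nat_power)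
    have "(\<integral>\<^sup>+s. ennreal (?q k s) \<partial>chain K x) = ennreal (\<integral>s. (?S ?n s)\<^sup>2 / (real ?n)\<^sup>2 \<partial>chain K x)"
      using int by (subst nn_integral_eq_integral) (auto simp: power_divide simp del: of_nat_power)
    also have "(\<integral>s. (?S ?n s)\<^sup>2 / (real ?n)\<^sup>2 \<partial>chain K x) = (\<integral>s. (?S ?n s)\<^sup>2 \<partial>chain K x) / (real ?n)\<^sup>2"
      by simp
    also have "\<dots> \<le> (real ?n * (2 * B)\<^sup>2) / (real ?n)\<^sup>2"
      by (intro divide_right_mono compensated_sum_second_moment u) simp
    also have "\<dots> = (2 * B)\<^sup>2 * (1 / real ?n)"
    proof -
      have "c * b / c\<^sup>2 = b * (1 / c)" if "0 < c" for b c :: real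
        using that by (simp add: power2_eq_square)
      then show ?thesis using n by blast
    qed
    also have "real ?n = (real (Suc k))\<^sup>2" by (rule of_nat_power)
    finally show ?thesis by (simp add: ennreal_leI)
  qed
  have sm: "summable (\<lambda>k. (2 * B)\<^sup>2 * (1 / (real (Suc k))\<^sup>2))"
    using inverse_power_summable[of 2, where 'a=real] 
    by (intro summable_mult) (simp add: summable_Suc_iff[of "\<lambda>k. 1 / (real k)\<^sup>2"] inverse_eq_divide del: of_nat_Suc)
  have "(\<integral>\<^sup>+s. (\<Sum>k. ennreal (?q k s)) \<partial>chain K x) = (\<Sum>k. \<integral>\<^sup>+s. ennreal (?q k s) \<partial>chain K x)"
    by (rule nn_integral_suminf) measurable
  also have "\<dots> \<le> (\<Sum>k. ennreal ((2 * B)\<^sup>2 * (1 / (real (Suc k))\<^sup>2)))"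
    by (intro suminf_le q) auto
  also have "\<dots> = ennreal (\<Sum>k. (2 * B)\<^sup>2 * (1 / (real (Suc k))\<^sup>2))"
    by (rule suminf_ennreal2[OF _ sm]) simp
  also have "\<dots> < \<infinity>" by simp
  finally have "AE s in chain K x. (\<Sum>k. ennreal (?q k s)) \<noteq> \<infinity>"
    by (intro nn_integral_PInf_AE) auto
  then show ?thesis
  proof eventually_elim
    case (elim s)
    then have "summable (\<lambda>k. ?q k s)"
      by (intro summable_suminf_not_top) (auto simp: top.not_eq_extremum)
    then have "(\<lambda>k. ?q k s) \<longlonglongrightarrow> 0" by (rule summable_LIMSEQ_zero)
    then have "(\<lambda>k. sqrt (?q k s)) \<longlonglongrightarrow> sqrt 0" by (rule tendsto_real_sqrt)
    then have "(\<lambda>k. \<bar>?S ((Suc k)\<^sup>2) s / real ((Suc k)\<^sup>2)\<bar>) \<longlonglongrightarrow> 0" by simp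
    then have "(\<lambda>k. ?S ((Suc k)\<^sup>2) s / real ((Suc k)\<^sup>2)) \<longlonglongrightarrow> 0" by (rule tendsto_rabs_zero_cancel)
    then have "(\<lambda>k. ?S (k\<^sup>2) s / real (k\<^sup>2)) \<longlonglongrightarrow> 0"
      by (rule LIMSEQ_imp_Suc)
    then show ?case
      by (rule tendsto_average_of_squares[rotated, where C="2 * B"])
         (use abs_compensated_increment_le[of u B, OF u] in \<open>simp add: compensated_sum_def\<close>)
  qed
qed

subsection \<open>Infinite mean return time gives frequency zero\<close>

text \<open>Let \<open>h k\<close> be the mean of the hitting time of \<open>a\<close> truncated at \<open>k\<close>. Along the path it decreases by at most
  one per step on average, except that a visit to \<open>a\<close> raises it, again on average, by \<open>T (Suc k) a - 1\<close>. As \<open>h k\<close> is bounded, the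
  law of large numbers for the compensated sums forces visits to have upper frequency at most \<open>1 / T (Suc k) a\<close>, which
  tends to zero if the mean return time is infinite.\<close>

lemma visit_frequency_zero:
  fixes K :: "'i::countable \<Rightarrow> 'i pmf"
  assumes ns: "\<not> summable (\<lambda>n. survival K a n a)"
  shows "AE s in chain K x. (\<lambda>N. (\<Sum>n<N. of_bool (s n = a)) / real N) \<longlonglongrightarrow> 0"
proof -
  define T where "T k x = (\<Sum>n<k. survival K a n x)" for k x
  define h where "h k x = (if x = a then 0 else T k x)" for k x
  have T0: "0 \<le> T k x" for k x by (simp add: T_def sum_nonneg survival_nonneg)
  have Tk: "T k x \<le> real k" for k x
    using sum_bounded_above[of "{..<k}" "\<lambda>n. survival K a n x" 1, OF survival_le_1] by (simp add: T_def)
  have h0: "0 \<le> h k x" and hk: "h k x \<le> real k" for k x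
    using T0 Tk by (auto simp: h_def)
  have Qh: "kernel_op K (h k) x = T (Suc k) x - 1" for k x
  proof -
    have "kernel_op K (h k) x = (\<integral>y. (\<Sum>n<k. (if y = a then 0 else survival K a n y)) \<partial>measure_pmf (K x))"
      unfolding kernel_op_def by (intro Bochner_Integration.integral_cong) (auto simp: h_def T_def)
    also have "\<dots> = (\<Sum>n<k. survival K a (Suc n) x)"
      using abs_survival_le_1
      by (subst Bochner_Integration.integral_sum) (auto intro!: integrable_pmf_bounded[where B=1])
    also have "\<dots> = T (Suc k) x - 1" by (simp add: T_def sum.lessThan_Suc_shift del: sum.lessThan_Suc survival.simps(2))
    finally show ?thesis .
  qed
  let ?V = "\<lambda>N s. (\<Sum>n<N. of_bool (s n = a)) :: real"
  \<comment> \<open>The drift of \<open>h k\<close> is at most \<open>0\<close> off \<open>a\<close>, at least \<open>-1\<close> there, and \<open>T (Suc k) a - 1\<close> at \<open>a\<close>; sum it along the path.\<close>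
  have drift: "?V N s * T (Suc k) a \<le> real N + real k - compensated_sum K (h k) N s" for k N s
  proof -
    have tel: "(\<Sum>n<N. h k (s (Suc n))) = (\<Sum>n<N. h k (s n)) + h k (s N) - h k (s 0)"
      using sum_lessThan_telescope[of "\<lambda>n. h k (s n)" N] by (simp add: sum_subtractf)
    have "h k y - kernel_op K (h k) y \<le> 1 - of_bool (y = a) * T (Suc k) a" for y
      using survival_nonneg[of K a k y] by (auto simp: Qh h_def T_def)
    then have "(\<Sum>n<N. h k (s n) - kernel_op K (h k) (s n)) \<le> (\<Sum>n<N. 1 - of_bool (s n = a) * T (Suc k) a)"
      by (intro sum_mono)
    also have "\<dots> = real N - ?V N s * T (Suc k) a" by (simp add: sum_subtractf sum_distrib_right)
    finally have "compensated_sum K (h k) N s \<le> h k (s N) - h k (s 0) + (real N - ?V N s * T (Suc k) a)"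
      using tel by (simp add: compensated_sum_def sum_subtractf)
    then show ?thesis using hk[of k "s N"] h0[of k "s 0"] by linarith
  qed
  have "AE s in chain K x. \<forall>k. (\<lambda>N. compensated_sum K (h k) N s / real N) \<longlonglongrightarrow> 0"
    unfolding AE_all_countable
    by (intro allI compensated_sum_average[where B="real _"]) (use h0 hk in auto)
  then show ?thesis
  proof eventually_elim
    case (elim s)
    show ?case
    proof (rule LIMSEQ_I)
      fix e :: real assume e: "0 < e"
      have "\<exists>k. 3 / e < T (Suc k) a"
      proof (rule ccontr)
        assume "\<not> ?thesis"
        then have "\<And>k. (\<Sum>n\<le>k. survival K a n a) \<le> 3 / e"
          by (auto simp: T_def lessThan_Suc_atMost not_less simp del: sum.lessThan_Suc)
        then have "summable (\<lambda>n. survival K a n a)"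
          by (intro bounded_imp_summable survival_nonneg)
        with ns show False by simp
      qed
      then obtain k where k: "3 / e < T (Suc k) a" by blast
      have Tpos: "0 < T (Suc k) a" using k e by (meson divide_pos_pos less_trans zero_less_numeral)
      have "(\<lambda>N. real k / real N - compensated_sum K (h k) N s / real N) \<longlonglongrightarrow> 0 - 0"
        using elim by (intro tendsto_diff lim_const_over_n) auto
      then have "eventually (\<lambda>N. real k / real N - compensated_sum K (h k) N s / real N < 1) sequentially"
        by (rule order_tendstoD) simp
      then have "eventually (\<lambda>N. ?V N s / real N < e) sequentially"
        using eventually_gt_at_top[of 0]
      proof eventually_elim
        case (elim N)
        then have N: "0 < real N" by simp
        have "?V N s * T (Suc k) a / real N \<le> (real N + real k - compensated_sum K (h k) N s) / real N"
          using N by (intro divide_right_mono drift) auto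
        also have "\<dots> = 1 + (real k / real N - compensated_sum K (h k) N s / real N)"
          using N by (simp add: field_simps)
        also have "\<dots> < 2" using elim by simp
        finally have "?V N s / real N < 2 / T (Suc k) a" using Tpos by (simp add: field_simps)
        also have "\<dots> < e" using k e Tpos by (simp add: field_simps)
        finally show ?case .
      qed
      moreover have "0 \<le> ?V N s / real N" for N by (simp add: sum_nonneg)
      ultimately show "\<exists>N0. \<forall>N\<ge>N0. norm (?V N s / real N - 0) < e"
        by (auto simp: eventually_sequentially sum_nonneg)
    qed
  qed
qed

subsection \<open>Words are visited\<close>

lemma measure_chain_shift_const:
  fixes K :: "'i::countable \<Rightarrow> 'i pmf"
  assumes A: "A \<in> sets path_space" and c: "\<And>y. measure (chain K y) A = c"
  shows "measure (chain K x) {s. (left_shift ^^ n) s \<in> A} = c"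
proof (induction n arbitrary: x)
  case (Suc n)
  have m: "{s. (left_shift ^^ n) s \<in> A} \<in> sets path_space" for n
    using measurable_sets[OF measurable_left_shift_funpow A, of n] by (simp add: vimage_def)
  show ?case
    by (subst measure_chain_first_step[OF m]) (simp add: funpow_Suc_right Suc del: funpow.simps)
qed (simp add: c)

text \<open>Let \<open>c\<close> be the probability that the word never occurs; it does not depend on the start. Starting at the first letter, the word
  occurs at once with probability \<open>\<delta> > 0\<close>, and whatever happens there it has to be avoided afterwards, which gives
  \<open>c \<le> c - \<delta> c\<close>.\<close>

lemma word_visited:
  fixes K :: "'i::countable \<Rightarrow> 'i pmf"
  assumes K: "irreducible_kernel K" "\<And>a. certain_return K a"
    and w: "0 < word_prob K (y # w)"
  shows "AE s in chain K x. \<exists>n. (left_shift ^^ n) s \<in> path_cyl (y # w)"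
proof -
  let ?C = "path_cyl (y # w)"
  define A where "A = {s. \<forall>n. (left_shift ^^ n) s \<notin> ?C}"
  have m: "{s. (left_shift ^^ n) s \<in> B} \<in> sets path_space" if "B \<in> sets path_space" for n and B :: "(nat \<Rightarrow> 'i) set"
    using measurable_sets[OF measurable_left_shift_funpow that, of n] by (simp add: vimage_def)
  have "A = UNIV - (\<Union>n. {s. (left_shift ^^ n) s \<in> ?C})" by (auto simp: A_def)
  also have "\<dots> \<in> sets path_space"
    using sets.compl_sets[of "\<Union>n. {s. (left_shift ^^ n) s \<in> ?C}" path_space] m[of ?C] by auto
  finally have A: "A \<in> sets path_space" .
  have sub: "left_shift s \<in> A" if sA: "s \<in> A" for s
  proof -
    have "(left_shift ^^ Suc n) s \<notin> ?C" for n using sA unfolding A_def by blast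
    then show ?thesis by (simp add: A_def funpow_Suc_right del: funpow.simps)
  qed
  define c where "c = measure (chain K y) A"
  have c: "measure (chain K x) A = c" for x
    unfolding c_def by (rule shift_invariant_constant[OF K A sub])
  interpret Y: prob_space "chain K y" by (rule prob_space_chain)
  let ?A' = "{s. (left_shift ^^ length w) s \<in> A}"
  have subn: "(left_shift ^^ n) s \<in> A" if "s \<in> A" for s n
    using that by (induction n) (auto intro: sub)
  have "c = Y.prob A" by (simp add: c_def)
  also have "\<dots> \<le> Y.prob (?A' - ?C)"
    using subn m[OF A] by (intro Y.finite_measure_mono) (auto simp: A_def dest: spec[of _ 0])
  also have "\<dots> = Y.prob ?A' - Y.prob (?C \<inter> ?A')"
    using Y.finite_measure_Diff'[of ?A' ?C] m[OF A] by (simp add: Int_commute)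
  also have "\<dots> = c - word_prob K (y # w) * c"
    by (simp add: measure_chain_markov[OF A] c measure_chain_shift_const[OF A c] measure_chain_path_cyl)
  finally have "word_prob K (y # w) * c \<le> 0" by simp
  then have "c \<le> 0" using w by (simp add: mult_le_0_iff)
  then have "measure (chain K x) A = 0" using c[of x] measure_nonneg[of "chain K x" A] by linarith
  moreover have "finite_measure (chain K x)" by (intro prob_space.finite_measure prob_space_chain)
  ultimately have "AE s in chain K x. s \<notin> A"
    using A by (subst AE_iff_measurable[OF _ refl]) (auto simp: finite_measure.emeasure_eq_measure)
  then show ?thesis by (simp add: A_def)
qed

subsection \<open>Positive recurrence: the ergodic theorem\<close>

lemma sum_lessThan_add: fixes m n :: nat shows "(\<Sum>k<m + n. g k) = (\<Sum>k<m. g k) + (\<Sum>k<n. (g (m + k) :: real))"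
  by (induction n) auto

text \<open>The covering argument of Katznelson and Weiss. Walk along the orbit: where some block of length at most \<open>R\<close> has average
  at most \<open>r\<close>, jump over such a block; elsewhere move one step and pay at most \<open>1\<close>, which the sum of indicators accounts for.
  The term \<open>R\<close> pays for an unfinished last block.\<close>

lemma greedy_cover_bound:
  fixes f :: "'s \<Rightarrow> real"
  assumes f: "\<And>s. 0 \<le> f s" "\<And>s. f s \<le> 1" and r: "0 \<le> r"
  shows "(\<Sum>k<L. f ((T ^^ k) s)) \<le> r * real L + real R
           + (\<Sum>k<L. of_bool (\<forall>n\<in>{1..R}. r * real n < (\<Sum>j<n. f ((T ^^ j) ((T ^^ k) s)))))"
    (is "?A L s \<le> _ + ?B L s")
proof (induction L arbitrary: s rule: less_induct)
  case (less L)
  have B0: "0 \<le> ?B L s" by (simp add: sum_nonneg)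
  show ?case
  proof (cases "L \<le> R")
    case True
    have "?A L s \<le> real L" using sum_bounded_above[of "{..<L}" "\<lambda>k. f ((T ^^ k) s)" 1, OF f(2)] by simp
    then show ?thesis using True B0 mult_nonneg_nonneg[OF r, of "real L"] by linarith
  next
    case False
    show ?thesis
    proof (cases "\<forall>n\<in>{1..R}. r * real n < ?A n s")
      case True
      obtain L' where L: "L = Suc L'" using False by (cases L) auto
      have "?A L s = f s + ?A L' (T s)"
        unfolding L by (simp add: sum.lessThan_Suc_shift funpow_Suc_right del: sum.lessThan_Suc funpow.simps(2))
      moreover have "?B L s = 1 + ?B L' (T s)"
        unfolding L using True
        by (simp add: sum.lessThan_Suc_shift funpow_Suc_right del: sum.lessThan_Suc funpow.simps(2))
      moreover have "?A L' (T s) \<le> r * real L' + real R + ?B L' (T s)"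
        by (rule less) (simp add: L)
      moreover have "r * real L' \<le> r * real L" using r by (simp add: L mult_left_mono)
      ultimately show ?thesis using f(2)[of s] by linarith
    next
      case False
      then obtain n where n: "1 \<le> n" "n \<le> R" "?A n s \<le> r * real n" by (auto simp: not_less)
      define m where "m = L - n"
      have L: "L = n + m" using n \<open>\<not> L \<le> R\<close> by (simp add: m_def)
      have fa: "(T ^^ (n + k)) s = (T ^^ k) ((T ^^ n) s)" for k
        by (metis add.commute comp_apply funpow_add)
      have "?A L s = ?A n s + ?A m ((T ^^ n) s)"
        unfolding L by (simp add: sum_lessThan_add fa)
      moreover have "?B m ((T ^^ n) s) \<le> ?B L s"
        unfolding L by (simp add: sum_lessThan_add fa sum_nonneg)
      moreover have "?A m ((T ^^ n) s) \<le> r * real m + real R + ?B m ((T ^^ n) s)"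
        by (rule less) (use n L in auto)
      moreover have "r * real L = r * real n + r * real m" by (simp add: L distrib_left)
      ultimately show ?thesis using n(3) by linarith
    qed
  qed
qed

text \<open>Integrate the covering bound over the invariant measure. With \<open>R\<close> large the points without a good block have small probability.\<close>

lemma integral_le_of_small_averages:
  fixes f :: "'s \<Rightarrow> real"
  assumes M: "prob_space M" and T [measurable]: "T \<in> measurable M M" and inv: "distr M M T = M"
    and f [measurable]: "f \<in> borel_measurable M" and f01: "\<And>s. 0 \<le> f s" "\<And>s. f s \<le> 1"
    and ae: "AE s in M. \<exists>n\<ge>1. (\<Sum>k<n. f ((T ^^ k) s)) \<le> r * real n"
  shows "(\<integral>s. f s \<partial>M) \<le> r"
proof -
  interpret prob_space M by fact
  let ?A = "\<lambda>n s. \<Sum>k<n. f ((T ^^ k) s)"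
  have r: "0 \<le> r"
  proof (rule ccontr)
    assume "\<not> 0 \<le> r"
    have "AE s in M. False"
      using ae
    proof eventually_elim
      case (elim s)
      then obtain n where n: "n \<ge> 1" "?A n s \<le> r * real n" by blast
      have "0 \<le> ?A n s" by (simp add: sum_nonneg f01)
      moreover have "r * real n < 0" using n \<open>\<not> 0 \<le> r\<close> by (simp add: mult_neg_pos)
      ultimately show False using n by linarith
    qed
    then show False by simp
  qed
  have Tk [measurable]: "T ^^ k \<in> measurable M M" for k
    by (induction k) auto
  have invk: "distr M M (T ^^ k) = M" for k
  proof (induction k)
    case (Suc k)
    have "distr M M (T ^^ Suc k) = distr (distr M M (T ^^ k)) M T"
      by (simp add: distr_distr comp_def)
    then show ?case by (simp only: Suc inv)
  qed (simp add: distr_id)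
  define bad where "bad R = {s\<in>space M. \<forall>n\<in>{1..R}. r * real n < ?A n s}" for R
  have bad [measurable]: "bad R \<in> sets M" for R unfolding bad_def by measurable
  have "(\<lambda>R. prob (bad R)) \<longlonglongrightarrow> prob (\<Inter>R. bad R)"
    by (rule finite_Lim_measure_decseq) (auto simp: decseq_def bad_def)
  moreover have "prob (\<Inter>R. bad R) = 0"
  proof -
    have "AE s in M. s \<notin> (\<Inter>R. bad R)"
      using ae
    proof eventually_elim
      case (elim s)
      then obtain n where "n \<ge> 1" "?A n s \<le> r * real n" by blast
      then have "s \<notin> bad n" by (auto simp: bad_def not_less intro!: bexI[of _ n])
      then show ?case by blast
    qed
    then show ?thesis by (subst prob_eq_0) auto
  qed
  ultimately have lim: "(\<lambda>R. prob (bad R)) \<longlonglongrightarrow> 0" by simp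
  have fb: "integrable M (\<lambda>s. f ((T ^^ k) s))" for k
    using f01 by (intro integrable_const_bound[where B=1]) auto
  have intf: "(\<integral>s. f ((T ^^ k) s) \<partial>M) = (\<integral>s. f s \<partial>M)" for k
    by (subst (2) invk[of k, symmetric]) (simp add: integral_distr)
  have intb: "(\<integral>s. indicator (bad R) ((T ^^ k) s) \<partial>M) = prob (bad R)" for k R
  proof -
    have "(\<integral>s. indicator (bad R) ((T ^^ k) s) \<partial>M) = (\<integral>s. (indicator (bad R) s :: real) \<partial>distr M M (T ^^ k))"
      by (rule integral_distr[symmetric]) auto
    then show ?thesis by (simp add: invk)
  qed
  have key: "real L * (\<integral>s. f s \<partial>M) \<le> r * real L + real R + real L * prob (bad R)" for L R
  proof -
    have ib: "integrable M (\<lambda>s. indicator (bad R) ((T ^^ k) s) :: real)" for k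
      by (intro integrable_const_bound[where B=1]) auto
    have "real L * (\<integral>s. f s \<partial>M) = (\<integral>s. ?A L s \<partial>M)"
      using fb by (simp add: Bochner_Integration.integral_sum intf)
    also have "\<dots> \<le> (\<integral>s. r * real L + real R + (\<Sum>k<L. indicator (bad R) ((T ^^ k) s)) \<partial>M)"
    proof (intro integral_mono)
      fix s assume s: "s \<in> space M"
      then have "(T ^^ k) s \<in> space M" for k using measurable_space[OF Tk] by blast
      then have "(\<Sum>k<L. indicator (bad R) ((T ^^ k) s)) = 
         (\<Sum>k<L. of_bool (\<forall>n\<in>{1..R}. r * real n < (\<Sum>j<n. f ((T ^^ j) ((T ^^ k) s)))) :: real)"
        by (intro sum.cong) (auto simp: bad_def indicator_def)
      with greedy_cover_bound[of f r T s L R, OF f01 r]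
      show "?A L s \<le> r * real L + real R + (\<Sum>k<L. indicator (bad R) ((T ^^ k) s))" by simp
    qed (use fb ib in auto)
    also have "\<dots> = r * real L + real R + real L * prob (bad R)"
      using ib by (simp add: Bochner_Integration.integral_sum intb prob_space)
    finally show ?thesis .
  qed
  have "(\<integral>s. f s \<partial>M) \<le> r + prob (bad R)" for R
  proof (rule LIMSEQ_le_const)
    show "(\<lambda>L. r + prob (bad R) + real R / real L) \<longlonglongrightarrow> r + prob (bad R)"
      using tendsto_add[OF tendsto_const lim_const_over_n[of "real R"]] by simp
    show "\<exists>N. \<forall>L\<ge>N. (\<integral>s. f s \<partial>M) \<le> r + prob (bad R) + real R / real L"
    proof (intro exI allI impI)
      fix L :: nat assume "L \<ge> 1"
      then show "(\<integral>s. f s \<partial>M) \<le> r + prob (bad R) + real R / real L"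
        using key[of L R] by (simp add: field_simps)
    qed
  qed
  then show ?thesis
    by (intro LIMSEQ_le_const[OF tendsto_add[OF tendsto_const[of r] lim, simplified]]) auto
qed

lemma left_shift_stationary:
  fixes K :: "'i::countable \<Rightarrow> 'i pmf"
  assumes st: "bind_pmf p K = p"
  shows "distr (measure_pmf p \<bind> chain K) path_space left_shift = measure_pmf p \<bind> chain K"
proof -
  have "distr (measure_pmf p \<bind> chain K) path_space left_shift
      = measure_pmf p \<bind> (\<lambda>x. distr (chain K x) path_space left_shift)"
    by (rule distr_bind[OF chain_measurable]) auto
  also have "\<dots> = measure_pmf p \<bind> (\<lambda>x. measure_pmf (K x) \<bind> chain K)"
    by (simp add: left_shift_chain)
  also have "\<dots> = (measure_pmf p \<bind> (\<lambda>x. measure_pmf (K x))) \<bind> chain K"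
    by (rule bind_assoc[where N="count_space UNIV" and R=path_space, symmetric])
       (use chain_measurable[of K] measurable_measure_pmf[of K] in \<open>auto cong: measurable_cong_sets\<close>)
  also have "\<dots> = measure_pmf p \<bind> chain K"
    using st by (simp add: measure_pmf_bind[symmetric])
  finally show ?thesis .
qed

text \<open>That the sums fall below every line of slope \<open>r\<close> is an invariant event, since a shift changes them by a bounded
  amount. If it had probability one, the covering argument would bound the integral by \<open>r\<close>. By the zero-one law it has probability
  zero, and this for every starting state.\<close>

lemma stationary_liminf_averages:
  fixes K :: "'i::countable \<Rightarrow> 'i pmf" and f :: "(nat \<Rightarrow> 'i) \<Rightarrow> real"
  assumes K: "irreducible_kernel K" "\<And>a. certain_return K a" and st: "bind_pmf p K = p"
    and f [measurable]: "f \<in> borel_measurable path_space" and f01: "\<And>s. 0 \<le> f s" "\<And>s. f s \<le> 1"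
    and r: "r < (\<integral>s. f s \<partial>(measure_pmf p \<bind> chain K))"
  shows "AE s in chain K x. \<exists>c. \<forall>n. r * real n - real c < (\<Sum>k<n. f ((left_shift ^^ k) s))"
proof -
  let ?A = "\<lambda>n s. \<Sum>k<n. f ((left_shift ^^ k) s)"
  let ?M = "measure_pmf p \<bind> chain K"
  \<comment> \<open>Unboundedness below, rather than a lower limit of averages, makes invariance under the shift exact.\<close>
  define E where "E = {s. \<forall>c::nat. \<exists>n. ?A n s \<le> r * real n - real c}"
  have A_Suc: "?A (Suc n) s = f s + ?A n (left_shift s)" for n s
    by (simp add: sum.lessThan_Suc_shift funpow_Suc_right del: sum.lessThan_Suc funpow.simps(2))
  have "{s \<in> space path_space. \<forall>c::nat. \<exists>n. ?A n s \<le> r * real n - real c} \<in> sets path_space"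
    by measurable
  then have E: "E \<in> sets path_space" by (simp add: E_def)
  obtain q :: nat where q: "\<bar>r\<bar> \<le> real q" using real_arch_simple by blast
  then have q': "- real q \<le> r" "r \<le> real q" by auto
  have inv: "left_shift s \<in> E \<longleftrightarrow> s \<in> E" for s
  proof
    assume *: "left_shift s \<in> E"
    show "s \<in> E" unfolding E_def
    proof (clarify)
      fix c :: nat
      obtain n where "?A n (left_shift s) \<le> r * real n - real (c + 1 + q)"
        using * unfolding E_def by blast
      then have "?A (Suc n) s \<le> r * real (Suc n) - real c"
        using q' f01(2)[of s] unfolding A_Suc by (simp add: distrib_left)
      then show "\<exists>n. ?A n s \<le> r * real n - real c" by blast
    qed
  next
    assume *: "s \<in> E"
    show "left_shift s \<in> E" unfolding E_def
    proof (clarify)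
      fix c :: nat
      obtain n where n: "?A n s \<le> r * real n - real (c + 1 + q)"
        using * unfolding E_def by blast
      then obtain n' where n': "n = Suc n'" by (cases n) auto
      have "?A n' (left_shift s) \<le> r * real n' - real c"
        using n q' f01(1)[of s] unfolding n' A_Suc by (simp add: distrib_left)
      then show "\<exists>n. ?A n (left_shift s) \<le> r * real n - real c" by blast
    qed
  qed
  have "\<not> (\<forall>x. measure (chain K x) E = 1)"
  proof
    assume 1: "\<forall>x. measure (chain K x) E = 1"
    have ae: "AE s in chain K x. s \<in> E" for x
      using 1 E by (subst prob_space.prob_eq_1[OF prob_space_chain, symmetric]) auto
    have "AE s in ?M. s \<in> E"
      using E ae by (subst AE_bind[OF chain_measurable]) auto
    then have "AE s in ?M. \<exists>n\<ge>1. ?A n s \<le> r * real n"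
    proof eventually_elim
      case (elim s)
      then obtain n where n: "?A n s \<le> r * real n - real 1" unfolding E_def by blast
      then have "n \<ge> 1" by (cases n) auto
      with n show ?case by (intro exI[of _ n]) auto
    qed
    moreover have sM: "sets ?M = sets path_space" by (rule started_chain)
    moreover have "distr ?M ?M left_shift = ?M"
    proof -
      have "distr ?M ?M left_shift = distr ?M path_space left_shift"
        by (rule distr_cong) (simp_all only: sM)
      then show ?thesis using left_shift_stationary[OF st] by simp
    qed
    ultimately have "(\<integral>s. f s \<partial>?M) \<le> r"
      by (intro integral_le_of_small_averages[where T=left_shift] started_chain(1) f01)
         (simp_all cong: measurable_cong_sets)
    with r show False by simp
  qed
  with shift_invariant_zero_one[OF K E inv] have "measure (chain K x) E = 0" by blast
  then have "AE s in chain K x. s \<notin> E"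
    using E by (subst prob_space.prob_eq_0[OF prob_space_chain, symmetric]) auto
  then show ?thesis by (auto simp: E_def not_le elim!: eventually_mono)
qed

text \<open>The lower bound applied to \<open>f\<close> and to \<open>1 - f\<close>. The chain may start anywhere although the limit is computed in the
  stationary chain.\<close>

theorem ergodic_averages:
  fixes K :: "'i::countable \<Rightarrow> 'i pmf" and f :: "(nat \<Rightarrow> 'i) \<Rightarrow> real"
  assumes K: "irreducible_kernel K" "\<And>a. certain_return K a" and st: "bind_pmf p K = p"
    and f [measurable]: "f \<in> borel_measurable path_space" and f01: "\<And>s. 0 \<le> f s" "\<And>s. f s \<le> 1"
  shows "AE s in chain K x. (\<lambda>n. (\<Sum>k<n. f ((left_shift ^^ k) s)) / real n)
           \<longlonglongrightarrow> (\<integral>s. f s \<partial>(measure_pmf p \<bind> chain K))"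
proof -
  let ?M = "measure_pmf p \<bind> chain K"
  let ?A = "\<lambda>f n s. \<Sum>k<n. f ((left_shift ^^ k) s) :: real"
  interpret M: prob_space ?M by (rule started_chain)
  have "space ?M = UNIV" using sets_eq_imp_space_eq[OF started_chain(2)[of p K]] by simp
  then have M1: "M.prob UNIV = 1" using M.prob_space by simp
  have lower: "AE s in chain K x. \<forall>j::nat. \<forall>\<^sub>F n in sequentially.
      (\<integral>s. g s \<partial>?M) - 2 / (real j + 1) < ?A g n s / real n"
    if g: "g \<in> borel_measurable path_space" "\<And>s. 0 \<le> g s" "\<And>s. g s \<le> 1" for g
    unfolding AE_all_countable
  proof
    fix j :: nat
    let ?r = "(\<integral>s. g s \<partial>?M) - 1 / (real j + 1)"
    have j: "0 < 1 / (real j + 1)" by simp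
    have "AE s in chain K x. \<exists>c. \<forall>n. ?r * real n - real c < ?A g n s"
      by (rule stationary_liminf_averages[OF K st g]) (use j in simp)
    then show "AE s in chain K x. \<forall>\<^sub>F n in sequentially. (\<integral>s. g s \<partial>?M) - 2 / (real j + 1) < ?A g n s / real n"
    proof eventually_elim
      case (elim s)
      then obtain c where c: "\<And>n. ?r * real n - real c < ?A g n s" by blast
      have "(\<lambda>n. real c / real n) \<longlonglongrightarrow> 0" by (rule lim_const_over_n)
      then have "\<forall>\<^sub>F n in sequentially. real c / real n < 1 / (real j + 1)"
        using j by (rule order_tendstoD)
      then show ?case using eventually_gt_at_top[of 0]
      proof eventually_elim
        case (elim n)
        have "(?r * real n - real c) / real n < ?A g n s / real n"
          using c[of n] elim by (intro divide_strict_right_mono) auto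
        moreover have "(?r * real n - real c) / real n = ?r - real c / real n"
          using elim by (simp add: diff_divide_distrib)
        ultimately show ?case using elim(1) by linarith
      qed
    qed
  qed
  have intf: "integrable ?M f"
    using f01 started_chain(2)[of p K]
    by (intro M.integrable_const_bound[where B=1]) (auto cong: measurable_cong_sets)
  have int1: "(\<integral>s. 1 - f s \<partial>?M) = 1 - (\<integral>s. f s \<partial>?M)"
    using intf by (subst Bochner_Integration.integral_diff) (auto simp: M1)
  have f': "(\<lambda>s. 1 - f s) \<in> borel_measurable path_space" by measurable
  have "AE s in chain K x. \<forall>j::nat. \<forall>\<^sub>F n in sequentially. (\<integral>s. f s \<partial>?M) - 2 / (real j + 1) < ?A f n s / real n"
    by (rule lower[OF f f01])
  moreover have "AE s in chain K x. \<forall>j::nat. \<forall>\<^sub>F n in sequentially.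
      (\<integral>s. 1 - f s \<partial>?M) - 2 / (real j + 1) < ?A (\<lambda>s. 1 - f s) n s / real n"
    by (rule lower[OF f']) (use f01 in auto)
  ultimately show ?thesis
  proof eventually_elim
    case (elim s)
    show ?case
    proof (rule LIMSEQ_I)
      fix e :: real assume "0 < e"
      then obtain j :: nat where "2 / e < real j" using reals_Archimedean2 by blast
      then have j: "2 / (real j + 1) < e" using \<open>0 < e\<close> by (simp add: field_simps)
      have "\<forall>\<^sub>F n in sequentially. norm (?A f n s / real n - (\<integral>s. f s \<partial>?M)) < e"
        using elim(1)[rule_format, of j] elim(2)[rule_format, of j] eventually_gt_at_top[of 0]
      proof eventually_elim
        case (elim n)
        have "?A (\<lambda>s. 1 - f s) n s / real n = 1 - ?A f n s / real n"
          using elim(3) by (simp add: sum_subtractf diff_divide_distrib)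
        then show ?case using elim(1,2) j unfolding int1 by (simp add: abs_less_iff)
      qed
      then show "\<exists>n0. \<forall>n\<ge>n0. norm (?A f n s / real n - (\<integral>s. f s \<partial>?M)) < e"
        by (simp add: eventually_sequentially)
    qed
  qed
qed

section \<open>The backward kernel of a Markov shift\<close>

definition predecessors :: "('i \<Rightarrow> 'i \<Rightarrow> real) \<Rightarrow> 'i \<Rightarrow> 'i set" where
  "predecessors m j = {i. m i j = 1}"

definition backward_kernel :: "('i \<Rightarrow> 'i \<Rightarrow> real) \<Rightarrow> 'i \<Rightarrow> 'i pmf" where
  "backward_kernel m j = pmf_of_set (predecessors m j)"

locale backward_shift =
  fixes m :: "'i::countable \<Rightarrow> 'i \<Rightarrow> real"
  assumes zero_one: "zero_one_matrix m"
    and transitive: "transitive_shift m"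
    and finite_columns: "finite_column_sums m"
begin

abbreviation "Q \<equiv> backward_matrix m"
abbreviation "K \<equiv> backward_kernel m"

lemma entry_cases: "m i j = 0 \<or> m i j = 1"
  using zero_one by (auto simp: zero_one_matrix_def)

lemma finite_predecessors: "finite (predecessors m j)"
proof (rule ccontr)
  assume inf: "infinite (predecessors m j)"
  have s: "(\<lambda>i. m i j) summable_on UNIV" using finite_columns by (simp add: finite_column_sums_def)
  obtain n :: nat where n: "(\<Sum>\<^sub>\<infinity>i. m i j) < real n" using reals_Archimedean2 by blast
  obtain B where B: "finite B" "card B = n" "B \<subseteq> predecessors m j"
    using infinite_arbitrarily_large[OF inf, of n] by blast
  have "real n = (\<Sum>i\<in>B. m i j)" using B by (simp add: predecessors_def subset_iff)
  also have "\<dots> \<le> (\<Sum>\<^sub>\<infinity>i. m i j)"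
  proof (rule finite_sum_le_infsum[OF s B(1)])
    show "0 \<le> m i j" for i using entry_cases[of i j] by auto
  qed simp
  finally show False using n by simp
qed

lemma predecessors_nonempty: "predecessors m j \<noteq> {}"
proof -
  have "(j, j) \<in> {(a, b). m a b > 0}\<^sup>+" using transitive by (simp add: transitive_shift_def)
  then obtain z where "m z j > 0" by (auto dest: tranclD2)
  then have "m z j = 1" using entry_cases[of z j] by auto
  then show ?thesis by (auto simp: predecessors_def)
qed

lemma column_sum_eq: "column_sum m j = real (card (predecessors m j))"
proof -
  have "column_sum m j = (\<Sum>\<^sub>\<infinity>i\<in>predecessors m j. m i j)"
    unfolding column_sum_def using entry_cases
    by (intro infsum_cong_neutral) (auto simp: predecessors_def)
  also have "\<dots> = (\<Sum>i\<in>predecessors m j. m i j)" by (rule infsum_finite[OF finite_predecessors])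
  also have "\<dots> = real (card (predecessors m j))" by (simp add: predecessors_def)
  finally show ?thesis .
qed

lemma set_backward_kernel: "set_pmf (K j) = predecessors m j"
  by (simp add: backward_kernel_def set_pmf_of_set finite_predecessors predecessors_nonempty)

lemma finite_set_backward_kernel: "finite (set_pmf (K j))"
  by (simp add: set_backward_kernel finite_predecessors)

lemma pmf_backward_kernel: "pmf (K j) i = Q j i"
proof -
  have "pmf (K j) i = indicator (predecessors m j) i / real (card (predecessors m j))"
    unfolding backward_kernel_def by (rule pmf_of_set[OF predecessors_nonempty finite_predecessors])
  then show ?thesis
    using entry_cases[of i j] by (auto simp: backward_matrix_def column_sum_eq predecessors_def)
qed

lemma irreducible_backward_kernel: "irreducible_kernel K"
proof -
  have e: "{(u, v). v \<in> set_pmf (K u)} = {(a, b). m a b > 0}\<inverse>"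
  proof -
    have "v \<in> set_pmf (K u) \<longleftrightarrow> m v u > 0" for u v
      using entry_cases[of v u] by (auto simp: set_backward_kernel predecessors_def)
    then show ?thesis by auto
  qed
  have "(x, y) \<in> ({(a, b). m a b > 0}\<inverse>)\<^sup>*" for x y
    using transitive by (simp add: transitive_shift_def rtrancl_converse trancl_into_rtrancl)
  then show ?thesis by (simp add: irreducible_kernel_def e)
qed

subsection \<open>Recurrence\<close>

lemma infsum_off_point:
  assumes "finite (set_pmf p)"
  shows "(\<Sum>\<^sub>\<infinity>k\<in>- {a}. pmf p k * g k) = (\<integral>y. (if y = a then 0 else g y) \<partial>measure_pmf p)"
proof -
  have "(\<Sum>\<^sub>\<infinity>k\<in>- {a}. pmf p k * g k) = (\<Sum>\<^sub>\<infinity>k\<in>set_pmf p. (if k = a then 0 else g k) * pmf p k)"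
    by (intro infsum_cong_neutral) (auto simp: set_pmf_iff)
  also have "\<dots> = (\<integral>y. (if y = a then 0 else g y) \<partial>measure_pmf p)"
    using assms by (subst integral_measure_pmf_real[OF assms]) (auto simp: infsum_finite)
  finally show ?thesis .
qed

text \<open>First passage at time \<open>n + 1\<close> means survival up to \<open>n\<close> but not up to \<open>n + 1\<close>.\<close>

lemma first_passage_eq: "first_passage Q (Suc n) x a = survival K a n x - survival K a (Suc n) x"
proof (induction n arbitrary: x)
  case 0
  have "(\<integral>y. (if y = a then 0 else 1) \<partial>measure_pmf (K x)) = (\<integral>y. 1 - (if y = a then 1 else 0) \<partial>measure_pmf (K x))"
    by (intro Bochner_Integration.integral_cong) auto
  also have "\<dots> = 1 - pmf (K x) a"
    by (subst Bochner_Integration.integral_diff) (auto intro!: integrable_pmf_bounded[where B=1] simp: integral_pmf_delta)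
  finally show ?case by (simp add: pmf_backward_kernel cong: if_cong)
next
  case (Suc n)
  have "first_passage Q (Suc (Suc n)) x a = (\<Sum>\<^sub>\<infinity>k\<in>- {a}. pmf (K x) k * first_passage Q (Suc n) k a)"
    by (simp add: pmf_backward_kernel)
  also have "\<dots> = (\<integral>y. (if y = a then 0 else first_passage Q (Suc n) y a) \<partial>measure_pmf (K x))"
    by (rule infsum_off_point[OF finite_set_backward_kernel])
  also have "\<dots> = (\<integral>y. (if y = a then 0 else survival K a n y) - (if y = a then 0 else survival K a (Suc n) y) \<partial>measure_pmf (K x))"
    by (intro Bochner_Integration.integral_cong refl) (simp add: Suc.IH del: survival.simps first_passage.simps)
  also have "\<dots> = (\<integral>y. (if y = a then 0 else survival K a n y) \<partial>measure_pmf (K x))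
      - (\<integral>y. (if y = a then 0 else survival K a (Suc n) y) \<partial>measure_pmf (K x))"
    using abs_survival_le_1
    by (intro Bochner_Integration.integral_diff integrable_pmf_bounded[where B=1]) (auto simp del: survival.simps)
  also have "\<dots> = survival K a (Suc n) x - survival K a (Suc (Suc n)) x"
    by (simp only: survival.simps(2))
  finally show ?case .
qed

lemma sum_first_passage: "(\<Sum>n<N. first_passage Q (Suc n) x a) = 1 - survival K a N x"
  by (induction N) (auto simp: first_passage_eq simp del: first_passage.simps survival.simps(2))

lemma recurrent_state_iff: "recurrent_state Q a \<longleftrightarrow> certain_return K a"
proof -
  have "recurrent_state Q a \<longleftrightarrow> (\<lambda>n. first_passage Q (Suc n) a a) sums 1"
    unfolding recurrent_state_def using sums_Suc_iff[of "\<lambda>n. first_passage Q n a a" 1] by simp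
  also have "\<dots> \<longleftrightarrow> (\<lambda>N. 1 - survival K a N a) \<longlonglongrightarrow> 1"
    by (simp add: sums_def sum_first_passage del: first_passage.simps)
  also have "\<dots> \<longleftrightarrow> certain_return K a"
  proof
    assume "(\<lambda>N. 1 - survival K a N a) \<longlonglongrightarrow> 1"
    from tendsto_diff[OF tendsto_const[of 1] this] show "certain_return K a"
      by (simp add: certain_return_def)
  next
    assume "certain_return K a"
    from tendsto_diff[OF tendsto_const[of 1] this[unfolded certain_return_def]]
    show "(\<lambda>N. 1 - survival K a N a) \<longlonglongrightarrow> 1" by simp
  qed
  finally show ?thesis .
qed

text \<open>Summation by parts; the boundary term \<open>N S\<^sub>N\<close> is what separates the mean return time from the sum of its tails.\<close>

lemma sum_times_first_passage:
  "(\<Sum>n<N. real (Suc n) * first_passage Q (Suc n) x a) = (\<Sum>n<N. survival K a n x) - real N * survival K a N x"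
  by (induction N) (auto simp: first_passage_eq algebra_simps simp del: first_passage.simps survival.simps(2))

lemma finite_mean_return_time_alt:
  "finite_mean_return_time Q a \<longleftrightarrow> summable (\<lambda>n. real (Suc n) * first_passage Q (Suc n) a a)"
  unfolding finite_mean_return_time_def
  using summable_Suc_iff[of "\<lambda>n. real n * first_passage Q n a a"] by simp

lemma first_passage_Suc_nonneg: "0 \<le> first_passage Q (Suc n) x a"
  unfolding first_passage_eq using survival_Suc_le[of K a n x] by simp

text \<open>For the converse direction the boundary term has to be bounded: \<open>N S\<^sub>N = N \<Sum>\<^sub>k\<^sub>>\<^sub>N f\<^sub>k \<le> \<Sum>\<^sub>k\<^sub>>\<^sub>N k f\<^sub>k\<close>, where certain return is
  used to write \<open>S\<^sub>N\<close> as the tail of the first passage probabilities.\<close>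

lemma finite_mean_return_time_iff:
  assumes rec: "certain_return K a"
  shows "finite_mean_return_time Q a \<longleftrightarrow> summable (\<lambda>n. survival K a n a)"
proof
  assume s: "summable (\<lambda>n. survival K a n a)"
  have "(\<Sum>n\<le>N. real (Suc n) * first_passage Q (Suc n) a a) \<le> (\<Sum>n. survival K a n a)" for N
  proof -
    have "0 \<le> real (Suc N) * survival K a (Suc N) a"
      by (intro mult_nonneg_nonneg survival_nonneg) simp
    then have "(\<Sum>n\<le>N. real (Suc n) * first_passage Q (Suc n) a a) \<le> (\<Sum>n<Suc N. survival K a n a)"
      using sum_times_first_passage[of a a "Suc N"] unfolding lessThan_Suc_atMost by linarith
    also have "\<dots> \<le> (\<Sum>n. survival K a n a)"
      by (rule sum_le_suminf[OF s]) (auto intro: survival_nonneg)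
    finally show ?thesis .
  qed
  then show "finite_mean_return_time Q a"
    unfolding finite_mean_return_time_alt
    by (intro bounded_imp_summable mult_nonneg_nonneg first_passage_Suc_nonneg) auto
next
  assume "finite_mean_return_time Q a"
  then have s: "summable (\<lambda>n. real (Suc n) * first_passage Q (Suc n) a a)"
    by (simp only: finite_mean_return_time_alt)
  define c where "c = (\<Sum>n. real (Suc n) * first_passage Q (Suc n) a a)"
  have nn: "0 \<le> real (Suc n) * first_passage Q (Suc n) a a" for n
    by (intro mult_nonneg_nonneg first_passage_Suc_nonneg) simp
  have part: "(\<Sum>n<N. real (Suc n) * first_passage Q (Suc n) a a) \<le> c" for N
    unfolding c_def by (rule sum_le_suminf[OF s]) (auto intro: nn simp del: of_nat_Suc first_passage.simps)
  have NS: "real N * survival K a N a \<le> c" for N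
  proof (rule LIMSEQ_le_const2)
    show "(\<lambda>L. real N * (survival K a N a - survival K a L a)) \<longlonglongrightarrow> real N * survival K a N a"
      using tendsto_mult[OF tendsto_const[of "real N"] tendsto_diff[OF tendsto_const[of "survival K a N a"]
        rec[unfolded certain_return_def]]] by simp
    show "\<exists>L0. \<forall>L\<ge>L0. real N * (survival K a N a - survival K a L a) \<le> c"
    proof (intro exI allI impI)
      fix L assume "L \<ge> N"
      then have "real N * (survival K a N a - survival K a L a)
         \<le> (\<Sum>n<L. real (Suc n) * first_passage Q (Suc n) a a)"
      proof (induction L rule: dec_induct)
        case base
        show ?case by (simp add: sum_nonneg nn del: of_nat_Suc first_passage.simps)
      next
        case (step L)
        have "real N * first_passage Q (Suc L) a a \<le> real (Suc L) * first_passage Q (Suc L) a a"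
          by (intro mult_right_mono first_passage_Suc_nonneg) (use step in simp)
        moreover have "real N * (survival K a N a - survival K a (Suc L) a)
            = real N * (survival K a N a - survival K a L a) + real N * first_passage Q (Suc L) a a"
          by (simp add: first_passage_eq algebra_simps del: first_passage.simps survival.simps(2))
        ultimately show ?case using step.IH by (simp del: of_nat_Suc first_passage.simps survival.simps(2))
      qed
      also have "\<dots> \<le> c" by (rule part)
      finally show "real N * (survival K a N a - survival K a L a) \<le> c" .
    qed
  qed
  show "summable (\<lambda>n. survival K a n a)"
  proof (rule bounded_imp_summable[OF survival_nonneg])
    fix N
    have "(\<Sum>n<Suc N. survival K a n a) \<le> c + c"
      using part[of "Suc N"] NS[of "Suc N"] sum_times_first_passage[of a a "Suc N"] by linarith
    then show "(\<Sum>n\<le>N. survival K a n a) \<le> c + c" by (simp only: lessThan_Suc_atMost)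
  qed
qed

lemma positive_recurrent_iff:
  "positive_recurrent Q \<longleftrightarrow> (\<forall>a. certain_return K a \<and> summable (\<lambda>n. survival K a n a))"
  unfolding positive_recurrent_def using finite_mean_return_time_iff by (auto simp: recurrent_state_iff)

lemma null_recurrent_iff:
  "null_recurrent Q \<longleftrightarrow> (\<forall>a. certain_return K a \<and> \<not> summable (\<lambda>n. survival K a n a))"
  unfolding null_recurrent_def using finite_mean_return_time_iff by (auto simp: recurrent_state_iff)

lemma transient_iff: "transient Q \<longleftrightarrow> (\<forall>a. \<not> certain_return K a)"
  unfolding transient_def by (simp add: recurrent_state_iff)

subsection \<open>Stationary vectors\<close>

text \<open>Translates integrals against a probability mass function into the unordered sums in which stationarity is phrased.\<close>

lemma has_sum_pmf_times:
  fixes f :: "'i \<Rightarrow> real"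
  assumes f: "\<And>y. \<bar>f y\<bar> \<le> B"
  shows "((\<lambda>y. pmf p y * f y) has_sum (\<integral>y. f y \<partial>measure_pmf p)) UNIV"
proof -
  have "Infinite_Set_Sum.abs_summable_on (\<lambda>y. B * pmf p y) UNIV"
    by (intro abs_summable_on_cmult_right pmf_abs_summable)
  then have abs: "Infinite_Set_Sum.abs_summable_on (\<lambda>y. pmf p y * f y) UNIV"
  proof (rule abs_summable_on_comparison_test)
    fix y
    have "B \<ge> 0" using f[of y] by simp
    have "pmf p y * \<bar>f y\<bar> \<le> pmf p y * B" by (intro mult_left_mono f) simp
    then show "norm (pmf p y * f y) \<le> norm (B * pmf p y)"
      using \<open>B \<ge> 0\<close> by (simp add: abs_mult mult.commute)
  qed
  then have s: "(\<lambda>y. pmf p y * f y) summable_on UNIV"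
    by (rule abs_summable_summable[OF abs_summable_equivalent[THEN iffD2]])
  have e: "(\<Sum>\<^sub>\<infinity>y. pmf p y * f y) = (\<integral>y. f y \<partial>measure_pmf p)"
    by (simp only: pmf_expectation_eq_infsetsum infsetsum_infsum[OF abs])
  show ?thesis using has_sum_infsum[OF s] unfolding e .
qed

lemma is_stationary_pmf: "is_stationary Q (pmf p) \<longleftrightarrow> bind_pmf p K = p"
proof -
  have 1: "((\<lambda>j. pmf p j * Q j i) has_sum pmf (bind_pmf p K) i) UNIV" for i
    using has_sum_pmf_times[of "\<lambda>j. pmf (K j) i" 1 p] by (simp add: pmf_bind pmf_backward_kernel[symmetric] pmf_le_1)
  have 2: "(pmf p has_sum 1) UNIV"
    using has_sum_pmf_times[of "\<lambda>_. 1" 1 p] by simp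
  show ?thesis
  proof
    assume "is_stationary Q (pmf p)"
    then have "((\<lambda>j. pmf p j * Q j i) has_sum pmf p i) UNIV" for i by (simp add: is_stationary_def)
    with 1 have "pmf (bind_pmf p K) i = pmf p i" for i using has_sum_unique by blast
    then show "bind_pmf p K = p" by (rule pmf_eqI)
  next
    assume "bind_pmf p K = p"
    with 1 2 show "is_stationary Q (pmf p)" by (auto simp: is_stationary_def)
  qed
qed

lemma is_stationary_imp_pmf:
  assumes "is_stationary Q \<pi>"
  obtains p where "\<pi> = pmf p"
proof -
  have nn: "0 \<le> \<pi> i" for i using assms by (simp add: is_stationary_def)
  have s: "(\<pi> has_sum 1) UNIV" using assms by (simp add: is_stationary_def)
  have "(\<lambda>x. norm (\<pi> x)) summable_on UNIV" using s nn by (auto simp: summable_on_def)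
  then have abs: "Infinite_Set_Sum.abs_summable_on \<pi> UNIV" by (rule abs_summable_equivalent[THEN iffD1])
  have "(\<integral>\<^sup>+ x. ennreal (\<pi> x) \<partial>count_space UNIV) = ennreal (infsetsum \<pi> UNIV)"
    by (rule nn_integral_conv_infsetsum[OF abs]) (rule nn)
  also have "infsetsum \<pi> UNIV = 1" using infsetsum_infsum[OF abs] s by (simp add: infsumI)
  finally have "(\<integral>\<^sup>+ x. ennreal (\<pi> x) \<partial>count_space UNIV) = 1" by simp
  then have "\<pi> = pmf (embed_pmf \<pi>)" using nn by (auto simp: pmf_embed_pmf)
  then show thesis by (rule that)
qed

lemma stationary_vector_pmf:
  assumes pos: "positive_recurrent Q"
  obtains p where "stationary_vector Q = pmf p" "bind_pmf p K = p" "\<And>i. 0 < pmf p i"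
proof -
  have K: "irreducible_kernel K" "\<And>a. certain_return K a" "\<And>a. summable (\<lambda>n. survival K a n a)"
    using irreducible_backward_kernel pos by (auto simp: positive_recurrent_iff)
  obtain p where p: "bind_pmf p K = p" using stationary_exists[OF K(3)] by blast
  have "stationary_vector Q = pmf p"
    unfolding stationary_vector_def
  proof (rule the_equality)
    show "is_stationary Q (pmf p)" using p by (simp add: is_stationary_pmf)
    fix \<pi> assume st: "is_stationary Q \<pi>"
    then obtain q where q: "\<pi> = pmf q" by (rule is_stationary_imp_pmf)
    with st have "bind_pmf q K = q" by (simp add: is_stationary_pmf)
    then have "q = p" using stationary_unique[OF K(1,2)] p by blast
    with q show "\<pi> = pmf p" by simp
  qed
  then show thesis using that p stationary_positive[OF K(1,2) p] by blast
qed

end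

section \<open>The shift space and its Borel sets\<close>

lemma cylinder_eq_path_cyl: "cylinder m w = path_cyl w \<inter> shift_space m"
  by (auto simp: cylinder_def path_cyl_def)

lemma sets_singleton_path: "{z} \<in> sets (path_space :: (nat \<Rightarrow> 'i::countable) measure)"
proof -
  have "{s \<in> space path_space. \<forall>n. s n = z n} \<in> sets (path_space :: (nat \<Rightarrow> 'i) measure)"
    by measurable
  moreover have "{s \<in> space path_space. \<forall>n. s n = z n} = {z}" by auto
  ultimately show ?thesis by simp
qed

lemma sets_shift_space [measurable, simp]:
  fixes m :: "'i::countable \<Rightarrow> 'i \<Rightarrow> real"
  shows "shift_space m \<in> sets path_space"
proof -
  have "{s. m (s n) (s (Suc n)) = 1} \<in> sets path_space" for n
  proof -
    have "{s. m (s n) (s (Suc n)) = 1} = (\<Union>a. {s. s n = a} \<inter> {s. s (Suc n) \<in> {b. m a b = 1}})" by auto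
    also have "\<dots> \<in> sets path_space"
      using sets_visit[of n "{a}" for a] by (intro sets.countable_UN' sets.Int) auto
    finally show ?thesis .
  qed
  then have "(\<Inter>n. {s. m (s n) (s (Suc n)) = 1}) \<in> sets path_space" by (intro sets.countable_INT) auto
  moreover have "(\<Inter>n. {s. m (s n) (s (Suc n)) = 1}) = shift_space m" by (auto simp: shift_space_def)
  ultimately show ?thesis by simp
qed

text \<open>Finite intersections of cylinders are again cylinders or empty, so the generated topology is described by
  prefixes.\<close>

lemma generate_cylinders_iff:
  "generate_topology_on {cylinder m w |w. w \<noteq> []} U \<longleftrightarrow>
     U \<subseteq> shift_space m \<and> (\<forall>x\<in>U. \<exists>n. \<forall>y\<in>shift_space m. (\<forall>k<n. y k = x k) \<longrightarrow> y \<in> U)"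
proof
  assume "generate_topology_on {cylinder m w |w. w \<noteq> []} U"
  then show "U \<subseteq> shift_space m \<and> (\<forall>x\<in>U. \<exists>n. \<forall>y\<in>shift_space m. (\<forall>k<n. y k = x k) \<longrightarrow> y \<in> U)"
  proof induction
    case Empty then show ?case by simp
  next
    case (Int a b)
    show ?case
    proof (intro conjI ballI)
      fix x assume "x \<in> a \<inter> b"
      then obtain n n' where
        "\<forall>y\<in>shift_space m. (\<forall>k<n. y k = x k) \<longrightarrow> y \<in> a"
        "\<forall>y\<in>shift_space m. (\<forall>k<n'. y k = x k) \<longrightarrow> y \<in> b"
        using Int.IH by blast
      then show "\<exists>n. \<forall>y\<in>shift_space m. (\<forall>k<n. y k = x k) \<longrightarrow> y \<in> a \<inter> b"
        by (intro exI[of _ "max n n'"]) auto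
    qed (use Int.IH in blast)
  next
    case (UN k)
    show ?case
    proof (intro conjI ballI)
      fix x assume "x \<in> \<Union>k"
      then obtain u where u: "u \<in> k" "x \<in> u" by blast
      then obtain n where "\<forall>y\<in>shift_space m. (\<forall>k<n. y k = x k) \<longrightarrow> y \<in> u" using UN.IH by blast
      then show "\<exists>n. \<forall>y\<in>shift_space m. (\<forall>k<n. y k = x k) \<longrightarrow> y \<in> \<Union>k" using u by blast
    qed (use UN.IH in blast)
  next
    case (Basis s)
    then obtain w where "s = cylinder m w" by blast
    then show ?case by (auto simp: cylinder_def intro!: exI[of _ "length w"])
  qed
next
  assume U: "U \<subseteq> shift_space m \<and> (\<forall>x\<in>U. \<exists>n. \<forall>y\<in>shift_space m. (\<forall>k<n. y k = x k) \<longrightarrow> y \<in> U)"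
  have "U = \<Union>{cylinder m w |w. w \<noteq> [] \<and> cylinder m w \<subseteq> U}"
  proof (intro equalityI subsetI)
    fix x assume x: "x \<in> U"
    then obtain n where n: "\<forall>y\<in>shift_space m. (\<forall>k<n. y k = x k) \<longrightarrow> y \<in> U" using U by blast
    let ?w = "map x [0..<Suc n]"
    have "cylinder m ?w \<subseteq> U"
    proof
      fix y assume "y \<in> cylinder m ?w"
      then have "y \<in> shift_space m" "\<And>k. k < Suc n \<Longrightarrow> y k = x k"
        by (auto simp: cylinder_def simp del: upt_Suc)
      with n show "y \<in> U" by auto
    qed
    moreover have "x \<in> cylinder m ?w" using x U by (auto simp: cylinder_def simp del: upt_Suc)
    moreover have "?w \<noteq> []" by simp
    ultimately show "x \<in> \<Union>{cylinder m w |w. w \<noteq> [] \<and> cylinder m w \<subseteq> U}" by blast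
  qed auto
  moreover have "generate_topology_on {cylinder m w |w. w \<noteq> []} (\<Union>{cylinder m w |w. w \<noteq> [] \<and> cylinder m w \<subseteq> U})"
    by (rule generate_topology_on.UN) (auto intro: generate_topology_on.Basis)
  ultimately show "generate_topology_on {cylinder m w |w. w \<noteq> []} U" by simp
qed

lemma openin_shift_topology:
  "openin (shift_topology m) U \<longleftrightarrow>
     U \<subseteq> shift_space m \<and> (\<forall>x\<in>U. \<exists>n. \<forall>y\<in>shift_space m. (\<forall>k<n. y k = x k) \<longrightarrow> y \<in> U)"
  by (simp add: shift_topology_def openin_topology_generated_by_iff generate_cylinders_iff)

lemma openin_cylinder: "openin (shift_topology m) (cylinder m w)"
  unfolding openin_shift_topology by (auto simp: cylinder_def intro!: exI[of _ "length w"])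

lemma topspace_shift_topology: "topspace (shift_topology m) = shift_space m"
proof
  show "topspace (shift_topology m) \<subseteq> shift_space m"
    using openin_topspace[of "shift_topology m"] by (simp only: openin_shift_topology)
  have "openin (shift_topology m) (shift_space m)" by (simp add: openin_shift_topology)
  then show "shift_space m \<subseteq> topspace (shift_topology m)" by (rule openin_subset)
qed

lemma space_shift_borel [simp]: "space (shift_borel m) = shift_space m"
  unfolding shift_borel_def by (rule space_measure_of) (auto simp: openin_shift_topology)

lemma sets_shift_borel: "sets (shift_borel m) = sigma_sets (shift_space m) {U. openin (shift_topology m) U}"
  unfolding shift_borel_def by (rule sets_measure_of) (auto simp: openin_shift_topology)

lemma sets_shift_borel_subset:
  fixes m :: "'i::countable \<Rightarrow> 'i \<Rightarrow> real"
  assumes "B \<in> sets (shift_borel m)"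
  shows "B \<in> sets path_space" "B \<subseteq> shift_space m"
proof -
  have "B \<in> sigma_sets (shift_space m) {U. openin (shift_topology m) U}"
    using assms by (simp only: sets_shift_borel)
  then show "B \<in> sets path_space"
  proof induction
    case (Basic U)
    then have U: "openin (shift_topology m) U" by simp
    have "U = (\<Union>w\<in>{w. cylinder m w \<subseteq> U}. cylinder m w)"
    proof (intro equalityI subsetI)
      fix x assume x: "x \<in> U"
      then obtain n where n: "\<forall>y\<in>shift_space m. (\<forall>k<n. y k = x k) \<longrightarrow> y \<in> U" "x \<in> shift_space m"
        using U unfolding openin_shift_topology by blast
      then have "cylinder m (map x [0..<n]) \<subseteq> U" "x \<in> cylinder m (map x [0..<n])"
        by (auto simp: cylinder_def)
      then show "x \<in> (\<Union>w\<in>{w. cylinder m w \<subseteq> U}. cylinder m w)" by blast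
    qed auto
    also have "\<dots> \<in> sets path_space"
      by (intro sets.countable_UN' ) (auto simp: cylinder_eq_path_cyl)
    finally show ?case .
  next
    case (Compl a)
    then show ?case by (intro sets.Diff) auto
  qed (auto intro: sets.countable_UN)
  show "B \<subseteq> shift_space m" using sets.sets_into_space[OF assms] by simp
qed

lemma sets_shift_borel_Int:
  fixes m :: "'i::countable \<Rightarrow> 'i \<Rightarrow> real"
  assumes "A \<in> sets path_space"
  shows "A \<inter> shift_space m \<in> sets (shift_borel m)"
proof -
  have cyl: "path_cyl w \<inter> shift_space m \<in> sets (shift_borel m)" for w
    unfolding cylinder_eq_path_cyl[symmetric] sets_shift_borel
    by (intro sigma_sets.Basic) (simp add: openin_cylinder)
  have top: "shift_space m \<in> sets (shift_borel m)" using sets.top[of "shift_borel m"] by simp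
  have "A \<in> sigma_sets UNIV (insert {} (range path_cyl))"
    using assms by (simp only: sets_path_space_eq)
  then show ?thesis
  proof induction
    case (Compl a)
    have "(UNIV - a) \<inter> shift_space m = shift_space m - a \<inter> shift_space m" by blast
    then show ?case using Compl.IH top by auto
  next
    case (Union a)
    have "(\<Union>i. a i) \<inter> shift_space m = (\<Union>i. a i \<inter> shift_space m)" by blast
    also have "\<dots> \<in> sets (shift_borel m)" using Union.IH by (intro sets.countable_UN) auto
    finally show ?case .
  qed (use cyl in auto)
qed

text \<open>Since there are only countably many words, the Borel sets of the shift are the trace of the product sigma-algebra.\<close>

lemma sets_shift_borel_eq:
  fixes m :: "'i::countable \<Rightarrow> 'i \<Rightarrow> real"
  shows "B \<in> sets (shift_borel m) \<longleftrightarrow> B \<in> sets path_space \<and> B \<subseteq> shift_space m"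
  using sets_shift_borel_subset[of B m] sets_shift_borel_Int[of B m] by (auto simp: Int_absorb2)

lemma sets_cylinder [simp]:
  fixes m :: "'i::countable \<Rightarrow> 'i \<Rightarrow> real"
  shows "cylinder m w \<in> sets (shift_borel m)"
  unfolding cylinder_eq_path_cyl by (intro sets_shift_borel_Int) simp

lemma measurable_shift_borel_iff:
  fixes m :: "'i::countable \<Rightarrow> 'i \<Rightarrow> real"
  shows "f \<in> measurable M (shift_borel m) \<longleftrightarrow> f \<in> measurable M path_space \<and> f \<in> space M \<rightarrow> shift_space m"
proof
  assume f: "f \<in> measurable M (shift_borel m)"
  have "(\<lambda>s. s) \<in> measurable (shift_borel m) path_space"
    by (rule measurableI) (auto simp: vimage_def Int_def[symmetric] sets_shift_borel_Int intro: sets_shift_borel_Int)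
  from measurable_comp[OF f this] show "f \<in> measurable M path_space \<and> f \<in> space M \<rightarrow> shift_space m"
    using measurable_space[OF f] by (auto simp: comp_def)
next
  assume f: "f \<in> measurable M path_space \<and> f \<in> space M \<rightarrow> shift_space m"
  show "f \<in> measurable M (shift_borel m)"
  proof (rule measurableI)
    fix A assume "A \<in> sets (shift_borel m)"
    then have "A \<in> sets path_space" by (simp add: sets_shift_borel_eq)
    with f show "f -` A \<inter> space M \<in> sets M" by (blast intro: measurable_sets)
  qed (use f in auto)
qed

section \<open>The law of the random backward trajectory\<close>

lemma (in backward_shift) preimages_eq:
  assumes "x \<in> shift_space m"
  shows "preimages m x = (\<lambda>i. case_nat i x) ` predecessors m (x 0)"
proof (intro equalityI subsetI)
  fix z assume z: "z \<in> preimages m x"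
  then have "z \<in> shift_space m" "left_shift z = x" by (auto simp: preimages_def)
  then have "z 0 \<in> predecessors m (x 0)" "z = case_nat (z 0) x"
    by (auto simp: shift_space_def left_shift_def predecessors_def split: nat.split)
  then show "z \<in> (\<lambda>i. case_nat i x) ` predecessors m (x 0)" by blast
next
  fix z assume "z \<in> (\<lambda>i. case_nat i x) ` predecessors m (x 0)"
  then obtain i where "z = case_nat i x" "m i (x 0) = 1" by (auto simp: predecessors_def)
  then show "z \<in> preimages m x"
    using assms by (auto simp: preimages_def shift_space_def left_shift_def split: nat.split)
qed

locale backward_trajectory = backward_shift m
  for m :: "'i::countable \<Rightarrow> 'i \<Rightarrow> real" +
  fixes y0 :: "nat \<Rightarrow> 'i" and \<Omega> :: "'w measure" and Y :: "nat \<Rightarrow> 'w \<Rightarrow> (nat \<Rightarrow> 'i)"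
  assumes y0: "y0 \<in> shift_space m"
    and trajectory: "random_backward_trajectory m y0 \<Omega> Y"
begin

sublocale prob_space \<Omega>
  using trajectory by (simp add: random_backward_trajectory_def)

lemma Y_measurable [measurable]: "Y n \<in> measurable \<Omega> path_space"
  and Y_in_shift_space: "\<omega> \<in> space \<Omega> \<Longrightarrow> Y n \<omega> \<in> shift_space m"
  using trajectory by (auto simp: random_backward_trajectory_def measurable_shift_borel_iff)

lemma Y_event [measurable]: "{\<omega> \<in> space \<Omega>. Y n \<omega> = z} \<in> sets \<Omega>"
  using measurable_sets[OF Y_measurable sets_singleton_path, of n z] by (simp add: vimage_def Int_def conj_commute)

lemma Y_events [measurable]: "{\<omega> \<in> space \<Omega>. \<forall>k\<le>n. Y k \<omega> = y k} \<in> sets \<Omega>"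
  by measurable

lemma preimages_finite: "x \<in> shift_space m \<Longrightarrow> finite (preimages m x)"
  by (simp add: preimages_eq finite_predecessors)

lemma card_preimages: "x \<in> shift_space m \<Longrightarrow> card (preimages m x) = card (predecessors m (x 0))"
  unfolding preimages_eq by (rule card_image) (auto intro!: inj_onI dest: fun_cong[of _ _ 0])

lemma card_preimages_pos: "x \<in> shift_space m \<Longrightarrow> 0 < card (preimages m x)"
  by (simp add: card_preimages card_gt_0_iff finite_predecessors predecessors_nonempty)

text \<open>The conditional probabilities in \<^const>\<open>random_backward_trajectory\<close> are only prescribed under conditions of positive
  probability; for null conditions both sides vanish.\<close>

lemma step_probability:
  assumes "x \<in> shift_space m" "z \<in> preimages m x"
  shows "prob {\<omega> \<in> space \<Omega>. Y (Suc n) \<omega> = z \<and> Y n \<omega> = x}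
       = prob {\<omega> \<in> space \<Omega>. Y n \<omega> = x} / real (card (preimages m x))"
proof (cases "prob {\<omega> \<in> space \<Omega>. Y n \<omega> = x} = 0")
  case True
  have "prob {\<omega> \<in> space \<Omega>. Y (Suc n) \<omega> = z \<and> Y n \<omega> = x} \<le> prob {\<omega> \<in> space \<Omega>. Y n \<omega> = x}"
    by (rule finite_measure_mono) auto
  with True show ?thesis by (simp add: measure_le_0_iff)
next
  case False
  then have pos: "0 < prob {\<omega> \<in> space \<Omega>. Y n \<omega> = x}" by (simp add: zero_less_measure_iff)
  then have "\<P>(\<omega> in \<Omega>. Y (Suc n) \<omega> = z \<bar> Y n \<omega> = x) = 1 / real (card (preimages m x))"
    using trajectory assms(2) by (auto simp: random_backward_trajectory_def)
  with pos show ?thesis by (simp add: cond_prob_def field_simps)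
qed

text \<open>The prescribed probabilities of the finitely many preimages add up to one, so nothing else happens.\<close>

lemma AE_step_at:
  assumes x: "x \<in> shift_space m"
  shows "AE \<omega> in \<Omega>. Y n \<omega> = x \<longrightarrow> Y (Suc n) \<omega> \<in> preimages m x"
proof -
  let ?A = "{\<omega> \<in> space \<Omega>. Y n \<omega> = x}"
  let ?B = "\<lambda>z. {\<omega> \<in> space \<Omega>. Y (Suc n) \<omega> = z \<and> Y n \<omega> = x}"
  have mB [measurable]: "?B z \<in> sets \<Omega>" for z
  proof -
    have "{\<omega> \<in> space \<Omega>. Y (Suc n) \<omega> = z} \<inter> ?A \<in> sets \<Omega>" by (intro sets.Int Y_event)
    also have "{\<omega> \<in> space \<Omega>. Y (Suc n) \<omega> = z} \<inter> ?A = ?B z" by auto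
    finally show ?thesis .
  qed
  have "prob (\<Union>z\<in>preimages m x. ?B z) = (\<Sum>z\<in>preimages m x. prob (?B z))"
    by (rule finite_measure_finite_Union) (use x mB in \<open>auto simp: preimages_finite disjoint_family_on_def\<close>)
  also have "\<dots> = (\<Sum>z\<in>preimages m x. prob ?A / real (card (preimages m x)))"
    by (rule sum.cong[OF refl]) (rule step_probability[OF x])
  also have "\<dots> = prob ?A" using card_preimages_pos[OF x] by simp
  finally have eq: "prob (\<Union>z\<in>preimages m x. ?B z) = prob ?A" .
  have mU: "(\<Union>z\<in>preimages m x. ?B z) \<in> sets \<Omega>"
    by (intro sets.finite_UN preimages_finite x mB)
  have "prob (?A - (\<Union>z\<in>preimages m x. ?B z)) = prob ?A - prob (\<Union>z\<in>preimages m x. ?B z)"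
    by (rule finite_measure_Diff) (use mU in auto)
  then have "prob (?A - (\<Union>z\<in>preimages m x. ?B z)) = 0" by (simp add: eq)
  then have "AE \<omega> in \<Omega>. \<omega> \<notin> ?A - (\<Union>z\<in>preimages m x. ?B z)"
    by (subst prob_eq_0[symmetric]) (use mU in auto)
  then show ?thesis using AE_space by eventually_elim auto
qed

text \<open>A finite set that carries \<open>Y n\<close>; finiteness lets the statements about single points \<open>x\<close> be combined.\<close>

primrec backward_set :: "nat \<Rightarrow> (nat \<Rightarrow> 'i) set" where
  "backward_set 0 = {y0}"
| "backward_set (Suc n) = (\<Union>x\<in>backward_set n. preimages m x)"

lemma backward_set: "finite (backward_set n) \<and> backward_set n \<subseteq> shift_space m"
proof (induction n)
  case (Suc n)
  moreover have "preimages m x \<subseteq> shift_space m" for x by (auto simp: preimages_def)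
  ultimately show ?case by (auto intro!: preimages_finite)
qed (simp add: y0)

lemma AE_Y_0: "AE \<omega> in \<Omega>. Y 0 \<omega> = y0"
proof -
  have "prob {\<omega> \<in> space \<Omega>. Y 0 \<omega> = y0} = 1"
    using trajectory by (simp add: random_backward_trajectory_def)
  then have "AE \<omega> in \<Omega>. \<omega> \<in> {\<omega> \<in> space \<Omega>. Y 0 \<omega> = y0}"
    by (subst prob_eq_1[symmetric]) auto
  then show ?thesis by eventually_elim simp
qed

lemma AE_backward:
  "(AE \<omega> in \<Omega>. Y n \<omega> \<in> backward_set n) \<and> (AE \<omega> in \<Omega>. left_shift (Y (Suc n) \<omega>) = Y n \<omega>)"
proof -
  have step: "AE \<omega> in \<Omega>. \<forall>x\<in>backward_set n. Y n \<omega> = x \<longrightarrow> Y (Suc n) \<omega> \<in> preimages m x" for n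
    using backward_set[of n] by (intro AE_finite_allI AE_step_at) auto
  have mem: "AE \<omega> in \<Omega>. Y n \<omega> \<in> backward_set n" for n
  proof (induction n)
    case 0 show ?case using AE_Y_0 by simp
  next
    case (Suc n)
    with step[of n] show ?case by eventually_elim auto
  qed
  have "AE \<omega> in \<Omega>. left_shift (Y (Suc n) \<omega>) = Y n \<omega>"
    using step[of n] mem[of n] by eventually_elim (auto simp: preimages_def)
  with mem show ?thesis by blast
qed

text \<open>The point reached after \<open>n\<close> backward steps that prepend \<open>x 1, \<dots>, x n\<close> to \<open>y0\<close>. The letter \<open>x 0\<close> overwrites the
  first letter of \<open>y0\<close>, so for \<open>x 0 \<noteq> y0 0\<close> no trajectory reaches these points.\<close>

definition glue :: "(nat \<Rightarrow> 'i) \<Rightarrow> nat \<Rightarrow> nat \<Rightarrow> 'i" where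
  "glue x n = (\<lambda>k. if k \<le> n then x (n - k) else y0 (k - n))"

lemma left_shift_glue: "left_shift (glue x (Suc n)) = glue x n"
  by (auto simp: glue_def left_shift_def)

lemma AE_Y_eq_glue: "AE \<omega> in \<Omega>. \<forall>n. Y n \<omega> = glue (\<lambda>k. Y k \<omega> 0) n"
proof -
  have "AE \<omega> in \<Omega>. \<forall>n. left_shift (Y (Suc n) \<omega>) = Y n \<omega>"
    using AE_backward by (simp add: AE_all_countable)
  then show ?thesis using AE_Y_0
  proof eventually_elim
    case (elim \<omega>)
    show ?case
    proof
      fix n
      show "Y n \<omega> = glue (\<lambda>k. Y k \<omega> 0) n"
      proof (induction n)
        case 0 show ?case using elim(2) by (auto simp: glue_def fun_eq_iff)
      next
        case (Suc n)
        show ?case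
        proof
          fix k
          show "Y (Suc n) \<omega> k = glue (\<lambda>k. Y k \<omega> 0) (Suc n) k"
          proof (cases k)
            case (Suc k')
            have "Y (Suc n) \<omega> k = left_shift (Y (Suc n) \<omega>) k'" by (simp add: Suc left_shift_def)
            also have "\<dots> = left_shift (glue (\<lambda>k. Y k \<omega> 0) (Suc n)) k'"
              using elim(1) Suc.IH by (simp add: left_shift_glue)
            finally show ?thesis by (simp add: Suc left_shift_def)
          qed (simp add: glue_def)
        qed
      qed
    qed
  qed
qed

text \<open>If \<open>x (Suc n)\<close> is not a predecessor of \<open>x n\<close>, both sides vanish, because the glued sequence is not admissible and the
  trajectory stays in the shift space.\<close>

lemma prob_states:
  "prob {\<omega> \<in> space \<Omega>. \<forall>k\<le>n. Y k \<omega> = glue x k}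
     = (if x 0 = y0 0 then \<Prod>k<n. pmf (K (x k)) (x (Suc k)) else 0)"
proof (induction n)
  case 0
  show ?case
  proof (cases "x 0 = y0 0")
    case True
    then have "glue x 0 = y0" by (auto simp: glue_def)
    then show ?thesis using trajectory True by (simp add: random_backward_trajectory_def)
  next
    case False
    then have "glue x 0 \<noteq> y0" by (auto simp: glue_def dest: fun_cong[of _ _ 0])
    then have "AE \<omega> in \<Omega>. \<omega> \<notin> {\<omega> \<in> space \<Omega>. \<forall>k\<le>0. Y k \<omega> = glue x k}"
      using AE_Y_0 by (auto elim!: eventually_mono)
    then have "prob {\<omega> \<in> space \<Omega>. \<forall>k\<le>0. Y k \<omega> = glue x k} = 0"
      by (subst prob_eq_0) (rule Y_events)
    then show ?thesis using False by simp
  qed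
next
  case (Suc n)
  let ?E = "\<lambda>n. {\<omega> \<in> space \<Omega>. \<forall>k\<le>n. Y k \<omega> = glue x k}"
  have ESuc: "?E (Suc n) = {\<omega> \<in> space \<Omega>. Y (Suc n) \<omega> = glue x (Suc n) \<and> (\<forall>k\<le>n. Y k \<omega> = glue x k)}"
    by (auto simp: le_Suc_eq)
  show ?case
  proof (cases "prob (?E n) = 0")
    case True
    have "prob (?E (Suc n)) \<le> prob (?E n)" by (rule finite_measure_mono) auto
    then show ?thesis using True Suc by (auto simp: measure_le_0_iff)
  next
    case False
    then have pos: "0 < prob (?E n)" by (simp add: zero_less_measure_iff)
    then have "?E n \<noteq> {}" by (metis less_irrefl measure_empty)
    then obtain \<omega> where "\<omega> \<in> ?E n" by blast
    then have sh: "glue x n \<in> shift_space m" using Y_in_shift_space[of \<omega> n] by simp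
    have "prob (?E n) \<le> prob {\<omega> \<in> space \<Omega>. Y n \<omega> = glue x n}"
      by (rule finite_measure_mono) auto
    then have pos': "0 < prob {\<omega> \<in> space \<Omega>. Y n \<omega> = glue x n}" using pos by linarith
    have start: "x 0 = y0 0" using False Suc by (auto split: if_splits)
    have "prob (?E (Suc n)) = pmf (K (x n)) (x (Suc n)) * prob (?E n)"
    proof (cases "m (x (Suc n)) (x n) = 1")
      case True
      have g0: "glue x n 0 = x n" by (simp add: glue_def)
      have "glue x (Suc n) = case_nat (x (Suc n)) (glue x n)"
        by (auto simp: glue_def fun_eq_iff split: nat.split)
      then have pre: "glue x (Suc n) \<in> preimages m (glue x n)"
        unfolding preimages_eq[OF sh] using True g0 by (auto simp: predecessors_def)
      have "\<P>(\<omega> in \<Omega>. Y (Suc n) \<omega> = glue x (Suc n) \<bar> \<forall>k\<le>n. Y k \<omega> = glue x k)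
          = \<P>(\<omega> in \<Omega>. Y (Suc n) \<omega> = glue x (Suc n) \<bar> Y n \<omega> = glue x n)"
        using trajectory pos unfolding random_backward_trajectory_def by blast
      also have "\<dots> = 1 / real (card (preimages m (glue x n)))"
        using trajectory pos' pre unfolding random_backward_trajectory_def by blast
      also have "\<dots> = pmf (K (x n)) (x (Suc n))"
        using True by (simp add: card_preimages[OF sh] g0 pmf_backward_kernel backward_matrix_def column_sum_eq)
      finally show ?thesis using pos unfolding ESuc cond_prob_def by (simp add: field_simps)
    next
      case False
      have "glue x (Suc n) \<notin> shift_space m"
      proof
        assume "glue x (Suc n) \<in> shift_space m"
        then have "m (glue x (Suc n) 0) (glue x (Suc n) (Suc 0)) = 1" unfolding shift_space_def by blast
        with False show False by (simp add: glue_def)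
      qed
      then have "Y (Suc n) \<omega> \<noteq> glue x (Suc n)" if "\<omega> \<in> space \<Omega>" for \<omega>
        using Y_in_shift_space[OF that, of "Suc n"] by auto
      then have "?E (Suc n) = {}" unfolding ESuc by blast
      moreover have "pmf (K (x n)) (x (Suc n)) = 0"
        using False entry_cases[of "x (Suc n)" "x n"] by (auto simp: pmf_backward_kernel backward_matrix_def)
      ultimately show ?thesis by (simp only: measure_empty mult_zero_left)
    qed
    then show ?thesis using Suc start by simp
  qed
qed

text \<open>A trajectory and the sequence of its first letters determine each other, so the law of the letters is given by
  \<open>prob_states\<close> and path measures are determined by words.\<close>

theorem law_of_states:
  "distr \<Omega> path_space (\<lambda>\<omega> n. Y n \<omega> 0) = chain K (y0 0)"
proof (rule path_measure_eqI)
  have X [measurable]: "(\<lambda>\<omega> n. Y n \<omega> 0) \<in> measurable \<Omega> path_space"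
    by (rule measurable_PiM_single') (auto intro: measurable_compose[OF Y_measurable measurable_coordinate])
  show "finite_measure (distr \<Omega> path_space (\<lambda>\<omega> n. Y n \<omega> 0))"
    by (intro prob_space.finite_measure prob_space_distr X)
  show "finite_measure (chain K (y0 0))" by (intro prob_space.finite_measure prob_space_chain)
  fix z :: 'i and w
  let ?x = "\<lambda>k. (z # w) ! k"
  have "measure (distr \<Omega> path_space (\<lambda>\<omega> n. Y n \<omega> 0)) (path_cyl (z # w))
      = prob {\<omega> \<in> space \<Omega>. (\<lambda>n. Y n \<omega> 0) \<in> path_cyl (z # w)}"
    by (subst measure_distr) (auto simp: vimage_def Int_def conj_commute)
  also have "\<dots> = prob {\<omega> \<in> space \<Omega>. \<forall>k\<le>length w. Y k \<omega> = glue ?x k}"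
  proof (rule finite_measure_eq_AE)
    show "AE \<omega> in \<Omega>. \<omega> \<in> {\<omega> \<in> space \<Omega>. (\<lambda>n. Y n \<omega> 0) \<in> path_cyl (z # w)} \<longleftrightarrow>
        \<omega> \<in> {\<omega> \<in> space \<Omega>. \<forall>k\<le>length w. Y k \<omega> = glue ?x k}"
      using AE_Y_eq_glue
    proof eventually_elim
      case (elim \<omega>)
      have "(\<lambda>n. Y n \<omega> 0) \<in> path_cyl (z # w) \<longleftrightarrow> (\<forall>k\<le>length w. Y k \<omega> 0 = ?x k)"
        by (simp add: path_cyl_def less_Suc_eq_le)
      also have "\<dots> \<longleftrightarrow> (\<forall>k\<le>length w. Y k \<omega> = glue ?x k)"
      proof
        assume *: "\<forall>k\<le>length w. Y k \<omega> 0 = ?x k"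
        show "\<forall>k\<le>length w. Y k \<omega> = glue ?x k"
        proof (intro allI impI)
          fix k assume "k \<le> length w"
          then have "glue (\<lambda>k. Y k \<omega> 0) k = glue ?x k" using * by (auto simp: glue_def)
          then show "Y k \<omega> = glue ?x k" using elim by metis
        qed
      next
        assume "\<forall>k\<le>length w. Y k \<omega> = glue ?x k"
        then show "\<forall>k\<le>length w. Y k \<omega> 0 = ?x k" by (simp add: glue_def)
      qed
      finally show ?case by simp
    qed
    show "{\<omega> \<in> space \<Omega>. (\<lambda>n. Y n \<omega> 0) \<in> path_cyl (z # w)} \<in> sets \<Omega>"
      using measurable_sets[OF X sets_path_cyl, of "z # w"] by (simp add: vimage_def Int_def conj_commute)
  qed (rule Y_events)
  also have "\<dots> = measure (chain K (y0 0)) (path_cyl (z # w))"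
    unfolding prob_states measure_chain_path_cyl by (simp add: word_prob_def)
  finally show "measure (distr \<Omega> path_space (\<lambda>\<omega> n. Y n \<omega> 0)) (path_cyl (z # w)) = measure (chain K (y0 0)) (path_cyl (z # w))" .
qed auto

lemma AE_states:
  assumes "AE s in chain K (y0 0). P s"
  shows "AE \<omega> in \<Omega>. P (\<lambda>n. Y n \<omega> 0)"
proof -
  have X: "(\<lambda>\<omega> n. Y n \<omega> 0) \<in> measurable \<Omega> path_space"
    by (rule measurable_PiM_single') (auto intro: measurable_compose[OF Y_measurable measurable_coordinate])
  show ?thesis by (rule AE_distrD[OF X]) (simp only: law_of_states assms)
qed

end

section \<open>The Markov measure\<close>

text \<open>Events that fix the first letter pick out a single starting state.\<close>

lemma measure_start_bind_chain:
  fixes K :: "'i::countable \<Rightarrow> 'i pmf"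
  assumes A: "A \<in> sets path_space" "\<And>s. s \<in> A \<Longrightarrow> s 0 = i"
  shows "measure (measure_pmf p \<bind> chain K) A = pmf p i * measure (chain K i) A"
proof -
  have 0: "measure (chain K x) A = 0" if "x \<noteq> i" for x
  proof -
    have "AE s in chain K x. s \<notin> A"
      using chain_start[where K=K and x=x] by eventually_elim (use A(2) that in auto)
    then show ?thesis by (subst prob_space.prob_eq_0[OF prob_space_chain]) (use A in auto)
  qed
  have "measure (measure_pmf p \<bind> chain K) A = (\<integral>x. measure (chain K x) A \<partial>measure_pmf p)"
    by (rule measure_pmf_bind_kernel[OF prob_space_chain _ A(1)]) simp
  also have "\<dots> = (\<integral>x. (if x = i then measure (chain K i) A else 0) \<partial>measure_pmf p)"
    by (intro Bochner_Integration.integral_cong) (auto simp: 0)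
  also have "\<dots> = pmf p i * measure (chain K i) A" by (rule integral_pmf_delta)
  finally show ?thesis .
qed

lemma measure_bind_chain_path_cyl:
  fixes K :: "'i::countable \<Rightarrow> 'i pmf"
  shows "measure (measure_pmf p \<bind> chain K) (path_cyl (x # w)) = pmf p x * word_prob K (x # w)"
proof -
  have "measure (measure_pmf p \<bind> chain K) (path_cyl (x # w)) = pmf p x * measure (chain K x) (path_cyl (x # w))"
    by (rule measure_start_bind_chain) (rule sets_path_cyl, auto simp: path_cyl_def)
  then show ?thesis by (simp add: measure_chain_path_cyl)
qed

lemma chain_follows_kernel:
  fixes K :: "'i::countable \<Rightarrow> 'i pmf"
  shows "AE s in chain K x. \<forall>n. s (Suc n) \<in> set_pmf (K (s n))"
proof -
  have A: "{s. s (Suc n) \<in> set_pmf (K (s n))} \<in> sets path_space" for n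
  proof -
    have "{s. s (Suc n) \<in> set_pmf (K (s n))} = (\<Union>a. {s. s n \<in> {a}} \<inter> {s. s (Suc n) \<in> set_pmf (K a)})" by auto
    also have "\<dots> \<in> sets path_space"
      by (intro sets.countable_UN' sets.Int sets_visit) auto
    finally show ?thesis .
  qed
  have 1: "measure (chain K x) {s. s (Suc n) \<in> set_pmf (K (s n))} = 1" for n x
  proof (induction n arbitrary: x)
    case 0
    have "measure (chain K y) {s. s 0 \<in> set_pmf (K x)} = 1" if "y \<in> set_pmf (K x)" for y
      using chain_start[where K=K and x=y]
      by (subst prob_space.prob_eq_1[OF prob_space_chain]) (use that in \<open>auto elim!: eventually_mono\<close>)
    then have "(\<integral>y. measure (chain K y) {s. s 0 \<in> set_pmf (K x)} \<partial>measure_pmf (K x)) = (\<integral>y. 1 \<partial>measure_pmf (K x))"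
      by (intro integral_cong_AE) (auto simp: AE_measure_pmf_iff)
    then show ?case by (subst measure_chain_first_step[OF A]) simp
  next
    case (Suc n)
    show ?case by (subst measure_chain_first_step[OF A]) (simp add: Suc)
  qed
  have "AE s in chain K x. s \<in> {s. s (Suc n) \<in> set_pmf (K (s n))}" for n
    using 1[of x n] by (subst prob_space.prob_eq_1[OF prob_space_chain, symmetric]) (use A in auto)
  then show ?thesis by (simp add: AE_all_countable)
qed

lemma word_prob_snoc:
  "w \<noteq> [] \<Longrightarrow> word_prob K (w @ [x]) = word_prob K w * pmf (K (last w)) x"
proof (induction w)
  case (Cons y w)
  then show ?case by (cases w) auto
qed simp

context backward_shift
begin

context
  fixes p :: "'i pmf"
  assumes stationary: "bind_pmf p K = p" and positive: "\<And>i. 0 < pmf p i"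
begin

text \<open>The rows of \<^const>\<open>reversed_matrix\<close> are probability vectors precisely because \<open>p\<close> is stationary for \<open>K\<close>.\<close>

definition reversed_kernel :: "'i \<Rightarrow> 'i pmf" where
  "reversed_kernel i = embed_pmf (reversed_matrix Q (pmf p) i)"

lemma pmf_reversed_kernel: "pmf (reversed_kernel i) j = pmf p j * pmf (K j) i / pmf p i"
proof -
  have nn: "0 \<le> pmf p j * pmf (K j) i / pmf p i" for j by simp
  have eq: "reversed_matrix Q (pmf p) i = (\<lambda>j. pmf p j * pmf (K j) i / pmf p i)"
    by (simp add: reversed_matrix_def pmf_backward_kernel fun_eq_iff)
  have "(\<integral>\<^sup>+ j. ennreal (pmf p j * pmf (K j) i / pmf p i) \<partial>count_space UNIV)
      = (\<integral>\<^sup>+ j. ennreal (pmf p j) * ennreal (pmf (K j) i) / ennreal (pmf p i) \<partial>count_space UNIV)"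
    using positive[of i] by (intro nn_integral_cong) (simp add: divide_ennreal ennreal_mult[symmetric])
  also have "\<dots> = (\<integral>\<^sup>+ j. ennreal (pmf p j) * ennreal (pmf (K j) i) \<partial>count_space UNIV) / ennreal (pmf p i)"
    by (rule nn_integral_divide) simp
  also have "(\<integral>\<^sup>+ j. ennreal (pmf p j) * ennreal (pmf (K j) i) \<partial>count_space UNIV) = ennreal (pmf (bind_pmf p K) i)"
    by (simp add: ennreal_pmf_bind nn_integral_measure_pmf)
  also have "\<dots> / ennreal (pmf p i) = 1"
    using positive[of i] by (simp add: stationary divide_ennreal)
  finally show ?thesis unfolding reversed_kernel_def eq by (subst pmf_embed_pmf) (use nn in auto)
qed

lemma reversed_kernel_stationary: "bind_pmf p reversed_kernel = p"
proof (rule pmf_eqI)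
  fix j
  have "ennreal (pmf (bind_pmf p reversed_kernel) j)
      = (\<integral>\<^sup>+ i. ennreal (pmf p i) * ennreal (pmf (reversed_kernel i) j) \<partial>count_space UNIV)"
    by (simp add: ennreal_pmf_bind nn_integral_measure_pmf)
  also have "\<dots> = (\<integral>\<^sup>+ i. ennreal (pmf p j) * ennreal (pmf (K j) i) \<partial>count_space UNIV)"
  proof (rule nn_integral_cong)
    fix i
    have "pmf p i * pmf (reversed_kernel i) j = pmf p j * pmf (K j) i"
      using positive[of i] by (simp add: pmf_reversed_kernel)
    then show "ennreal (pmf p i) * ennreal (pmf (reversed_kernel i) j) = ennreal (pmf p j) * ennreal (pmf (K j) i)"
      by (simp add: ennreal_mult[symmetric])
  qed
  also have "\<dots> = ennreal (pmf p j)"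
    by (simp add: nn_integral_cmult nn_integral_pmf measure_pmf.emeasure_space_1[simplified])
  finally show "pmf (bind_pmf p reversed_kernel) j = pmf p j" by simp
qed

abbreviation "reversed_law \<equiv> measure_pmf p \<bind> chain reversed_kernel"

lemma prob_space_reversed_law: "prob_space reversed_law"
  and sets_reversed_law: "sets reversed_law = sets path_space"
  by (rule started_chain)+

lemma space_reversed_law: "space reversed_law = UNIV"
  using sets_eq_imp_space_eq[OF sets_reversed_law] by simp

lemma AE_reversed_law_shift_space: "AE s in reversed_law. s \<in> shift_space m"
proof -
  have *: "m i j = 1" if "j \<in> set_pmf (reversed_kernel i)" for i j
  proof -
    have "pmf (K j) i \<noteq> 0" using that by (auto simp: set_pmf_iff pmf_reversed_kernel)
    then show ?thesis using entry_cases[of i j] by (auto simp: pmf_backward_kernel backward_matrix_def)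
  qed
  have "AE s in chain reversed_kernel x. s \<in> shift_space m" for x
    using chain_follows_kernel[of reversed_kernel x]
    by eventually_elim (auto simp: shift_space_def intro: *)
  then show ?thesis by (subst AE_bind[OF chain_measurable]) auto
qed

text \<open>The stationary chain of the reversed kernel lives on all sequences; almost every path is admissible, so restricting it
  to the shift space keeps the total mass.\<close>

definition stationary_markov :: "(nat \<Rightarrow> 'i) measure" where
  "stationary_markov = restrict_space reversed_law (shift_space m)"

lemma sets_stationary_markov: "sets stationary_markov = sets (shift_borel m)"
proof -
  have "sets stationary_markov = (\<inter>) (shift_space m) ` sets path_space"
    unfolding stationary_markov_def by (simp add: sets_restrict_space sets_reversed_law)
  also have "\<dots> = sets (shift_borel m)"
    using sets_shift_borel_Int[of _ m] sets_shift_borel_eq[of _ m]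
    by (auto simp: Int_commute image_iff)
  finally show ?thesis .
qed

lemma measure_stationary_markov:
  "B \<in> sets (shift_borel m) \<Longrightarrow> measure stationary_markov B = measure reversed_law B"
  unfolding stationary_markov_def
  by (rule measure_restrict_space) (auto simp: space_reversed_law sets_reversed_law sets_shift_borel_eq)

lemma measure_reversed_law_Int_shift_space:
  "A \<in> sets path_space \<Longrightarrow> measure reversed_law (A \<inter> shift_space m) = measure reversed_law A"
  using AE_reversed_law_shift_space
  by (intro finite_measure.finite_measure_eq_AE prob_space.finite_measure prob_space_reversed_law)
     (auto simp: sets_reversed_law elim!: eventually_mono)

lemma prob_space_stationary_markov: "prob_space stationary_markov"
proof -
  have "emeasure reversed_law (shift_space m) = 1"
    using AE_reversed_law_shift_space
    by (intro prob_space.emeasure_eq_1_AE[OF prob_space_reversed_law]) (auto simp: sets_reversed_law)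
  then show ?thesis unfolding stationary_markov_def
    by (intro prob_space_restrict_space) (auto simp: sets_reversed_law)
qed

lemma invariant_stationary_markov: "invariant_borel_prob m stationary_markov"
  unfolding invariant_borel_prob_def
proof (intro conjI ballI sets_stationary_markov prob_space_stationary_markov)
  fix B assume "B \<in> sets stationary_markov"
  then have B: "B \<in> sets (shift_borel m)" by (simp only: sets_stationary_markov)
  then have Bp: "B \<in> sets path_space" by (simp add: sets_shift_borel_eq)
  have pre: "left_shift -` B \<in> sets path_space"
    using measurable_sets[OF measurable_left_shift Bp] by simp
  have "measure stationary_markov (left_shift -` B \<inter> shift_space m) = measure reversed_law (left_shift -` B)"
    by (simp add: measure_stationary_markov sets_shift_borel_Int[OF pre] measure_reversed_law_Int_shift_space[OF pre])
  also have "\<dots> = measure (distr reversed_law path_space left_shift) B"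
    by (subst measure_distr) (use Bp in \<open>auto simp: space_reversed_law cong: measurable_cong_sets[OF sets_reversed_law refl]\<close>)
  also have "\<dots> = measure stationary_markov B"
    by (simp add: left_shift_stationary[OF reversed_kernel_stationary] measure_stationary_markov[OF B])
  finally show "measure stationary_markov (left_shift -` B \<inter> shift_space m) = measure stationary_markov B" .
qed

lemma measure_stationary_markov_cylinder:
  "measure stationary_markov (cylinder m (x # w)) = pmf p x * word_prob reversed_kernel (x # w)"
proof -
  have "measure stationary_markov (cylinder m (x # w)) = measure reversed_law (path_cyl (x # w) \<inter> shift_space m)"
    by (simp add: measure_stationary_markov cylinder_eq_path_cyl[symmetric])
  also have "\<dots> = measure reversed_law (path_cyl (x # w))"
    by (rule measure_reversed_law_Int_shift_space) simp
  finally show ?thesis by (simp only: measure_bind_chain_path_cyl)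
qed

lemma is_markov_stationary_markov:
  "is_markov_measure m (pmf p) (reversed_matrix Q (pmf p)) stationary_markov"
  unfolding is_markov_measure_def
proof (intro conjI allI impI invariant_stationary_markov)
  fix w :: "'i list" assume "w \<noteq> []"
  then obtain x v where w: "w = x # v" by (cases w) auto
  have "pmf (reversed_kernel i) j = reversed_matrix Q (pmf p) i j" for i j
    by (simp add: pmf_reversed_kernel reversed_matrix_def pmf_backward_kernel)
  then show "measure stationary_markov (cylinder m w) = pmf p (w ! 0) *
     (\<Prod>k<length w - 1. reversed_matrix Q (pmf p) (w ! k) (w ! Suc k))"
    unfolding w measure_stationary_markov_cylinder by (simp add: word_prob_def)
qed

text \<open>A measure on the shift is carried to the path space, where word events determine it.\<close>

lemma markov_measure_unique:
  assumes \<nu>: "is_markov_measure m (pmf p) (reversed_matrix Q (pmf p)) \<nu>"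
  shows "\<nu> = stationary_markov"
proof -
  have s\<nu>: "sets \<nu> = sets (shift_borel m)" and p\<nu>: "prob_space \<nu>"
    using \<nu> by (auto simp: is_markov_measure_def invariant_borel_prob_def)
  have id: "(\<lambda>s. s) \<in> measurable M path_space" if "sets M = sets (shift_borel m)" for M
    using measurable_ident_sets[OF that] unfolding measurable_shift_borel_iff by simp
  have eval: "measure (distr M path_space (\<lambda>s. s)) B = measure M (B \<inter> shift_space m)"
    if "sets M = sets (shift_borel m)" "B \<in> sets path_space" for M B
    using sets_eq_imp_space_eq[OF that(1)] by (subst measure_distr[OF id[OF that(1)] that(2)]) simp
  have "distr \<nu> path_space (\<lambda>s. s) = distr stationary_markov path_space (\<lambda>s. s)"
  proof (rule path_measure_eqI)
    show "finite_measure (distr \<nu> path_space (\<lambda>s. s))"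
      "finite_measure (distr stationary_markov path_space (\<lambda>s. s))"
      by (auto intro!: prob_space.finite_measure prob_space.prob_space_distr id
          p\<nu> prob_space_stationary_markov s\<nu> sets_stationary_markov)
    fix x :: 'i and w
    show "measure (distr \<nu> path_space (\<lambda>s. s)) (path_cyl (x # w))
        = measure (distr stationary_markov path_space (\<lambda>s. s)) (path_cyl (x # w))"
      using \<nu> is_markov_stationary_markov
      by (simp add: eval s\<nu> sets_stationary_markov cylinder_eq_path_cyl[symmetric] is_markov_measure_def)
  qed auto
  note eq = this
  show ?thesis
  proof (rule measure_eqI)
    show "sets \<nu> = sets stationary_markov" by (simp only: s\<nu> sets_stationary_markov)
    fix B assume "B \<in> sets \<nu>"
    then have B: "B \<in> sets path_space" "B \<subseteq> shift_space m" by (auto simp: s\<nu> sets_shift_borel_eq)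
    then have "measure \<nu> B = measure stationary_markov B"
      using eval[OF s\<nu> B(1)] eval[OF sets_stationary_markov B(1)] eq by (simp add: Int_absorb2)
    then show "emeasure \<nu> B = emeasure stationary_markov B"
      by (simp add: finite_measure.emeasure_eq_measure prob_space.finite_measure p\<nu> prob_space_stationary_markov)
  qed
qed

lemma markov_measure_eq: "markov_measure m (pmf p) (reversed_matrix Q (pmf p)) = stationary_markov"
  unfolding markov_measure_def
  by (rule the_equality) (auto intro: is_markov_stationary_markov markov_measure_unique)

text \<open>Conditioning on the first step gives \<open>\<mu>([i] \<inter> \<sigma>\<^sup>-\<^sup>1 B) = p\<^sub>i p\<^sub>i\<^sub>j P\<^sub>j(B)\<close>, and \<open>p\<^sub>i p\<^sub>i\<^sub>j = p\<^sub>j q\<^sub>j\<^sub>i\<close> is the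
  defining property of the reversal.\<close>

lemma fair_stationary_markov: "fair_measure m stationary_markov"
  unfolding fair_measure_def
proof (intro conjI allI ballI impI invariant_stationary_markov)
  fix j B i
  assume "B \<in> sets stationary_markov" and Bj: "B \<subseteq> cylinder m [j]" and ij: "m i j = 1"
  then have B: "B \<in> sets (shift_borel m)" by (simp only: sets_stationary_markov)
  then have Bp: "B \<in> sets path_space" by (simp add: sets_shift_borel_eq)
  have B0: "s 0 = j" if "s \<in> B" for s using that Bj by (auto simp: cylinder_def)
  have pre: "left_shift -` B \<in> sets path_space"
    using measurable_sets[OF measurable_left_shift Bp] by simp
  let ?A = "path_cyl [i] \<inter> left_shift -` B"
  have A: "?A \<in> sets path_space" using pre by auto
  have "cylinder m [i] \<inter> left_shift -` B = ?A \<inter> shift_space m"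
    by (auto simp: cylinder_eq_path_cyl)
  then have "measure stationary_markov (cylinder m [i] \<inter> left_shift -` B) = measure reversed_law ?A"
    by (simp add: measure_stationary_markov sets_shift_borel_Int[OF A] measure_reversed_law_Int_shift_space[OF A])
  also have "\<dots> = pmf p i * measure (chain reversed_kernel i) ?A"
    by (rule measure_start_bind_chain[OF A]) (auto simp: path_cyl_def)
  also have "measure (chain reversed_kernel i) ?A = measure (measure_pmf (reversed_kernel i) \<bind> chain reversed_kernel) B"
  proof -
    have "measure (chain reversed_kernel i) ?A = measure (chain reversed_kernel i) (left_shift -` B)"
      using chain_start[where K=reversed_kernel and x=i] A pre
      by (intro finite_measure.finite_measure_eq_AE prob_space.finite_measure prob_space_chain)
         (auto simp: path_cyl_def elim!: eventually_mono)
    also have "\<dots> = measure (distr (chain reversed_kernel i) path_space left_shift) B"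
      by (subst measure_distr) (use Bp in auto)
    finally show ?thesis by (simp only: left_shift_chain)
  qed
  also have "\<dots> = pmf (reversed_kernel i) j * measure (chain reversed_kernel j) B"
    by (rule measure_start_bind_chain[where i=j, OF Bp]) (rule B0)
  finally have "measure stationary_markov (cylinder m [i] \<inter> left_shift -` B)
      = pmf p i * pmf (reversed_kernel i) j * measure (chain reversed_kernel j) B" by simp
  also have "pmf p i * pmf (reversed_kernel i) j = pmf p j * Q j i"
    using positive[of i] by (simp add: pmf_reversed_kernel pmf_backward_kernel)
  also have "\<dots> * measure (chain reversed_kernel j) B = pmf p j * measure (chain reversed_kernel j) B / column_sum m j"
    by (simp add: backward_matrix_def ij)
  also have "pmf p j * measure (chain reversed_kernel j) B = measure reversed_law B"
    by (rule measure_start_bind_chain[where i=j, OF Bp, symmetric]) (rule B0)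
  also have "\<dots> = measure stationary_markov B" by (simp add: measure_stationary_markov[OF B])
  finally show "measure stationary_markov (cylinder m [i] \<inter> left_shift -` B) = measure stationary_markov B / column_sum m j" .
qed

text \<open>Pushing the weight \<open>p\<close> through the word with \<open>p\<^sub>i p\<^sub>i\<^sub>j = p\<^sub>j q\<^sub>j\<^sub>i\<close> turns each transition around.\<close>

lemma word_prob_reversed:
  "pmf p x * word_prob reversed_kernel (x # w) = pmf p (last (x # w)) * word_prob K (rev (x # w))"
proof (induction w arbitrary: x)
  case (Cons y w)
  have r: "pmf p x * pmf (reversed_kernel x) y = pmf p y * pmf (K y) x"
    using positive[of x] by (simp add: pmf_reversed_kernel)
  have "pmf p x * word_prob reversed_kernel (x # y # w)
      = pmf p x * pmf (reversed_kernel x) y * word_prob reversed_kernel (y # w)" by simp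
  also have "\<dots> = pmf (K y) x * (pmf p y * word_prob reversed_kernel (y # w))" unfolding r by simp
  also have "\<dots> = pmf (K y) x * (pmf p (last (y # w)) * word_prob K (rev (y # w)))" by (simp only: Cons.IH)
  also have "\<dots> = pmf p (last (x # y # w)) * word_prob K (rev (x # y # w))"
    using word_prob_snoc[of "rev (y # w)" K x] by (simp add: mult_ac)
  finally show ?case .
qed simp

text \<open>The link between the two chains: a backward trajectory meets the cylinder of \<open>w\<close> when its letters spell \<open>w\<close> backwards.\<close>

lemma measure_cylinder_eq_reversed_word:
  assumes "w \<noteq> []"
  shows "measure stationary_markov (cylinder m w) = measure (measure_pmf p \<bind> chain K) (path_cyl (rev w))"
proof -
  obtain x v where w: "w = x # v" using assms by (cases w) auto
  obtain z u where zu: "rev w = z # u" using assms by (cases "rev w") auto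
  then have "z = last w" by (metis assms hd_rev list.sel(1))
  then show ?thesis
    unfolding zu measure_bind_chain_path_cyl unfolding w measure_stationary_markov_cylinder
    using word_prob_reversed[of x v] zu w by simp
qed

end

end

section \<open>Equidistribution from word frequencies\<close>

lemma borel_measurable_continuous_shift:
  fixes \<phi> :: "(nat \<Rightarrow> 'i::countable) \<Rightarrow> real"
  assumes "continuous_map (shift_topology m) euclideanreal \<phi>" and s: "sets \<mu> = sets (shift_borel m)"
  shows "\<phi> \<in> borel_measurable \<mu>"
proof (rule borel_measurableI)
  fix S :: "real set" assume "open S"
  then have "openin (shift_topology m) {x \<in> topspace (shift_topology m). \<phi> x \<in> S}"
    using assms(1) by (auto simp: continuous_map_def)
  then have "{x \<in> shift_space m. \<phi> x \<in> S} \<in> sets (shift_borel m)"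
    unfolding sets_shift_borel by (intro sigma_sets.Basic) (simp add: topspace_shift_topology)
  moreover have "\<phi> -` S \<inter> space \<mu> = {x \<in> shift_space m. \<phi> x \<in> S}"
    using sets_eq_imp_space_eq[OF s] by auto
  ultimately show "\<phi> -` S \<inter> space \<mu> \<in> sets \<mu>" by (simp add: s)
qed

definition small_oscillation_words :: "('i \<Rightarrow> 'i \<Rightarrow> real) \<Rightarrow> ((nat \<Rightarrow> 'i) \<Rightarrow> real) \<Rightarrow> real \<Rightarrow> nat \<Rightarrow> 'i list set" where
  "small_oscillation_words m \<phi> e k = {w. length w = k \<and> cylinder m w \<noteq> {} \<and>
     (\<forall>x\<in>cylinder m w. \<forall>y\<in>cylinder m w. \<bar>\<phi> x - \<phi> y\<bar> \<le> e)}"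

lemma small_oscillation_cover:
  assumes cont: "continuous_map (shift_topology m) euclideanreal \<phi>" and e: "0 < e" and x: "x \<in> shift_space m"
  shows "\<exists>n. \<forall>k\<ge>n. x \<in> (\<Union>w\<in>small_oscillation_words m \<phi> e k. cylinder m w)"
proof -
  let ?S = "{\<phi> x - e/2 <..< \<phi> x + e/2}"
  have "openin (shift_topology m) {y \<in> topspace (shift_topology m). \<phi> y \<in> ?S}"
    using cont open_greaterThanLessThan[of "\<phi> x - e/2" "\<phi> x + e/2"] unfolding continuous_map_def by fastforce
  then obtain n where n: "\<forall>y\<in>shift_space m. (\<forall>k<n. y k = x k) \<longrightarrow> y \<in> {y \<in> topspace (shift_topology m). \<phi> y \<in> ?S}"
    using x e unfolding openin_shift_topology topspace_shift_topology by fastforce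
  have "x \<in> (\<Union>w\<in>small_oscillation_words m \<phi> e k. cylinder m w)" if "k \<ge> n" for k
  proof -
    let ?w = "map x [0..<k]"
    have xw: "x \<in> cylinder m ?w" using x by (simp add: cylinder_def)
    have near: "\<phi> y \<in> ?S" if "y \<in> cylinder m ?w" for y
    proof -
      have "y \<in> shift_space m" "\<forall>j<n. y j = x j" using that \<open>k \<ge> n\<close> by (auto simp: cylinder_def)
      then show ?thesis using n by blast
    qed
    have "?w \<in> small_oscillation_words m \<phi> e k"
      unfolding small_oscillation_words_def
    proof (intro CollectI conjI ballI)
      fix y z assume "y \<in> cylinder m ?w" "z \<in> cylinder m ?w"
      then show "\<bar>\<phi> y - \<phi> z\<bar> \<le> e" using near[of y] near[of z] by auto
    qed (use xw in auto)
    with xw show ?thesis by blast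
  qed
  then show ?thesis by blast
qed

text \<open>Cylinders on which \<open>\<phi>\<close> oscillates little and which have a common length are disjoint, and finitely many of them have almost
  full measure. There \<open>\<phi>\<close> is close to a combination \<open>\<psi>\<close> of their indicators. The remaining cylinders contribute
  little to the averages as well, since the frequencies of the chosen ones add up to almost one.\<close>

theorem equidistributes_if_word_frequencies:
  fixes m :: "'i::countable \<Rightarrow> 'i \<Rightarrow> real" and y :: "nat \<Rightarrow> nat \<Rightarrow> 'i"
  assumes \<mu>: "prob_space \<mu>" and s: "sets \<mu> = sets (shift_borel m)" and y: "\<And>n. y n \<in> shift_space m"
    and freq: "\<And>w. w \<noteq> [] \<Longrightarrow> (\<lambda>N. (\<Sum>n<N. indicator (cylinder m w) (y n)) / real N) \<longlonglongrightarrow> measure \<mu> (cylinder m w)"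
  shows "equidistributes m \<mu> y"
  unfolding equidistributes_def
proof (intro allI impI)
  fix \<phi> :: "(nat \<Rightarrow> 'i) \<Rightarrow> real"
  assume "continuous_map (shift_topology m) euclideanreal \<phi> \<and> bounded (\<phi> ` shift_space m)"
  then have cont: "continuous_map (shift_topology m) euclideanreal \<phi>" and bdd: "bounded (\<phi> ` shift_space m)"
    by auto
  interpret prob_space \<mu> by fact
  have sp: "space \<mu> = shift_space m" using sets_eq_imp_space_eq[OF s] by simp
  have \<phi>m [measurable]: "\<phi> \<in> borel_measurable \<mu>"
    by (rule borel_measurable_continuous_shift[OF cont s])
  obtain B where B: "\<And>x. x \<in> shift_space m \<Longrightarrow> \<bar>\<phi> x\<bar> \<le> B" and B0: "0 < B"
    using bdd unfolding bounded_pos by auto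
  have cyl [measurable]: "cylinder m w \<in> sets \<mu>" for w by (simp add: s)
  have int\<phi>: "integrable \<mu> \<phi>"
    by (rule integrable_const_bound[where B=B]) (use B sp in auto)
  show "(\<lambda>N. (\<Sum>n<N. \<phi> (y n)) / real N) \<longlonglongrightarrow> (\<integral>x. \<phi> x \<partial>\<mu>)"
  proof (rule LIMSEQ_I)
    fix e' :: real assume e': "0 < e'"
    \<comment> \<open>The three errors below add up to at most \<open>(3 + 2 * B) * e\<close>.\<close>
    define e where "e = e' / (4 + 2 * B)"
    have e: "0 < e" using e' B0 by (simp add: e_def)
    let ?W = "small_oscillation_words m \<phi> e"
    let ?U = "\<lambda>G. \<Union>w\<in>G. cylinder m w"
    have mU: "?U G \<in> sets \<mu>" for G by (intro sets.countable_UN') auto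
    \<comment> \<open>Cylinders of small oscillation and a common length fill almost all of the space.\<close>
    have "\<exists>k\<ge>1. 1 - e / 2 < prob (?U (?W k))"
    proof -
      \<comment> \<open>Small oscillation on a prefix persists on longer prefixes, so each point lies in the unions for all large \<open>k\<close>.\<close>
      let ?L = "\<lambda>n. \<Inter>k\<in>{n..}. ?U (?W k)"
      have mL: "?L n \<in> sets \<mu>" for n by (intro sets.countable_INT' mU) auto
      have "(\<lambda>n. prob (?L n)) \<longlonglongrightarrow> prob (\<Union>n. ?L n)"
        by (rule finite_Lim_measure_incseq) (use mL in \<open>auto simp: incseq_def\<close>)
      moreover have "(\<Union>n. ?L n) = space \<mu>"
      proof (intro equalityI subsetI)
        fix x assume "x \<in> space \<mu>"
        then obtain n where "\<forall>k\<ge>n. x \<in> ?U (?W k)" using small_oscillation_cover[OF cont e, of x] sp by blast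
        then show "x \<in> (\<Union>n. ?L n)" by blast
      qed (use sets.sets_into_space[OF mL] in blast)
      ultimately have "(\<lambda>n. prob (?L n)) \<longlonglongrightarrow> 1" by (simp add: prob_space)
      then have "eventually (\<lambda>n. 1 - e / 2 < prob (?L n)) sequentially"
        by (rule order_tendstoD) (use e in simp)
      then obtain k where "k \<ge> 1" "1 - e / 2 < prob (?L k)"
        unfolding eventually_sequentially by (meson nat_le_linear order_trans)
      moreover have "prob (?L k) \<le> prob (?U (?W k))" by (rule finite_measure_mono) (use mU in auto)
      ultimately show ?thesis by (intro exI[of _ k]) auto
    qed
    then obtain k where k: "k \<ge> 1" "1 - e / 2 < prob (?U (?W k))" by blast
    \<comment> \<open>Finitely many of them already do.\<close>
    have "\<exists>F. finite F \<and> F \<subseteq> ?W k \<and> 1 - e < prob (?U F)"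
    proof -
      let ?F = "\<lambda>n. {w \<in> ?W k. to_nat w \<le> n}"
      have fin: "finite (?F n)" for n
        by (rule finite_subset[OF _ finite_vimageI[of "{..n}" to_nat]]) auto
      have "(\<lambda>n. prob (?U (?F n))) \<longlonglongrightarrow> prob (\<Union>n. ?U (?F n))"
        by (rule finite_Lim_measure_incseq) (use mU in \<open>auto simp: incseq_def intro: le_trans\<close>)
      moreover have "(\<Union>n. ?U (?F n)) = ?U (?W k)" by auto
      ultimately have "eventually (\<lambda>n. 1 - e < prob (?U (?F n))) sequentially"
        using k e by (intro order_tendstoD(1)[of _ "prob (?U (?W k))"]) auto
      then obtain n where "1 - e < prob (?U (?F n))" by (auto simp: eventually_sequentially)
      with fin show ?thesis by (intro exI[of _ "?F n"]) auto
    qed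
    then obtain F where F: "finite F" "F \<subseteq> ?W k" "1 - e < prob (?U F)" by blast
    have Fw: "w \<noteq> []" "length w = k" "cylinder m w \<noteq> {}" if "w \<in> F" for w
      using that F(2) k(1) by (auto simp: small_oscillation_words_def)
    define c where "c w = (SOME x. x \<in> cylinder m w)" for w
    have c: "c w \<in> cylinder m w" if "w \<in> F" for w
    proof -
      have "\<exists>x. x \<in> cylinder m w" using Fw(3)[OF that] by blast
      then show ?thesis unfolding c_def by (rule someI_ex)
    qed
    define \<psi> where "\<psi> x = (\<Sum>w\<in>F. \<phi> (c w) * indicator (cylinder m w) x)" for x
    define \<rho> where "\<rho> x = (\<Sum>w\<in>F. indicator (cylinder m w) x :: real)" for x
    have disj: "v = w" if "x \<in> cylinder m v" "x \<in> cylinder m w" "v \<in> F" "w \<in> F" for v w x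
      using that Fw(2)[of v] Fw(2)[of w] by (auto simp: cylinder_def list_eq_iff_nth_eq)
    have approx: "\<bar>\<phi> x - \<psi> x\<bar> \<le> e + B * (1 - \<rho> x)" if x: "x \<in> shift_space m" for x
    proof (cases "\<exists>w\<in>F. x \<in> cylinder m w")
      case True
      then obtain w where w: "w \<in> F" "x \<in> cylinder m w" by blast
      have ind: "indicator (cylinder m v) x = (if v = w then 1 else 0 :: real)" if "v \<in> F" for v
      proof (cases "v = w")
        case True then show ?thesis using w by simp
      next
        case False
        then have "x \<notin> cylinder m v" using disj[OF _ w(2) that w(1)] by blast
        then show ?thesis using False by simp
      qed
      have "\<psi> x = (\<Sum>v\<in>F. if v = w then \<phi> (c v) else 0)"
        unfolding \<psi>_def by (intro sum.cong refl) (simp add: ind)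
      then have "\<psi> x = \<phi> (c w)" using F(1) w by simp
      moreover have "\<rho> x = 1"
        unfolding \<rho>_def using F(1) w by (simp add: ind cong: sum.cong)
      moreover have "\<bar>\<phi> x - \<phi> (c w)\<bar> \<le> e"
        using F(2) w c[OF w(1)] by (auto simp: small_oscillation_words_def)
      ultimately show ?thesis by simp
    next
      case False
      then have "\<psi> x = 0" "\<rho> x = 0" unfolding \<psi>_def \<rho>_def by (auto intro!: sum.neutral)
      then show ?thesis using B[OF x] e by simp
    qed
    have cyl_Int: "cylinder m w \<inter> shift_space m = cylinder m w" for w by (auto simp: cylinder_def)
    have int_ind: "integrable \<mu> (\<lambda>x. indicator (cylinder m w) x :: real)" for w
      by (rule integrable_const_bound[where B=1]) auto
    have int\<psi>: "integrable \<mu> \<psi>" and int\<rho>: "integrable \<mu> \<rho>"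
      unfolding \<psi>_def \<rho>_def using int_ind by auto
    have \<psi>I: "(\<integral>x. \<psi> x \<partial>\<mu>) = (\<Sum>w\<in>F. \<phi> (c w) * prob (cylinder m w))"
      unfolding \<psi>_def using int_ind by (subst Bochner_Integration.integral_sum) (auto simp: sp cyl_Int)
    have \<rho>I: "(\<integral>x. \<rho> x \<partial>\<mu>) = (\<Sum>w\<in>F. prob (cylinder m w))"
      unfolding \<rho>_def using int_ind by (subst Bochner_Integration.integral_sum) (auto simp: sp cyl_Int)
    have "prob (?U F) = (\<Sum>w\<in>F. prob (cylinder m w))"
      by (rule finite_measure_finite_Union[OF F(1)]) (use disj in \<open>auto simp: disjoint_family_on_def\<close>)
    then have \<rho>large: "1 - e < (\<integral>x. \<rho> x \<partial>\<mu>)" using F(3) \<rho>I by simp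
    have "\<bar>(\<integral>x. \<phi> x \<partial>\<mu>) - (\<integral>x. \<psi> x \<partial>\<mu>)\<bar> = \<bar>\<integral>x. \<phi> x - \<psi> x \<partial>\<mu>\<bar>"
      using int\<phi> int\<psi> by simp
    also have "\<dots> \<le> (\<integral>x. \<bar>\<phi> x - \<psi> x\<bar> \<partial>\<mu>)" by (rule integral_abs_bound)
    also have "\<dots> \<le> (\<integral>x. e + B * (1 - \<rho> x) \<partial>\<mu>)"
      using int\<phi> int\<psi> int\<rho> approx by (intro integral_mono) (auto simp: sp)
    also have "\<dots> = e + B * (1 - (\<integral>x. \<rho> x \<partial>\<mu>))"
      using int\<rho> by (simp add: prob_space)
    also have "\<dots> \<le> e + B * e"
      using \<rho>large B0 by (intro add_left_mono mult_left_mono) auto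
    finally have I: "\<bar>(\<integral>x. \<phi> x \<partial>\<mu>) - (\<integral>x. \<psi> x \<partial>\<mu>)\<bar> \<le> e + B * e" .
    have av\<psi>: "(\<lambda>N. (\<Sum>n<N. \<psi> (y n)) / real N) \<longlonglongrightarrow> (\<integral>x. \<psi> x \<partial>\<mu>)"
    proof -
      have "(\<lambda>N. \<Sum>w\<in>F. \<phi> (c w) * ((\<Sum>n<N. indicator (cylinder m w) (y n)) / real N))
          \<longlonglongrightarrow> (\<Sum>w\<in>F. \<phi> (c w) * prob (cylinder m w))"
        by (intro tendsto_sum tendsto_mult tendsto_const freq Fw)
      moreover have "(\<Sum>w\<in>F. \<phi> (c w) * ((\<Sum>n<N. indicator (cylinder m w) (y n)) / real N)) = (\<Sum>n<N. \<psi> (y n)) / real N" for N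
      proof -
        have "(\<Sum>n<N. \<psi> (y n)) = (\<Sum>w\<in>F. \<phi> (c w) * (\<Sum>n<N. indicator (cylinder m w) (y n)))"
          unfolding \<psi>_def by (subst sum.swap) (simp only: sum_distrib_left)
        then show ?thesis by (simp only: sum_divide_distrib[of _ F] times_divide_eq_right)
      qed
      ultimately show ?thesis by (simp add: \<psi>I)
    qed
    have av\<rho>: "(\<lambda>N. (\<Sum>n<N. \<rho> (y n)) / real N) \<longlonglongrightarrow> (\<integral>x. \<rho> x \<partial>\<mu>)"
    proof -
      have "(\<lambda>N. \<Sum>w\<in>F. (\<Sum>n<N. indicator (cylinder m w) (y n)) / real N)
          \<longlonglongrightarrow> (\<Sum>w\<in>F. prob (cylinder m w))"
        by (intro tendsto_sum freq Fw)
      moreover have "(\<Sum>w\<in>F. (\<Sum>n<N. indicator (cylinder m w) (y n)) / real N) = (\<Sum>n<N. \<rho> (y n)) / real N" for N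
      proof -
        have "(\<Sum>n<N. \<rho> (y n)) = (\<Sum>w\<in>F. \<Sum>n<N. indicator (cylinder m w) (y n))"
          unfolding \<rho>_def by (rule sum.swap)
        then show ?thesis by (simp only: sum_divide_distrib[of _ F])
      qed
      ultimately show ?thesis by (simp add: \<rho>I)
    qed
    have "eventually (\<lambda>N. 1 - e < (\<Sum>n<N. \<rho> (y n)) / real N) sequentially"
      by (rule order_tendstoD(1)[OF av\<rho> \<rho>large])
    moreover have "eventually (\<lambda>N. dist ((\<Sum>n<N. \<psi> (y n)) / real N) (\<integral>x. \<psi> x \<partial>\<mu>) < e) sequentially"
      by (rule tendstoD[OF av\<psi> e])
    ultimately have "eventually (\<lambda>N. norm ((\<Sum>n<N. \<phi> (y n)) / real N - (\<integral>x. \<phi> x \<partial>\<mu>)) < e') sequentially"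
      using eventually_gt_at_top[of 0]
    proof eventually_elim
      case (elim N)
      have "\<bar>(\<Sum>n<N. \<phi> (y n)) - (\<Sum>n<N. \<psi> (y n))\<bar> \<le> (\<Sum>n<N. \<bar>\<phi> (y n) - \<psi> (y n)\<bar>)"
        by (simp add: sum_subtractf[symmetric])
      also have "\<dots> \<le> (\<Sum>n<N. e + B * (1 - \<rho> (y n)))" by (intro sum_mono approx y)
      also have "\<dots> = real N * e + B * (real N - (\<Sum>n<N. \<rho> (y n)))"
        by (simp add: sum.distrib sum_distrib_left[symmetric] sum_subtractf)
      finally have "\<bar>(\<Sum>n<N. \<phi> (y n)) - (\<Sum>n<N. \<psi> (y n))\<bar> / real N
          \<le> (real N * e + B * (real N - (\<Sum>n<N. \<rho> (y n)))) / real N"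
        by (intro divide_right_mono) auto
      also have "\<dots> = e + B * (1 - (\<Sum>n<N. \<rho> (y n)) / real N)"
        using elim(3) by (simp add: field_simps)
      also have "\<dots> \<le> e + B * e"
        using elim(1) B0 by (intro add_left_mono mult_left_mono) auto
      finally have "\<bar>(\<Sum>n<N. \<phi> (y n)) / real N - (\<Sum>n<N. \<psi> (y n)) / real N\<bar> \<le> e + B * e"
        by (simp add: diff_divide_distrib[symmetric])
      then have "\<bar>(\<Sum>n<N. \<phi> (y n)) / real N - (\<integral>x. \<phi> x \<partial>\<mu>)\<bar> < (e + B * e) + e + (e + B * e)"
        using elim(2) I by (simp add: dist_real_def)
      also have "\<dots> = e * (3 + 2 * B)" by (simp add: algebra_simps)
      also have "\<dots> < e * (4 + 2 * B)" using e by simp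
      also have "\<dots> = e'" using B0 by (simp add: e_def)
      finally show ?case by simp
    qed
    then show "\<exists>N0. \<forall>N\<ge>N0. norm ((\<Sum>n<N. \<phi> (y n)) / real N - (\<integral>x. \<phi> x \<partial>\<mu>)) < e'"
      by (simp add: eventually_sequentially)
  qed
qed

text \<open>The trajectory has spelled a full word of length \<open>k + 1\<close> only from time \<open>k\<close> on; such a delay shifts the sums by at most \<open>k\<close>.\<close>

lemma average_delayed:
  fixes a b :: "nat \<Rightarrow> real"
  assumes a: "\<And>n. 0 \<le> a n" "\<And>n. a n \<le> 1" and b: "\<And>n. a (n + k) = b n"
    and lim: "(\<lambda>N. (\<Sum>n<N. b n) / real N) \<longlonglongrightarrow> L"
  shows "(\<lambda>N. (\<Sum>n<N. a n) / real N) \<longlonglongrightarrow> L"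
proof -
  have le: "\<bar>(\<Sum>n<N. a n) - (\<Sum>n<N. b n)\<bar> \<le> real k" for N
  proof -
    have "(\<Sum>n<N + k. a n) = (\<Sum>n<N. a n) + (\<Sum>j<k. a (N + j))" by (rule sum_lessThan_add)
    moreover have "(\<Sum>n<k + N. a n) = (\<Sum>n<k. a n) + (\<Sum>n<N. b n)"
      unfolding sum_lessThan_add b[symmetric] by (simp only: add.commute[of k])
    moreover have "(\<Sum>n<N + k. a n) = (\<Sum>n<k + N. a n)" by (simp only: add.commute[of N k])
    ultimately have "(\<Sum>n<N. a n) - (\<Sum>n<N. b n) = (\<Sum>n<k. a n) - (\<Sum>j<k. a (N + j))"
      by linarith
    moreover have "0 \<le> (\<Sum>n<k. a n)" "0 \<le> (\<Sum>j<k. a (N + j))" by (auto intro: sum_nonneg a)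
    moreover have "(\<Sum>n<k. a n) \<le> real k" "(\<Sum>j<k. a (N + j)) \<le> real k"
      using sum_bounded_above[of "{..<k}" a 1, OF a(2)]
        sum_bounded_above[of "{..<k}" "\<lambda>j. a (N + j)" 1, OF a(2)] by auto
    ultimately show ?thesis by linarith
  qed
  have "(\<lambda>N. ((\<Sum>n<N. a n) - (\<Sum>n<N. b n)) / real N) \<longlonglongrightarrow> 0"
  proof (rule Lim_null_comparison[OF _ lim_const_over_n[of "real k"]])
    show "\<forall>\<^sub>F N in sequentially. norm (((\<Sum>n<N. a n) - (\<Sum>n<N. b n)) / real N) \<le> real k / real N"
      using le by (intro always_eventually allI) (simp add: divide_right_mono)
  qed
  from tendsto_add[OF this lim] show ?thesis by (simp add: add_divide_distrib[symmetric])
qed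

section \<open>The three regimes\<close>

context backward_trajectory
begin

lemma Y_in_cylinder_iff:
  assumes eq: "Y (n + k) \<omega> = glue (\<lambda>k. Y k \<omega> 0) (n + k)" and \<omega>: "\<omega> \<in> space \<Omega>" and w: "length w = Suc k"
  shows "Y (n + k) \<omega> \<in> cylinder m w \<longleftrightarrow> (left_shift ^^ n) (\<lambda>k. Y k \<omega> 0) \<in> path_cyl (rev w)"
proof -
  have "Y (n + k) \<omega> \<in> cylinder m w \<longleftrightarrow> (\<forall>j<Suc k. Y (n + k) \<omega> j = w ! j)"
    using Y_in_shift_space[OF \<omega>] w by (simp add: cylinder_def)
  also have "\<dots> \<longleftrightarrow> (\<forall>j<Suc k. Y (n + (k - j)) \<omega> 0 = w ! j)"
    by (subst eq) (auto simp: glue_def)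
  also have "\<dots> \<longleftrightarrow> (\<forall>j<Suc k. Y (n + j) \<omega> 0 = w ! (k - j))"
  proof (intro iffI allI impI)
    fix j assume *: "\<forall>j<Suc k. Y (n + (k - j)) \<omega> 0 = w ! j" and "j < Suc k"
    then show "Y (n + j) \<omega> 0 = w ! (k - j)" using *[rule_format, of "k - j"] by simp
  next
    fix j assume *: "\<forall>j<Suc k. Y (n + j) \<omega> 0 = w ! (k - j)" and "j < Suc k"
    then show "Y (n + (k - j)) \<omega> 0 = w ! j" using *[rule_format, of "k - j"] by simp
  qed
  also have "\<dots> \<longleftrightarrow> (left_shift ^^ n) (\<lambda>k. Y k \<omega> 0) \<in> path_cyl (rev w)"
    using w by (simp add: path_cyl_def left_shift_funpow rev_nth)
  finally show ?thesis .
qed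

lemma Y_in_letter_cylinder: "\<omega> \<in> space \<Omega> \<Longrightarrow> Y n \<omega> \<in> cylinder m [i] \<longleftrightarrow> Y n \<omega> 0 = i"
  using Y_in_shift_space[of \<omega> n] by (simp add: cylinder_def)

theorem equidistribution:
  assumes rec: "\<And>a. certain_return K a" and p: "bind_pmf p K = p" "\<And>i. 0 < pmf p i"
  shows "AE \<omega> in \<Omega>. equidistributes m (stationary_markov p) (\<lambda>n. Y n \<omega>)"
proof -
  let ?M = "measure_pmf p \<bind> chain K"
  have "AE s in chain K (y0 0). \<forall>v. (\<lambda>N. (\<Sum>n<N. indicator (path_cyl v) ((left_shift ^^ n) s)) / real N)
      \<longlonglongrightarrow> measure ?M (path_cyl v)"
    unfolding AE_all_countable
  proof
    fix v
    have "sets ?M = sets path_space" by (rule started_chain)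
    then have "(\<integral>s. indicator (path_cyl v) s \<partial>?M) = measure ?M (path_cyl v)"
      using sets_eq_imp_space_eq[of ?M path_space] by simp
    then show "AE s in chain K (y0 0). (\<lambda>N. (\<Sum>n<N. indicator (path_cyl v) ((left_shift ^^ n) s)) / real N)
      \<longlonglongrightarrow> measure ?M (path_cyl v)"
      using ergodic_averages[OF irreducible_backward_kernel rec p(1), of "indicator (path_cyl v)" "y0 0"] by simp
  qed
  from AE_states[OF this] AE_Y_eq_glue AE_space show ?thesis
  proof eventually_elim
    case (elim \<omega>)
    show ?case
    proof (rule equidistributes_if_word_frequencies)
      show "prob_space (stationary_markov p)" by (rule prob_space_stationary_markov[OF p])
      show "sets (stationary_markov p) = sets (shift_borel m)" by (rule sets_stationary_markov[OF p])
      show "Y n \<omega> \<in> shift_space m" for n by (rule Y_in_shift_space[OF elim(3)])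
      fix w :: "'i list" assume w: "w \<noteq> []"
      then obtain k where k: "length w = Suc k" by (cases w) auto
      show "(\<lambda>N. (\<Sum>n<N. indicator (cylinder m w) (Y n \<omega>)) / real N) \<longlonglongrightarrow> measure (stationary_markov p) (cylinder m w)"
        unfolding measure_cylinder_eq_reversed_word[OF p w]
      proof (rule average_delayed[where k=k, OF _ _ _ elim(1)[rule_format, of "rev w"]])
        fix n
        show "indicator (cylinder m w) (Y (n + k) \<omega>) = (indicator (path_cyl (rev w)) ((left_shift ^^ n) (\<lambda>n. Y n \<omega> 0)) :: real)"
          using Y_in_cylinder_iff[OF elim(2)[rule_format] elim(3) k] by (simp add: indicator_def)
      qed auto
    qed
  qed
qed

lemma positive_word_prob:
  assumes "x \<in> cylinder m w" "w \<noteq> []"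
  shows "0 < word_prob K (rev w)"
proof -
  have x: "x \<in> shift_space m" and xw: "\<And>k. k < length w \<Longrightarrow> w ! k = x k"
    using assms by (auto simp: cylinder_def)
  show ?thesis
    unfolding word_prob_def
  proof (rule prod_pos)
    fix k assume "k \<in> {..<length (rev w) - 1}"
    then have k: "Suc k < length w" by auto
    let ?j = "length w - Suc (Suc k)"
    have j: "Suc ?j = length w - Suc k" using k by simp
    have "m (x ?j) (x (Suc ?j)) = 1" using x by (simp add: shift_space_def)
    then have "x ?j \<in> set_pmf (K (x (Suc ?j)))" by (simp add: set_backward_kernel predecessors_def)
    then have "0 < pmf (K (x (Suc ?j))) (x ?j)" by (rule pmf_positive)
    then show "0 < pmf (K (rev w ! k)) (rev w ! Suc k)"
      using k j by (simp add: rev_nth xw)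
  qed
qed

text \<open>It suffices to meet each nonempty cylinder, and there are countably many.\<close>

theorem dense_trajectory:
  assumes rec: "\<And>a. certain_return K a"
  shows "AE \<omega> in \<Omega>. dense_in_shift m (\<lambda>n. Y n \<omega>)"
proof -
  have "AE s in chain K (y0 0). \<forall>w\<in>{w. w \<noteq> [] \<and> cylinder m w \<noteq> {}}. \<exists>n. (left_shift ^^ n) s \<in> path_cyl (rev w)"
  proof (subst AE_ball_countable)
    show "\<forall>w\<in>{w. w \<noteq> [] \<and> cylinder m w \<noteq> {}}. AE s in chain K (y0 0). \<exists>n. (left_shift ^^ n) s \<in> path_cyl (rev w)"
    proof
      fix w assume w: "w \<in> {w. w \<noteq> [] \<and> cylinder m w \<noteq> {}}"
      obtain z u where zu: "rev w = z # u" using w by (cases "rev w") auto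
      have "0 < word_prob K (rev w)" using w positive_word_prob by blast
      then show "AE s in chain K (y0 0). \<exists>n. (left_shift ^^ n) s \<in> path_cyl (rev w)"
        unfolding zu by (rule word_visited[OF irreducible_backward_kernel rec])
    qed
  qed simp
  from AE_states[OF this] AE_Y_eq_glue AE_space show ?thesis
  proof eventually_elim
    case (elim \<omega>)
    have "x \<in> shift_topology m closure_of (range (\<lambda>n. Y n \<omega>))" if x: "x \<in> shift_space m" for x
      unfolding in_closure_of topspace_shift_topology
    proof (intro conjI x allI impI)
      fix U assume U: "x \<in> U \<and> openin (shift_topology m) U"
      then obtain n where n: "\<forall>z\<in>shift_space m. (\<forall>k<n. z k = x k) \<longrightarrow> z \<in> U"
        unfolding openin_shift_topology by blast
      let ?w = "map x [0..<Suc n]"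
      have "x \<in> cylinder m ?w" using x by (simp add: cylinder_def del: upt_Suc)
      then have "?w \<in> {w. w \<noteq> [] \<and> cylinder m w \<noteq> {}}" by auto
      then obtain t where "(left_shift ^^ t) (\<lambda>n. Y n \<omega> 0) \<in> path_cyl (rev ?w)" using elim(1) by blast
      then have "Y (t + n) \<omega> \<in> cylinder m ?w"
        using Y_in_cylinder_iff[OF elim(2)[rule_format] elim(3), of ?w n t] by simp
      then have "Y (t + n) \<omega> \<in> shift_space m" "\<forall>k<n. Y (t + n) \<omega> k = x k"
        by (auto simp: cylinder_def simp del: upt_Suc)
      then show "\<exists>z. z \<in> range (\<lambda>n. Y n \<omega>) \<and> z \<in> U" using n by blast
    qed
    moreover have "shift_topology m closure_of (range (\<lambda>n. Y n \<omega>)) \<subseteq> shift_space m"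
      using closure_of_subset_topspace[of "shift_topology m"] by (simp add: topspace_shift_topology)
    ultimately show ?case unfolding dense_in_shift_def by blast
  qed
qed

theorem zero_frequency:
  assumes "\<And>a. \<not> summable (\<lambda>n. survival K a n a)"
  shows "AE \<omega> in \<Omega>. \<forall>i. (\<lambda>N. real (card {n. n < N \<and> Y n \<omega> \<in> cylinder m [i]}) / real N) \<longlonglongrightarrow> 0"
proof -
  have "AE s in chain K (y0 0). \<forall>i. (\<lambda>N. (\<Sum>n<N. of_bool (s n = i)) / real N) \<longlonglongrightarrow> 0"
    unfolding AE_all_countable using visit_frequency_zero[OF assms] by blast
  from AE_states[OF this] AE_space show ?thesis
  proof eventually_elim
    case (elim \<omega>)
    have "real (card {n. n < N \<and> Y n \<omega> \<in> cylinder m [i]}) = (\<Sum>n<N. of_bool (Y n \<omega> 0 = i))" for N i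
    proof -
      have "{n. n < N \<and> Y n \<omega> \<in> cylinder m [i]} = {..<N} \<inter> {n. Y n \<omega> 0 = i}"
        using Y_in_letter_cylinder[OF elim(2)] by auto
      then show ?thesis by (simp add: sum_of_bool_eq)
    qed
    with elim(1) show ?case by simp
  qed
qed

theorem finitely_many_visits:
  assumes "\<And>a. \<not> certain_return K a"
  shows "AE \<omega> in \<Omega>. \<forall>i. finite {n. Y n \<omega> \<in> cylinder m [i]}"
proof -
  have "AE s in chain K (y0 0). \<forall>i. finite {n. s n = i}"
    unfolding AE_all_countable using transient_finite_visits[OF assms] by blast
  from AE_states[OF this] AE_space show ?thesis
    by eventually_elim (simp add: Y_in_letter_cylinder)
qed

end

theorem theorem4p1:
  fixes m :: "'i::countable \<Rightarrow> 'i \<Rightarrow> real"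
    and y0 :: "nat \<Rightarrow> 'i"
    and \<Omega> :: "'w measure"
    and Y :: "nat \<Rightarrow> 'w \<Rightarrow> (nat \<Rightarrow> 'i)"
  assumes "zero_one_matrix m"
    and "transitive_shift m"
    and "finite_column_sums m"
    and "y0 \<in> shift_space m"
    and "random_backward_trajectory m y0 \<Omega> Y"
  shows "(positive_recurrent (backward_matrix m) \<longrightarrow>
            (let Q = backward_matrix m;
                 \<pi> = stationary_vector Q;
                 P = reversed_matrix Q \<pi>;
                 \<mu> = markov_measure m \<pi> P
             in is_stationary Q \<pi> \<and> is_markov_measure m \<pi> P \<mu> \<and> fair_measure m \<mu> \<and>
                (AE \<omega> in \<Omega>. equidistributes m \<mu> (\<lambda>n. Y n \<omega>)))) \<and>
         (null_recurrent (backward_matrix m) \<longrightarrow>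
            (AE \<omega> in \<Omega>. dense_in_shift m (\<lambda>n. Y n \<omega>) \<and>
               (\<forall>i. (\<lambda>N. real (card {n. n < N \<and> Y n \<omega> \<in> cylinder m [i]}) / real N)
                      \<longlonglongrightarrow> 0))) \<and>
         (transient (backward_matrix m) \<longrightarrow>
            (AE \<omega> in \<Omega>. \<forall>i. finite {n. Y n \<omega> \<in> cylinder m [i]}))"
proof -
  interpret backward_trajectory m y0 \<Omega> Y
    using assms by unfold_locales
  show ?thesis
  proof (intro conjI impI)
    assume pos: "positive_recurrent (backward_matrix m)"
    then obtain p where p: "stationary_vector Q = pmf p" "bind_pmf p K = p" "\<And>i. 0 < pmf p i"
      by (rule stationary_vector_pmf) blast
    have "\<And>a. certain_return K a" using pos by (simp add: positive_recurrent_iff)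
    then show "let Q = backward_matrix m;
                 \<pi> = stationary_vector Q;
                 P = reversed_matrix Q \<pi>;
                 \<mu> = markov_measure m \<pi> P
             in is_stationary Q \<pi> \<and> is_markov_measure m \<pi> P \<mu> \<and> fair_measure m \<mu> \<and>
                (AE \<omega> in \<Omega>. equidistributes m \<mu> (\<lambda>n. Y n \<omega>))"
      unfolding Let_def p(1) markov_measure_eq[OF p(2,3)]
      using is_stationary_pmf[of p] p(2) is_markov_stationary_markov[OF p(2,3)]
        fair_stationary_markov[OF p(2,3)] equidistribution[OF _ p(2,3)] by blast
  next
    assume "null_recurrent (backward_matrix m)"
    then have "\<And>a. certain_return K a" "\<And>a. \<not> summable (\<lambda>n. survival K a n a)"
      by (auto simp: null_recurrent_iff)
    then show "AE \<omega> in \<Omega>. dense_in_shift m (\<lambda>n. Y n \<omega>) \<and>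
               (\<forall>i. (\<lambda>N. real (card {n. n < N \<and> Y n \<omega> \<in> cylinder m [i]}) / real N) \<longlonglongrightarrow> 0)"
      using dense_trajectory zero_frequency by (intro AE_conjI) blast+
  next
    assume "transient (backward_matrix m)"
    then show "AE \<omega> in \<Omega>. \<forall>i. finite {n. Y n \<omega> \<in> cylinder m [i]}"
      by (intro finitely_many_visits) (simp add: transient_iff)
  qed
qed

end
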